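(* Let $p$ be an odd prime, let $\mathbb F$ be a finite field of characteristic $p$, and let $m$ be an odd integer with $1\le m\le p-1$. Let $P=P(m,\mathbb F)=LQ$, and let $C$ and $W$ be the groups of $3\times 3$ matrices defined in the context. Then the following are equivalent: (a) there is a $p$-subgroup $W_0$ of $P$ and an isomorphism $N_{P/Z(P)}(W_0Z(P)/Z(P))\to C$ which maps $W_0Z(P)/Z(P)$ onto $W$; (b) $\mathbb F$ has prime order $p$ and $p=m+4$.
   Context: $V_m$ is the $(m+1)$-dimensional space of homogeneous polynomials of degree $m$ in $\mathbb F[X,Y]$. $L=\mathbb F^\times\times \mathrm{GL}_2(\mathbb F)$. For $A=\left(\begin{smallmatrix}\alpha&\beta\\\gamma&\delta\end{smallmatrix}\right)\in\mathrm{GL}_2(\mathbb F)$, $v\mapsto v\cdot A$ is the linear map on $V_m$ with $X^aY^b\cdot A=(\alpha X+\beta Y)^a(\gamma X+\delta Y)^b$ ($a+b=m$). The bilinear form $\beta_m$ on $V_m$ is given by $\beta_m(X^aY^b,X^cY^d)=0$ if $a\neq d$ and $\beta_m(X^aY^b,X^cY^d)=(-1)^a/\binom{m}{a}$ if $a=d$ (where $a+b=c+d=m$); it is non-degenerate and alternating. $Q=V_m\times\mathbb F$ with product $(v,y)(w,z)=(v+w,y+z+\beta_m(v,w))$ is a $p$-group. $L$ acts on $Q$ by automorphisms via $(v,z)^{(t,A)}=(t(v\cdot A),t^2(\det A)^m z)$, and $P=P(m,\mathbb F)=LQ$ is the corresponding semidirect product. (One has $Z(P)=C_L(Q)$, a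 group of order prime to $p$.) $C$ is the group of matrices $\left(\begin{smallmatrix}1&0&0\\\alpha&\theta&0\\\delta&\epsilon&\theta^{-1}\end{smallmatrix}\right)$ with $\alpha,\delta,\epsilon\in\mathbb F$, $\theta\in\mathbb F^\times$, and $W$ is its subgroup of matrices $\left(\begin{smallmatrix}1&0&0\\\alpha&1&0\\\delta&0&1\end{smallmatrix}\right)$ with $\alpha,\delta\in\mathbb F$. *)

theory Defs
  imports
    "HOL-Analysis.Determinants"
    "HOL-Computational_Algebra.Computational_Algebra"
    "HOL-Algebra.Group_Action"
begin

section \<open>Homogeneous polynomials in two variables\<close>

text \<open>
  The ring F[X,Y] is represented as F[X][Y], i.e. by the type \<open>'f poly poly\<close>: the outer variable
  is Y, the inner one is X.
\<close>

definition var_X :: "'f::field poly poly" where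
  "var_X = [:[:0, 1:]:]"

definition var_Y :: "'f::field poly poly" where
  "var_Y = [:0, 1:]"

definition scalar :: "'f::field \<Rightarrow> 'f poly poly" where
  "scalar c = [:[:c:]:]"

text \<open>The coefficient of \<open>X^a * Y^b\<close>.\<close>

definition coeff_XY :: "'f::field poly poly \<Rightarrow> nat \<Rightarrow> nat \<Rightarrow> 'f" where
  "coeff_XY v a b = coeff (coeff v b) a"

definition hom_polys :: "nat \<Rightarrow> 'f::field poly poly set" where
  "hom_polys m = {v. \<forall>a b. coeff_XY v a b \<noteq> 0 \<longrightarrow> a + b = m}"

text \<open>
  The right action of matrices: the linear extension to \<open>hom_polys m\<close> of
  \<open>X^a * Y^b \<mapsto> (\<alpha> X + \<beta> Y)^a * (\<gamma> X + \<delta> Y)^b\<close>, where \<open>\<alpha>, \<beta>\<close> is the first and \<open>\<gamma>, \<delta>\<close> the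
  second row of the matrix.
\<close>

definition mat_act :: "nat \<Rightarrow> 'f::field poly poly \<Rightarrow> 'f^2^2 \<Rightarrow> 'f poly poly" where
  "mat_act m v A =
     (\<Sum>a\<le>m. scalar (coeff_XY v a (m - a))
        * (scalar (A $ 1 $ 1) * var_X + scalar (A $ 1 $ 2) * var_Y) ^ a
        * (scalar (A $ 2 $ 1) * var_X + scalar (A $ 2 $ 2) * var_Y) ^ (m - a))"

text \<open>The value of the form on \<open>X^a * Y^(m - a)\<close> and \<open>X^c * Y^d\<close> depends on \<open>a\<close> and \<open>d\<close> only.\<close>

definition form_basis :: "nat \<Rightarrow> nat \<Rightarrow> nat \<Rightarrow> 'f::field" where
  "form_basis m a d = (if a = d then (- 1) ^ a / of_nat (m choose a) else 0)"

definition form :: "nat \<Rightarrow> 'f::field poly poly \<Rightarrow> 'f poly poly \<Rightarrow> 'f" where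
  "form m v w =
     (\<Sum>a\<le>m. \<Sum>c\<le>m. coeff_XY v a (m - a) * coeff_XY w c (m - c) * form_basis m a (m - c))"

lemma coeff_XY_monomial:
  "coeff_XY (var_X ^ a * var_Y ^ b :: 'f::field poly poly) i j = (if i = a \<and> j = b then 1 else 0)"
proof -
  have X: "var_X ^ a = ([:monom 1 a:] :: 'f poly poly)"
    by (induction a) (auto simp: var_X_def monom_Suc one_pCons)
  have Y: "var_Y ^ b = (monom 1 b :: 'f poly poly)"
    by (simp add: var_Y_def monom_altdef)
  show ?thesis
    unfolding X Y coeff_XY_def by simp
qed

lemma monomial_in_hom_polys:
  "a + b = m \<Longrightarrow> var_X ^ a * var_Y ^ b \<in> hom_polys m"
  by (simp add: hom_polys_def coeff_XY_monomial)

lemma mat_act_monomial: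
  assumes "a + b = m"
  shows "mat_act m (var_X ^ a * var_Y ^ b) A =
     (scalar (A $ 1 $ 1) * var_X + scalar (A $ 1 $ 2) * var_Y) ^ a
      * (scalar (A $ 2 $ 1) * var_X + scalar (A $ 2 $ 2) * var_Y) ^ b"
proof -
  have "m - a = b" "a \<le> m"
    using assms by auto
  moreover have "scalar (coeff_XY (var_X ^ a * var_Y ^ b :: 'a poly poly) i (m - i))
        = (if i = a then 1 else 0)" if "i \<le> m" for i
    using assms that by (auto simp: coeff_XY_monomial scalar_def one_pCons)
  ultimately show ?thesis
    by (simp add: mat_act_def if_distrib[of "\<lambda>x. x * _"] sum.delta cong: if_cong)
qed

lemma form_monomial:
  assumes "a + b = m" "c + d = m"
  shows "form m (var_X ^ a * var_Y ^ b) (var_X ^ c * var_Y ^ d) =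
    (if a = d then (- 1) ^ a / of_nat (m choose a) else (0 :: 'f::field))"
proof -
  have "coeff_XY (var_X ^ a * var_Y ^ b) i (m - i) = (if i = a then 1 else (0::'f))"
    and "coeff_XY (var_X ^ c * var_Y ^ d) i (m - i) = (if i = c then 1 else (0::'f))"
    if "i \<le> m" for i
    using assms that by (auto simp: coeff_XY_monomial)
  moreover have "m - c = d" "a \<le> m" "c \<le> m"
    using assms by auto
  ultimately have "form m (var_X ^ a * var_Y ^ b) (var_X ^ c * var_Y ^ d) =
      (\<Sum>i\<le>m. \<Sum>j\<le>m. if i = a then if j = c then form_basis m a d else 0 else (0::'f))"
    by (auto simp: form_def intro!: sum.cong)
  also have "\<dots> = (\<Sum>i\<le>m. if i = a then form_basis m a d else 0)"
    using \<open>c \<le> m\<close> by (intro sum.cong) auto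
  also have "\<dots> = form_basis m a d"
    using \<open>a \<le> m\<close> by simp
  finally show ?thesis
    by (simp add: form_basis_def)
qed


section \<open>The group \<open>P(m, F)\<close>\<close>

definition units_group :: "'f::field monoid" where
  "units_group = \<lparr>carrier = UNIV - {0}, mult = (*), one = 1\<rparr>"

definition GL2 :: "('f::field^2^2) monoid" where
  "GL2 = \<lparr>carrier = {A. invertible A}, mult = (**), one = mat 1\<rparr>"

definition L_group :: "('f::field \<times> ('f^2^2)) monoid" where
  "L_group = units_group \<times>\<times> GL2"

definition Q_group :: "nat \<Rightarrow> ('f::field poly poly \<times> 'f) monoid" where
  "Q_group m = \<lparr>carrier = hom_polys m \<times> UNIV,
     mult = (\<lambda>(v, y) (w, z). (v + w, y + z + form m v w)),
     one = (0, 0)\<rparr>"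

definition Q_act :: "nat \<Rightarrow> 'f::field poly poly \<times> 'f \<Rightarrow> 'f \<times> ('f^2^2) \<Rightarrow> 'f poly poly \<times> 'f" where
  "Q_act m = (\<lambda>(v, z) (t, A). (scalar t * mat_act m v A, t\<^sup>2 * det A ^ m * z))"

text \<open>
  The pair \<open>(l, q)\<close> stands for the product \<open>l q\<close>. As \<open>q^l = l^(-1) q l\<close> is a right action,
  \<open>(l q) (l' q') = (l l') (q^l' q')\<close>.
\<close>

definition semidirect ::
  "'l monoid \<Rightarrow> 'q monoid \<Rightarrow> ('q \<Rightarrow> 'l \<Rightarrow> 'q) \<Rightarrow> ('l \<times> 'q) monoid" where
  "semidirect L Q act = \<lparr>carrier = carrier L \<times> carrier Q,
     mult = (\<lambda>(l, q) (l', q'). (l \<otimes>\<^bsub>L\<^esub> l', act q l' \<otimes>\<^bsub>Q\<^esub> q')),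
     one = (\<one>\<^bsub>L\<^esub>, \<one>\<^bsub>Q\<^esub>)\<rparr>"

definition P_group :: "nat \<Rightarrow> (('f::field \<times> ('f^2^2)) \<times> ('f poly poly \<times> 'f)) monoid" where
  "P_group m = semidirect L_group (Q_group m) (Q_act m)"


section \<open>The matrix groups \<open>C\<close> and \<open>W\<close>\<close>

definition C_mat :: "'f::field \<Rightarrow> 'f \<Rightarrow> 'f \<Rightarrow> 'f \<Rightarrow> 'f^3^3" where
  "C_mat \<alpha> \<theta> \<delta> \<epsilon> =
     vector [vector [1, 0, 0],
             vector [\<alpha>, \<theta>, 0],
             vector [\<delta>, \<epsilon>, inverse \<theta>]]"

definition C_group :: "('f::field^3^3) monoid" where
  "C_group = \<lparr>carrier = {C_mat \<alpha> \<theta> \<delta> \<epsilon> | \<alpha> \<theta> \<delta> \<epsilon>. \<theta> \<noteq> 0}, mult = (**), one = mat 1\<rparr>"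

definition W_subgroup :: "('f::field^3^3) set" where
  "W_subgroup = {C_mat \<alpha> 1 \<delta> 0 | \<alpha> \<delta>. True}"


section \<open>Notions from group theory\<close>

definition center :: "('a, 'b) monoid_scheme \<Rightarrow> 'a set" where
  "center G = {z \<in> carrier G. \<forall>g \<in> carrier G. z \<otimes>\<^bsub>G\<^esub> g = g \<otimes>\<^bsub>G\<^esub> z}"

definition p_subgroup :: "nat \<Rightarrow> 'a set \<Rightarrow> ('a, 'b) monoid_scheme \<Rightarrow> bool" where
  "p_subgroup p H G \<longleftrightarrow> subgroup H G \<and> (\<exists>k. card H = p ^ k)"

text \<open>\<open>H N / N\<close>, a set of cosets, as a subset of the carrier of \<open>G Mod N\<close>.\<close>

definition image_Mod :: "('a, 'b) monoid_scheme \<Rightarrow> 'a set \<Rightarrow> 'a set \<Rightarrow> 'a set set" where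
  "image_Mod G H N = (\<lambda>g. N #>\<^bsub>G\<^esub> g) ` (H <#>\<^bsub>G\<^esub> N)"

end

theory Submission
  imports Defs "HOL-Algebra.Zassenhaus" "HOL-Number_Theory.Residues"
begin

unbundle no fps_syntax
hide_const (open) up_ring.monom up_ring.coeff

text \<open>
  An isomorphism \<open>N(W0 Z/Z) \<rightarrow> C\<close> forces \<open>Z(Q) \<subseteq> W0\<close>, since \<open>W\<close> is its own centralizer in \<open>C\<close>,
  and \<open>W0\<close> is not contained in \<open>Q\<close>, since \<open>- 1\<close> inverts \<open>V\<close> but centralizes \<open>Z(Q)\<close> while the
  involutions of \<open>C\<close> invert \<open>W\<close>. After conjugation, the elements of \<open>W0\<close> lie over matrices
  \<open>(1 0; g 1)\<close>, and as they commute with each other, the coefficient of \<open>Y^m\<close> in their \<open>V\<close>-part is a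
  multiple of \<open>g\<close>. Hence an element of the normalizer lying over \<open>(t, (a 0; c d))\<close> satisfies
  \<open>t d^m = a / d\<close> and acts on \<open>Z(Q)\<close> as \<open>x^(m + 2)\<close> with \<open>x = a / d\<close>. Comparison with the torus of
  \<open>C\<close>, which acts on \<open>W\<close> with the two weights \<open>\<theta>\<close> and \<open>1 / \<theta>\<close>, yields an additive bijection of \<open>F\<close>
  with \<open>y^(m + 2) \<mapsto> 1 / y\<close>. Counting roots of polynomials, this is only possible for \<open>|F| = p = m + 4\<close>
  or for \<open>p = 3\<close>, \<open>m = 1\<close>, and in the latter case the elements of \<open>W0\<close> outside \<open>Q\<close> would not have
  order 3.

  Conversely, for \<open>|F| = p = m + 4\<close>, an explicit embedding of \<open>C\<close> into \<open>P\<close> complements \<open>Z(P)\<close> in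
  the normalizer of the image of \<open>W\<close>; it is built on the one-parameter subgroup of \<open>P\<close> whose
  \<open>V\<close>-part is the integral of \<open>(Y + r X)^m dr\<close>.
\<close>

section \<open>The action on binary forms\<close>

text \<open>The coefficient of Y^m is decisive because it is the value of the form against X^m. If
  it vanished on all of W0, then X^m, which lower shears fix, would centralize W0 and so lie in W0.
  But W0 meets Q only in Z(Q): the torus of C moves any nonzero \<alpha> to any other, while its
  lift merely rescales the entry g. Hence the coefficient is nonzero for some element of W0, and
  only this ties t to a and d. The exponent m + 2 is that of t^2 det^m expressed in x. The weights
  \<theta> and 1 / \<theta> are inverse to each other, and an additive map with H 1 = 1 is the
  identity on the prime field, so x^(m + 3) = 1 for the nonzero x there and p - 1 \<le> m + 3. As p
  \<ge> m + 2 and both are odd, p is m + 2 or m + 4; the former gives x^2 = 1 on the prime field,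
  hence p = 3. The quotient by Z(P) is avoided throughout: Z(P) consists of scalar matrices with
  suitable t, so the trace separates W0 from its product with Z(P), and all calculations take place
  in P.\<close>

definition lin :: "'f::field \<Rightarrow> 'f \<Rightarrow> 'f poly poly" where
  "lin a b = scalar a * var_X + scalar b * var_Y"

lemma scalar_simps [simp]:
  "scalar 0 = 0" "scalar 1 = 1"
  "scalar (a + b) = scalar a + scalar b" "scalar (- a) = - scalar a"
  "scalar (a * b) = scalar a * scalar b"
  by (simp_all add: scalar_def one_pCons)

lemma scalar_power: "scalar (a ^ n) = scalar a ^ n"
  by (induction n) simp_all

lemma scalar_of_nat: "scalar (of_nat n) = of_nat n"
  by (induction n) simp_all

lemma coeff_XY_simps [simp]:
  "coeff_XY 0 a b = 0"
  "coeff_XY (v + w) a b = coeff_XY v a b + coeff_XY w a b"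
  "coeff_XY (v - w) a b = coeff_XY v a b - coeff_XY w a b"
  "coeff_XY (- v) a b = - coeff_XY v a b"
  "coeff_XY (scalar c * v) a b = c * coeff_XY v a b"
  "coeff_XY (\<Sum>i\<in>I. f i) a b = (\<Sum>i\<in>I. coeff_XY (f i) a b)"
  by (simp_all add: coeff_XY_def scalar_def coeff_sum)

lemma coeff_XY_scalar_right [simp]: "coeff_XY (v * scalar c) a b = c * coeff_XY v a b"
  by (simp add: mult.commute[of v])

lemma poly_poly_eqI: "(\<And>a b. coeff_XY v a b = coeff_XY w a b) \<Longrightarrow> v = w"
  by (auto simp: coeff_XY_def poly_eq_iff)

lemma hom_polys_closed [simp, intro]:
  "0 \<in> hom_polys m"
  "v \<in> hom_polys m \<Longrightarrow> - v \<in> hom_polys m"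
  "v \<in> hom_polys m \<Longrightarrow> scalar c * v \<in> hom_polys m"
  by (auto simp: hom_polys_def)

lemma hom_polys_add [simp, intro]:
  assumes "v \<in> hom_polys m" "w \<in> hom_polys m"
  shows "v + w \<in> hom_polys m"
proof -
  have "coeff_XY v a b = 0" "coeff_XY w a b = 0" if "a + b \<noteq> m" for a b
    using assms that by (auto simp: hom_polys_def)
  then show ?thesis
    by (force simp: hom_polys_def)
qed

lemma hom_polys_diff [simp, intro]:
  "v \<in> hom_polys m \<Longrightarrow> w \<in> hom_polys m \<Longrightarrow> v - w \<in> hom_polys m"
  using hom_polys_add[of v m "- w"] by auto

lemma hom_polys_sum [intro]:
  "(\<And>i. i \<in> I \<Longrightarrow> f i \<in> hom_polys m) \<Longrightarrow> (\<Sum>i\<in>I. f i) \<in> hom_polys m"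
  by (induction I rule: infinite_finite_induct) auto

lemma hom_polys_mult:
  assumes "v \<in> hom_polys m" "w \<in> hom_polys n"
  shows "v * w \<in> hom_polys (m + n)"
proof -
  have "a + b = m + n" if nz: "coeff_XY (v * w) a b \<noteq> 0" for a b
  proof -
    have "coeff_XY (v * w) a b = (\<Sum>i\<le>b. \<Sum>j\<le>a. coeff_XY v j i * coeff_XY w (a - j) (b - i))"
      by (simp add: coeff_XY_def coeff_mult coeff_sum)
    then obtain i j where "i \<le> b" "j \<le> a" "coeff_XY v j i \<noteq> 0" "coeff_XY w (a - j) (b - i) \<noteq> 0"
      using nz by (metis (no_types, lifting) atMost_iff mult_eq_0_iff sum.not_neutral_contains_not_neutral)
    then have "j + i = m" "(a - j) + (b - i) = n"
      using assms by (auto simp: hom_polys_def)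
    with \<open>i \<le> b\<close> \<open>j \<le> a\<close> show ?thesis by simp
  qed
  then show ?thesis
    by (auto simp: hom_polys_def)
qed

lemma hom_polys_eqI:
  assumes "v \<in> hom_polys m" "w \<in> hom_polys m"
    and "\<And>i. i \<le> m \<Longrightarrow> coeff_XY v i (m - i) = coeff_XY w i (m - i)"
  shows "v = w"
proof (rule poly_poly_eqI)
  fix a b
  show "coeff_XY v a b = coeff_XY w a b"
  proof (cases "a + b = m")
    case True
    then show ?thesis using assms(3)[of a] by auto
  next
    case False
    then have "coeff_XY v a b = 0" "coeff_XY w a b = 0"
      using assms(1,2) by (auto simp: hom_polys_def)
    then show ?thesis by simp
  qed
qed

lemma coeff_XY_monomial' [simp]:
  "i \<le> m \<Longrightarrow> a \<le> m \<Longrightarrow> coeff_XY (var_X ^ a * var_Y ^ (m - a)) i (m - i) = (if i = a then 1 else 0)"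
  by (auto simp: coeff_XY_monomial)

lemma hom_polys_expand:
  assumes "v \<in> hom_polys m"
  shows "v = (\<Sum>i\<le>m. scalar (coeff_XY v i (m - i)) * (var_X ^ i * var_Y ^ (m - i)))"
proof (rule hom_polys_eqI[OF assms])
  show "(\<Sum>i\<le>m. scalar (coeff_XY v i (m - i)) * (var_X ^ i * var_Y ^ (m - i))) \<in> hom_polys m"
    by (intro hom_polys_sum hom_polys_closed monomial_in_hom_polys) auto
next
  fix j assume "j \<le> m"
  have "(\<Sum>i\<le>m. coeff_XY v i (m - i) * coeff_XY (var_X ^ i * var_Y ^ (m - i)) j (m - j))
      = (\<Sum>i\<le>m. if j = i then coeff_XY v i (m - i) else 0)"
    using \<open>j \<le> m\<close> by (intro sum.cong) auto
  with \<open>j \<le> m\<close> show "coeff_XY v j (m - j) =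
      coeff_XY (\<Sum>i\<le>m. scalar (coeff_XY v i (m - i)) * (var_X ^ i * var_Y ^ (m - i))) j (m - j)"
    by simp
qed

lemma lin_power_expand:
  "lin a b ^ m = (\<Sum>i\<le>m. scalar (of_nat (m choose i) * a ^ i * b ^ (m - i)) * (var_X ^ i * var_Y ^ (m - i)))"
  by (simp add: lin_def binomial_ring power_mult_distrib scalar_power scalar_of_nat algebra_simps)

lemma lin_power_in_hom_polys [simp, intro]: "lin a b ^ m \<in> hom_polys m"
  unfolding lin_power_expand by (intro hom_polys_sum hom_polys_closed monomial_in_hom_polys) auto

lemma coeff_XY_lin_power [simp]:
  assumes "i \<le> m"
  shows "coeff_XY (lin a b ^ m) i (m - i) = of_nat (m choose i) * a ^ i * b ^ (m - i)"
proof -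
  have "coeff_XY (lin a b ^ m) i (m - i)
      = (\<Sum>j\<le>m. of_nat (m choose j) * a ^ j * b ^ (m - j) * coeff_XY (var_X ^ j * var_Y ^ (m - j)) i (m - i))"
    unfolding lin_power_expand by (simp only: coeff_XY_simps)
  also have "\<dots> = (\<Sum>j\<le>m. if i = j then of_nat (m choose i) * a ^ i * b ^ (m - i) else 0)"
    using assms by (intro sum.cong) auto
  finally show ?thesis using assms by simp
qed

lemma coeff_XY_lin_power_ends [simp]:
  "coeff_XY (lin a b ^ m) 0 m = b ^ m" "coeff_XY (lin a b ^ m) m 0 = a ^ m"
  using coeff_XY_lin_power[of 0 m a b] coeff_XY_lin_power[of m m a b] by simp_all

lemma mat_act_add [simp]: "mat_act m (v + w) A = mat_act m v A + mat_act m w A"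
  by (simp add: mat_act_def algebra_simps sum.distrib)

lemma mat_act_scalar [simp]: "mat_act m (scalar c * v) A = scalar c * mat_act m v A"
  by (simp add: mat_act_def sum_distrib_left mult.assoc)

lemma mat_act_scalar_right [simp]: "mat_act m (v * scalar c) A = scalar c * mat_act m v A"
  by (simp add: mult.commute[of v])

lemma mat_act_0 [simp]: "mat_act m 0 A = 0"
  by (simp add: mat_act_def)

lemma mat_act_uminus [simp]: "mat_act m (- v) A = - mat_act m v A"
  using mat_act_scalar[of m "-1" v A] by simp

lemma mat_act_diff [simp]: "mat_act m (v - w) A = mat_act m v A - mat_act m w A"
  using mat_act_add[of m v "- w" A] by simp

lemma mat_act_in_hom_polys [simp, intro]: "mat_act m v A \<in> hom_polys m"
proof -
  have "lin a b ^ i * lin c d ^ (m - i) \<in> hom_polys m" if "i \<le> m" for i and a b c d :: 'a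
    using hom_polys_mult[of "lin a b ^ i" i "lin c d ^ (m - i)" "m - i"] that by simp
  then show ?thesis
    unfolding mat_act_def by (auto simp flip: lin_def simp: mult.assoc)
qed

lemma lin_scalar: "scalar c * lin a b = lin (c * a) (c * b)"
  by (simp add: lin_def algebra_simps)

lemma lin_add: "lin a b + lin c d = lin (a + c) (b + d)"
  by (simp add: lin_def algebra_simps)

lemma mat_act_lin_power:
  "mat_act m (lin a b ^ m) A =
    lin (a * A $ 1 $ 1 + b * A $ 2 $ 1) (a * A $ 1 $ 2 + b * A $ 2 $ 2) ^ m"
proof -
  have "mat_act m (lin a b ^ m) A = (\<Sum>i\<le>m. scalar (of_nat (m choose i) * a ^ i * b ^ (m - i))
      * lin (A $ 1 $ 1) (A $ 1 $ 2) ^ i * lin (A $ 2 $ 1) (A $ 2 $ 2) ^ (m - i))"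
    unfolding mat_act_def lin_def[symmetric] by (intro sum.cong) auto
  also have "\<dots> = (scalar a * lin (A $ 1 $ 1) (A $ 1 $ 2) + scalar b * lin (A $ 2 $ 1) (A $ 2 $ 2)) ^ m"
    by (simp add: binomial_ring power_mult_distrib scalar_power scalar_of_nat algebra_simps)
  finally show ?thesis
    by (simp add: lin_scalar lin_add)
qed

section \<open>The bilinear form and its behaviour under matrices\<close>

lemma form_altdef:
  "form m v w = (\<Sum>a\<le>m. (- 1) ^ a * coeff_XY v a (m - a) * coeff_XY w (m - a) a / of_nat (m choose a))"
proof -
  have "(\<Sum>c\<le>m. coeff_XY v a (m - a) * coeff_XY w c (m - c) * form_basis m a (m - c))
      = (- 1) ^ a * coeff_XY v a (m - a) * coeff_XY w (m - a) a / of_nat (m choose a)"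
    if "a \<le> m" for a
  proof -
    have "(\<Sum>c\<le>m. coeff_XY v a (m - a) * coeff_XY w c (m - c) * form_basis m a (m - c))
        = (\<Sum>c\<le>m. if c = m - a then (- 1) ^ a * coeff_XY v a (m - a) * coeff_XY w (m - a) a
             / of_nat (m choose a) else 0)"
      using that by (intro sum.cong) (auto simp: form_basis_def)
    then show ?thesis by simp
  qed
  then show ?thesis
    by (simp add: form_def)
qed

lemma form_linear [simp]:
  "form m (v + v') w = form m v w + form m v' w"
  "form m v (w + w') = form m v w + form m v w'"
  "form m (scalar c * v) w = c * form m v w"
  "form m v (scalar c * w) = c * form m v w"
  "form m 0 w = 0"
  "form m v 0 = 0"
  by (simp_all add: form_altdef algebra_simps add_divide_distrib sum.distrib sum_distrib_left)

lemma form_scalar_right [simp]: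
  "form m (v * scalar c) w = c * form m v w"
  "form m v (w * scalar c) = c * form m v w"
  by (simp_all add: mult.commute[of _ "scalar c"])

lemma form_minus [simp]:
  "form m (- v) w = - form m v w"
  "form m v (- w) = - form m v w"
  "form m (v - v') w = form m v w - form m v' w"
  "form m v (w - w') = form m v w - form m v w'"
proof -
  show *: "form m (- v) w = - form m v w" "form m v (- w) = - form m v w" for v w
    using form_linear(3)[of m "-1" v w] form_linear(4)[of m v "-1" w] by simp_all
  show "form m (v - v') w = form m v w - form m v' w" "form m v (w - w') = form m v w - form m v w'"
    using form_linear(1)[of m v "- v'" w] form_linear(2)[of m v w "- w'"] * by simp_all
qed

lemma prime_CHAR: "prime CHAR('f::{field,finite})"
  by (intro prime_CHAR_semidom finite_imp_CHAR_pos) auto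

text \<open>A binomial coefficient divides m!, which is prime to the characteristic. This makes the
  denominators of \<open>form_basis\<close> invertible.\<close>

lemma of_nat_binomial_nonzero:
  assumes "m < CHAR('f)" "i \<le> m"
  shows "of_nat (m choose i) \<noteq> (0 :: 'f::{field,finite})"
proof -
  have "\<not> CHAR('f) dvd fact m"
    using assms prime_dvd_fact_iff[OF prime_CHAR[where 'f = 'f]] by simp
  moreover have "(m choose i) dvd fact m"
    using binomial_fact_lemma[OF \<open>i \<le> m\<close>] by (metis dvd_triv_right)
  ultimately show ?thesis
    by (metis dvd_trans of_nat_eq_0_iff_char_dvd)
qed

lemma poly_eq_0_if_many_roots:
  fixes q :: "'f::{field,finite} poly"
  assumes "\<And>x. x \<in> S \<Longrightarrow> poly q x = 0" and "degree q < card S"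
  shows "q = 0"
proof (rule ccontr)
  assume "q \<noteq> 0"
  then have "card {x. poly q x = 0} \<le> degree q"
    by (rule card_poly_roots_bound)
  moreover have "card S \<le> card {x. poly q x = 0}"
    using assms(1) by (intro card_mono) auto
  ultimately show False using assms(2) by linarith
qed

lemma CHAR_le_CARD: "CHAR('f::{field,finite}) \<le> CARD('f)"
proof -
  have "inj_on (of_nat :: nat \<Rightarrow> 'f) {..<CHAR('f)}"
    by (auto simp: inj_on_def of_nat_eq_iff_cong_CHAR cong_def)
  then have "card {..<CHAR('f)} \<le> CARD('f)"
    by (rule card_inj_on_le) auto
  then show ?thesis by simp
qed

text \<open>
  The \<open>m\<close>-th powers of linear forms span the space of binary forms of degree \<open>m\<close>, so identities
  that are linear in \<open>v\<close> need to be checked on these powers only.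
\<close>

lemma lin_powers_span:
  fixes f :: "'f::{field,finite} poly poly \<Rightarrow> 'f"
  assumes m: "m < CHAR('f)"
    and add: "\<And>v w. f (v + w) = f v + f w" and scal: "\<And>c v. f (scalar c * v) = c * f v"
    and zero: "\<And>b. f (lin 1 b ^ m) = 0" and v: "v \<in> hom_polys m"
  shows "f v = 0"
proof -
  have f0: "f 0 = 0" using scal[of 0 0] by simp
  have fsum: "f (\<Sum>i\<in>I. scalar (c i) * w i) = (\<Sum>i\<in>I. c i * f (w i))" for I :: "nat set" and c w
    by (induction I rule: infinite_finite_induct) (auto simp: f0 add scal)
  define e where "e i = f (var_X ^ i * var_Y ^ (m - i))" for i
  \<comment> \<open>As a polynomial in b, \<open>f (lin 1 b ^ m)\<close> has degree at most m but
    vanishes on all of F, which has more than m elements. So its coefficients are zero, and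
    cancelling the binomials leaves f = 0 on every monomial.\<close>
  define q where "q = (\<Sum>i\<le>m. monom (of_nat (m choose i) * e i) (m - i))"
  have "poly q b = 0" for b
  proof -
    have "poly q b = f (lin 1 b ^ m)"
      unfolding lin_power_expand fsum by (simp add: q_def e_def poly_sum poly_monom algebra_simps)
    then show ?thesis using zero by simp
  qed
  moreover have "degree q \<le> m"
    unfolding q_def by (intro degree_sum_le) (auto intro: order_trans[OF degree_monom_le])
  ultimately have "q = 0"
    using m CHAR_le_CARD[where 'f = 'f] by (intro poly_eq_0_if_many_roots[of UNIV]) auto
  have "e i = 0" if "i \<le> m" for i
  proof -
    have "coeff q (m - i) = (\<Sum>j\<le>m. if j = i then of_nat (m choose i) * e i else 0)"
      unfolding q_def coeff_sum using that by (intro sum.cong) auto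
    with \<open>q = 0\<close> that have "of_nat (m choose i) * e i = 0" by simp
    with of_nat_binomial_nonzero[OF m that] show ?thesis by simp
  qed
  then show ?thesis
    using fsum[of "\<lambda>i. coeff_XY v i (m - i)" "\<lambda>i. var_X ^ i * var_Y ^ (m - i)" "{..m}"]
    by (simp flip: hom_polys_expand[OF v] add: e_def)
qed

lemma mat_act_mult:
  fixes A B :: "'f::{field,finite}^2^2"
  assumes "m < CHAR('f)" "v \<in> hom_polys m"
  shows "mat_act m (mat_act m v A) B = mat_act m v (A ** B)"
proof (rule poly_poly_eqI)
  fix i j
  let ?f = "\<lambda>v. coeff_XY (mat_act m (mat_act m v A) B - mat_act m v (A ** B)) i j"
  have "?f v = 0"
  proof (rule lin_powers_span[where f = ?f, OF assms(1)])
    show "?f (lin 1 b ^ m) = 0" for b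
      unfolding mat_act_lin_power by (simp add: matrix_matrix_mult_def sum_2 algebra_simps)
  qed (simp_all add: algebra_simps assms(2))
  then show "coeff_XY (mat_act m (mat_act m v A) B) i j = coeff_XY (mat_act m v (A ** B)) i j"
    by simp
qed

lemma mat_act_1:
  fixes v :: "'f::{field,finite} poly poly"
  assumes "m < CHAR('f)" "v \<in> hom_polys m"
  shows "mat_act m v (mat 1) = v"
proof (rule poly_poly_eqI)
  fix i j
  let ?f = "\<lambda>v. coeff_XY (mat_act m v (mat 1) - v) i j"
  have "?f v = 0"
  proof (rule lin_powers_span[where f = ?f, OF assms(1)])
    show "?f (lin 1 b ^ m) = 0" for b
      unfolding mat_act_lin_power by (simp add: mat_def)
  qed (simp_all add: algebra_simps assms(2))
  then show "coeff_XY (mat_act m v (mat 1)) i j = coeff_XY v i j"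
    by simp
qed

text \<open>The denominator of the form cancels one of the two binomial coefficients coming from the
  powers, and a plain binomial expansion remains. Up to sign the value is the m-th power of a 2x2
  determinant, the source of the behaviour of the form under matrices.\<close>

lemma form_lin_power:
  fixes a b c d :: "'f::{field,finite}"
  assumes "m < CHAR('f)"
  shows "form m (lin a b ^ m) (lin c d ^ m) = (b * c - a * d) ^ m"
proof -
  have "form m (lin a b ^ m) (lin c d ^ m) = (\<Sum>i\<le>m. of_nat (m choose i) * (- (a * d)) ^ i * (b * c) ^ (m - i))"
    unfolding form_altdef
  proof (rule sum.cong[OF refl])
    fix i assume "i \<in> {..m}"
    then have i: "i \<le> m" by simp
    have "coeff_XY (lin c d ^ m) (m - i) (m - (m - i)) = of_nat (m choose i) * c ^ (m - i) * d ^ i"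
      using i by (subst coeff_XY_lin_power) (auto simp: binomial_symmetric[symmetric])
    with i have "coeff_XY (lin c d ^ m) (m - i) i = of_nat (m choose i) * c ^ (m - i) * d ^ i"
      by simp
    moreover have "(- (a * d)) ^ i = (- 1) ^ i * (a ^ i * d ^ i)"
      by (subst power_minus) (simp add: power_mult_distrib)
    ultimately show "(- 1) ^ i * coeff_XY (lin a b ^ m) i (m - i) * coeff_XY (lin c d ^ m) (m - i) i
        / of_nat (m choose i) = of_nat (m choose i) * (- (a * d)) ^ i * (b * c) ^ (m - i)"
      using i of_nat_binomial_nonzero[OF assms i] by (simp add: power_mult_distrib)
  qed
  also have "\<dots> = (- (a * d) + b * c) ^ m"
    by (simp only: binomial_ring)
  finally show ?thesis by (simp add: algebra_simps)
qed

text \<open>On powers of linear forms the form is a power of a determinant, and determinants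
  multiply. The spanning argument is applied to each of the two variables in turn.\<close>

lemma form_mat_act:
  fixes A :: "'f::{field,finite}^2^2"
  assumes m: "m < CHAR('f)" and v: "v \<in> hom_polys m" and w: "w \<in> hom_polys m"
  shows "form m (mat_act m v A) (mat_act m w A) = det A ^ m * form m v w"
proof -
  let ?g = "\<lambda>v w. form m (mat_act m v A) (mat_act m w A) - det A ^ m * form m v w"
  have *: "?g (lin 1 a ^ m) (lin 1 b ^ m) = 0" for a b
    unfolding mat_act_lin_power form_lin_power[OF m] 
    by (simp add: det_2 algebra_simps flip: power_mult_distrib)
  have "?g (lin 1 a ^ m) w = 0" for a
    by (rule lin_powers_span[where f = "?g (lin 1 a ^ m)", OF m _ _ * w]) (simp_all add: algebra_simps)
  from lin_powers_span[where f = "\<lambda>v. ?g v w", OF m _ _ this v] have "?g v w = 0"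
    by (simp add: algebra_simps)
  then show ?thesis by simp
qed

text \<open>Reversing the summation index exchanges v and w and turns (-1)^a into (-1)^(m - a),
  which is the opposite sign because m is odd.\<close>

lemma form_skew:
  fixes v w :: "'f::{field,finite} poly poly"
  assumes "odd m"
  shows "form m w v = - form m v w"
proof -
  have "form m w v = (\<Sum>a\<le>m. (- 1) ^ (m - a) * coeff_XY w (m - a) a * coeff_XY v a (m - a) / of_nat (m choose a))"
    unfolding form_altdef
    by (rule sum.reindex_bij_witness[of _ "\<lambda>a. m - a" "\<lambda>a. m - a"]) (auto simp: binomial_symmetric[symmetric])
  also have "\<dots> = (\<Sum>a\<le>m. - ((- 1) ^ a * coeff_XY v a (m - a) * coeff_XY w (m - a) a / of_nat (m choose a)))"
  proof (rule sum.cong[OF refl])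
    fix a assume "a \<in> {..m}"
    then have "(- 1) ^ (m - a) = - ((- 1) ^ a :: 'f)"
      using assms by (auto simp: minus_one_power_iff)
    then show "(- 1) ^ (m - a) * coeff_XY w (m - a) a * coeff_XY v a (m - a) / of_nat (m choose a) =
        - ((- 1) ^ a * coeff_XY v a (m - a) * coeff_XY w (m - a) a / of_nat (m choose a))"
      by simp
  qed
  finally show ?thesis
    by (simp add: form_altdef sum_negf)
qed

text \<open>This makes the coefficient of Y^m the obstruction to commuting with X^m.\<close>

lemma form_X_power [simp]: "form m v (var_X ^ m) = coeff_XY v 0 m"
proof -
  have "coeff_XY (var_X ^ m :: 'a poly poly) (m - a) a = (if a = 0 then 1 else 0)" if "a \<le> m" for a
    using that coeff_XY_monomial[of m 0 "m - a" a, where 'f = 'a] by auto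
  then have "form m v (var_X ^ m) = (\<Sum>a\<le>m. if a = 0 then coeff_XY v 0 m else 0)"
    unfolding form_altdef by (intro sum.cong) auto
  then show ?thesis by simp
qed

section \<open>Normalizers modulo a normal subgroup\<close>

text \<open>Products are easy to compute in \<open>P_group\<close> while inverses are not, so the
  normalizer is tested by comparing cosets instead of by conjugation.\<close>

lemma (in group) normalizer_eq:
  assumes "K \<subseteq> carrier G"
  shows "normalizer G K = {g \<in> carrier G. g <# K = K #> g}"
proof -
  have "g <# K #> inv g = K \<longleftrightarrow> g <# K = K #> g" if g: "g \<in> carrier G" for g
  proof
    assume "g <# K #> inv g = K"
    then have "K #> g = g <# K #> inv g #> g" by simp
    also have "\<dots> = g <# K"
      using g assms by (simp add: coset_mult_assoc l_coset_subset_G)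
    finally show "g <# K = K #> g" by simp
  next
    assume "g <# K = K #> g"
    then show "g <# K #> inv g = K"
      using g assms by (simp add: coset_mult_assoc)
  qed
  then show ?thesis
    using assms by (auto simp: normalizer_def stabilizer_def)
qed

lemma (in group) normalizer_I:
  assumes "K \<subseteq> carrier G" "g \<in> carrier G"
    and "\<And>k. k \<in> K \<Longrightarrow> \<exists>k'\<in>K. g \<otimes> k = k' \<otimes> g"
    and "\<And>k. k \<in> K \<Longrightarrow> \<exists>k'\<in>K. k \<otimes> g = g \<otimes> k'"
  shows "g \<in> normalizer G K"
proof -
  have "g <# K = K #> g"
    unfolding l_coset_def r_coset_def using assms(3,4) by blast
  then show ?thesis using assms(1,2) by (simp add: normalizer_eq)
qed

lemma (in group) normalizer_D:
  assumes "K \<subseteq> carrier G" "g \<in> normalizer G K" "k \<in> K"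
  obtains k' where "k' \<in> K" "k \<otimes> g = g \<otimes> k'"
proof -
  have "k \<otimes> g \<in> K #> g" using assms(3) by (auto simp: r_coset_def)
  also have "K #> g = g <# K" using assms(1,2) by (simp add: normalizer_eq)
  finally show thesis using that by (auto simp: l_coset_def)
qed

context normal
begin

lemma FactGroup_eq_iff:
  assumes "x \<in> carrier G" "y \<in> carrier G"
  shows "H #> x = H #> y \<longleftrightarrow> (\<exists>z\<in>H. y = z \<otimes> x)"
proof
  assume "H #> x = H #> y"
  then have "y \<in> H #> x"
    using repr_independenceD[OF subgroup_axioms assms(2)] by simp
  then show "\<exists>z\<in>H. y = z \<otimes> x"
    by (auto simp: r_coset_def)
next
  assume "\<exists>z\<in>H. y = z \<otimes> x"
  then have "y \<in> H #> x"
    by (auto simp: r_coset_def)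
  then show "H #> x = H #> y"
    using repr_independence assms(1) subgroup_axioms by blast
qed

text \<open>Sets absorbing multiplication by H are unions of cosets, so they can be recovered from
  their images in the quotient.\<close>

lemma image_FactGroup_eq_iff:
  assumes S: "S \<subseteq> carrier G" "T \<subseteq> carrier G"
    and sat: "\<And>z s. z \<in> H \<Longrightarrow> s \<in> S \<Longrightarrow> z \<otimes> s \<in> S" "\<And>z s. z \<in> H \<Longrightarrow> s \<in> T \<Longrightarrow> z \<otimes> s \<in> T"
  shows "(\<lambda>g. H #> g) ` S = (\<lambda>g. H #> g) ` T \<longleftrightarrow> S = T"
proof -
  have "S \<subseteq> T" if im: "(\<lambda>g. H #> g) ` S \<subseteq> (\<lambda>g. H #> g) ` T"
    and ST: "S \<subseteq> carrier G" "T \<subseteq> carrier G"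
    and sat: "\<And>z s. z \<in> H \<Longrightarrow> s \<in> T \<Longrightarrow> z \<otimes> s \<in> T" for S T
  proof
    fix s assume s: "s \<in> S"
    then obtain t where "t \<in> T" "H #> s = H #> t"
      using im by blast
    then obtain z where "z \<in> H" "s = z \<otimes> t"
      using FactGroup_eq_iff[of t s] s ST by auto
    then show "s \<in> T" using sat \<open>t \<in> T\<close> by simp
  qed
  then show ?thesis using assms by (metis subset_antisym equalityE)
qed

text \<open>Both g K and K g absorb H, so comparing them in the quotient amounts to comparing them
  in the group.\<close>

lemma normalizer_FactGroup:
  assumes K: "K \<subseteq> carrier G"
    and sat: "\<And>z k. z \<in> H \<Longrightarrow> k \<in> K \<Longrightarrow> z \<otimes> k \<in> K"
  shows "normalizer (G Mod H) ((\<lambda>g. H #> g) ` K) = (\<lambda>g. H #> g) ` normalizer G K"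
proof -
  interpret Q: group "G Mod H" by (rule factorgroup_is_group)
  let ?\<pi> = "\<lambda>g. H #> g"
  have \<pi>: "?\<pi> g <#>\<^bsub>G\<^esub> ?\<pi> k = ?\<pi> (g \<otimes> k)" if "g \<in> carrier G" "k \<in> carrier G" for g k
    using that by (rule rcos_sum)
  have sub: "?\<pi> ` K \<subseteq> carrier (G Mod H)"
    using K by (auto simp: carrier_FactGroup)
  have l: "?\<pi> g <#\<^bsub>G Mod H\<^esub> ?\<pi> ` K = ?\<pi> ` (g <# K)" and r: "?\<pi> ` K #>\<^bsub>G Mod H\<^esub> ?\<pi> g = ?\<pi> ` (K #> g)"
    if "g \<in> carrier G" for g
  proof -
    have "?\<pi> g <#\<^bsub>G Mod H\<^esub> ?\<pi> ` K = (\<lambda>k. ?\<pi> g <#>\<^bsub>G\<^esub> ?\<pi> k) ` K"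
      by (auto simp: l_coset_def)
    also have "\<dots> = (\<lambda>k. ?\<pi> (g \<otimes> k)) ` K"
      using that K by (intro image_cong refl \<pi>) auto
    also have "\<dots> = ?\<pi> ` (g <# K)" by (auto simp: l_coset_def)
    finally show "?\<pi> g <#\<^bsub>G Mod H\<^esub> ?\<pi> ` K = ?\<pi> ` (g <# K)" .
    have "?\<pi> ` K #>\<^bsub>G Mod H\<^esub> ?\<pi> g = (\<lambda>k. ?\<pi> k <#>\<^bsub>G\<^esub> ?\<pi> g) ` K"
      by (auto simp: r_coset_def)
    also have "\<dots> = (\<lambda>k. ?\<pi> (k \<otimes> g)) ` K"
      using that K by (intro image_cong refl \<pi>) auto
    also have "\<dots> = ?\<pi> ` (K #> g)" by (auto simp: r_coset_def)
    finally show "?\<pi> ` K #>\<^bsub>G Mod H\<^esub> ?\<pi> g = ?\<pi> ` (K #> g)" .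
  qed
  have *: "?\<pi> ` (g <# K) = ?\<pi> ` (K #> g) \<longleftrightarrow> g <# K = K #> g" if g: "g \<in> carrier G" for g
  proof (rule image_FactGroup_eq_iff)
    show "g <# K \<subseteq> carrier G" "K #> g \<subseteq> carrier G"
      using K g by (auto simp: l_coset_def r_coset_def)
    show "z \<otimes> s \<in> K #> g" if z: "z \<in> H" and s: "s \<in> K #> g" for z s
    proof -
      obtain k where "k \<in> K" "s = k \<otimes> g" using s by (auto simp: r_coset_def)
      then have "z \<otimes> s = (z \<otimes> k) \<otimes> g" "z \<otimes> k \<in> K"
        using sat g K z by (auto simp: m_assoc subsetD)
      then show ?thesis by (auto simp: r_coset_def)
    qed
    show "z \<otimes> s \<in> g <# K" if zH: "z \<in> H" and s: "s \<in> g <# K" for z s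
    proof -
      obtain k where k: "k \<in> K" "s = g \<otimes> k" using s by (auto simp: l_coset_def)
      then have kc: "k \<in> carrier G" using K by auto
      \<comment> \<open>Normality lets z pass to the right of g: z g = g (g^-1 z g).\<close>
      have z: "inv g \<otimes> z \<otimes> g \<in> H"
        using inv_op_closed1[OF g zH] .
      have "g \<otimes> ((inv g \<otimes> z \<otimes> g) \<otimes> k) = (g \<otimes> inv g) \<otimes> z \<otimes> g \<otimes> k"
        using kc g mem_carrier[OF zH] by (simp only: m_assoc m_closed inv_closed)
      then have "z \<otimes> s = g \<otimes> ((inv g \<otimes> z \<otimes> g) \<otimes> k)"
        using kc k(2) g mem_carrier[OF zH] by (simp add: m_assoc)
      then show ?thesis using sat[OF z k(1)] by (auto simp: l_coset_def)
    qed
  qed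
  show ?thesis
    unfolding Q.normalizer_eq[OF sub] normalizer_eq[OF K]
    using l r * by (auto simp: carrier_FactGroup)
qed

end

lemma (in group) normal_center: "center G \<lhd> G"
proof (rule normalI)
  show "subgroup (center G) G"
  proof (rule subgroupI)
    show "center G \<subseteq> carrier G" "center G \<noteq> {}"
      by (auto simp: center_def)
    show "inv z \<in> center G" if "z \<in> center G" for z
    proof -
      have z: "z \<in> carrier G" using that by (simp add: center_def)
      have "inv z \<otimes> g = g \<otimes> inv z" if g: "g \<in> carrier G" for g
      proof -
        have "z \<otimes> g = g \<otimes> z" using \<open>z \<in> center G\<close> g by (simp add: center_def)
        then have "g = inv z \<otimes> (g \<otimes> z)"
          using z g by (subst inv_solve_left) auto
        then have "g = (inv z \<otimes> g) \<otimes> z"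
          using z g by (simp add: m_assoc)
        then show ?thesis
          using z g by (subst inv_solve_right) auto
      qed
      then show ?thesis using z by (simp add: center_def)
    qed
    show "y \<otimes> z \<in> center G" if "y \<in> center G" "z \<in> center G" for y z
    proof -
      have yz: "y \<in> carrier G" "z \<in> carrier G" using that by (auto simp: center_def)
      have "y \<otimes> z \<otimes> g = g \<otimes> (y \<otimes> z)" if g: "g \<in> carrier G" for g
      proof -
        have "y \<otimes> z \<otimes> g = y \<otimes> (g \<otimes> z)"
          using \<open>z \<in> center G\<close> yz g by (simp add: center_def m_assoc)
        also have "\<dots> = g \<otimes> y \<otimes> z"
          using \<open>y \<in> center G\<close> yz g by (simp add: center_def flip: m_assoc)
        finally show ?thesis using yz g by (simp add: m_assoc)
      qed
      then show ?thesis using yz by (simp add: center_def)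
    qed
  qed
  show "\<forall>x\<in>carrier G. center G #> x = x <# center G"
    by (auto simp: center_def r_coset_def l_coset_def)
qed

context group
begin

lemma center_closed: "z \<in> center G \<Longrightarrow> z \<in> carrier G"
  and center_commute: "z \<in> center G \<Longrightarrow> g \<in> carrier G \<Longrightarrow> z \<otimes> g = g \<otimes> z"
  by (auto simp: center_def)

lemma set_mult_center:
  assumes "subgroup W G"
  shows "subgroup (W <#> center G) G" "W \<subseteq> W <#> center G" "center G \<subseteq> W <#> center G"
proof -
  interpret Z: normal "center G" G by (rule normal_center)
  have "W <#> center G = center G <#> W"
  proof -
    have "w \<otimes> z = z \<otimes> w" if "w \<in> W" "z \<in> center G" for w z
      using center_commute[OF that(2), of w] that(1) subgroup.subset[OF assms] by auto
    then have "(\<Union>w\<in>W. \<Union>z\<in>center G. {w \<otimes> z}) = (\<Union>w\<in>W. \<Union>z\<in>center G. {z \<otimes> w})"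
      by (intro SUP_cong refl) auto
    also have "\<dots> = (\<Union>z\<in>center G. \<Union>w\<in>W. {z \<otimes> w})"
      by (rule SUP_commute)
    finally show ?thesis by (simp add: set_mult_def)
  qed
  then show "subgroup (W <#> center G) G"
    using mult_norm_subgroup[OF normal_center assms] by simp
  have "\<exists>z\<in>center G. w = w \<otimes> z" if "w \<in> W" for w
    using that subgroup.subset[OF assms] Z.one_closed by (intro bexI[of _ \<one>]) auto
  then show "W \<subseteq> W <#> center G" by (auto simp: set_mult_def)
  have "\<exists>w\<in>W. z = w \<otimes> z" if "z \<in> center G" for z
    using that subgroup.one_closed[OF assms] Z.subset by (intro bexI[of _ \<one>]) auto
  then show "center G \<subseteq> W <#> center G" by (simp add: set_mult_def) blast
qed

lemma normalizer_Mod_center: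
  assumes W: "subgroup W G"
  shows "normalizer (G Mod center G) (image_Mod G W (center G))
    = (\<lambda>g. center G #> g) ` normalizer G (W <#> center G)"
  unfolding image_Mod_def
proof (rule normal.normalizer_FactGroup[OF normal_center])
  note K = set_mult_center[OF W]
  show "W <#> center G \<subseteq> carrier G" using subgroup.subset[OF K(1)] .
  show "z \<otimes> k \<in> W <#> center G" if "z \<in> center G" "k \<in> W <#> center G" for z k
    using that K subgroup.m_closed[OF K(1)] by blast
qed

text \<open>Here the quotient disappears: the isomorphism becomes a homomorphism on a normalizer
  inside G whose kernel is the centre, so that later calculations can use coordinates of group
  elements.\<close>

lemma pull_back_iso:
  assumes W: "subgroup W G"
    and h: "h \<in> iso ((G Mod center G)\<lparr>carrier := normalizer (G Mod center G) (image_Mod G W (center G))\<rparr>) C"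
    and D: "h ` image_Mod G W (center G) = D"
    and C: "group C"
  obtains \<Phi> where
    "\<And>x y. x \<in> normalizer G (W <#> center G) \<Longrightarrow> y \<in> normalizer G (W <#> center G) \<Longrightarrow>
       \<Phi> (x \<otimes> y) = \<Phi> x \<otimes>\<^bsub>C\<^esub> \<Phi> y"
    "\<Phi> ` normalizer G (W <#> center G) = carrier C"
    "\<And>x. x \<in> normalizer G (W <#> center G) \<Longrightarrow> \<Phi> x = \<one>\<^bsub>C\<^esub> \<longleftrightarrow> x \<in> center G"
    "\<And>x. x \<in> normalizer G (W <#> center G) \<Longrightarrow> \<Phi> x \<in> D \<longleftrightarrow> x \<in> W <#> center G"
proof -
  interpret Z: normal "center G" G by (rule normal_center)
  interpret Q: group "G Mod center G" by (rule Z.factorgroup_is_group)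
  interpret C: group C by (rule C)
  let ?\<pi> = "\<lambda>g. center G #> g"
  let ?K = "W <#> center G"
  let ?N = "normalizer G ?K"
  let ?NQ = "normalizer (G Mod center G) (image_Mod G W (center G))"
  note K = set_mult_center[OF W]
  have Ksub: "?K \<subseteq> carrier G" using subgroup.subset[OF K(1)] .
  have Nsub: "?N \<subseteq> carrier G" using Ksub by (auto simp: normalizer_eq)
  have NQ: "?NQ = ?\<pi> ` ?N" by (rule normalizer_Mod_center[OF W])
  have bij: "bij_betw h ?NQ (carrier C)" using h by (auto simp: iso_def)
  then have inj: "inj_on h ?NQ" by (simp add: bij_betw_def)
  have hm: "h (X \<otimes>\<^bsub>G Mod center G\<^esub> Y) = h X \<otimes>\<^bsub>C\<^esub> h Y" if "X \<in> ?NQ" "Y \<in> ?NQ" for X Y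
    using h that by (auto simp: iso_def hom_def)
  have KN: "?K \<subseteq> ?N"
  proof
    fix k assume k: "k \<in> ?K"
    then have "k <# ?K = ?K #> k"
      using coset_join3[OF _ K(1)] coset_join2[OF _ K(1)] Ksub by auto
    then show "k \<in> ?N" using k Ksub by (auto simp: normalizer_eq)
  qed
  have one: "\<one> \<in> ?N" using KN K(2) subgroup.one_closed[OF W] by blast
  have h\<pi>: "h (?\<pi> x) = h (?\<pi> y) \<longleftrightarrow> ?\<pi> x = ?\<pi> y" if "x \<in> ?N" "y \<in> ?N" for x y
    using inj_onD[OF inj, of "?\<pi> x" "?\<pi> y"] that by (auto simp: NQ)
  show thesis
  proof (rule that[of "\<lambda>g. h (?\<pi> g)"])
    show mult: "h (?\<pi> (x \<otimes> y)) = h (?\<pi> x) \<otimes>\<^bsub>C\<^esub> h (?\<pi> y)" if "x \<in> ?N" "y \<in> ?N" for x y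
      using hm[of "?\<pi> x" "?\<pi> y"] that Nsub by (auto simp: NQ Z.rcos_sum subsetD)
    show surj: "(\<lambda>g. h (?\<pi> g)) ` ?N = carrier C"
      using bij by (auto simp: NQ bij_betw_def image_image)
    have "h (?\<pi> \<one>) \<otimes>\<^bsub>C\<^esub> h (?\<pi> \<one>) = h (?\<pi> \<one>)"
      using mult[OF one one] by simp
    then have h1: "h (?\<pi> \<one>) = \<one>\<^bsub>C\<^esub>"
      using surj one by (intro C.l_cancel_one[THEN iffD1]) auto
    show "h (?\<pi> x) = \<one>\<^bsub>C\<^esub> \<longleftrightarrow> x \<in> center G" if x: "x \<in> ?N" for x
    proof -
      have "h (?\<pi> x) = \<one>\<^bsub>C\<^esub> \<longleftrightarrow> ?\<pi> \<one> = ?\<pi> x"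
        using h\<pi>[OF x one] h1 by auto
      also have "\<dots> \<longleftrightarrow> (\<exists>z\<in>center G. x = z \<otimes> \<one>)"
        using Z.FactGroup_eq_iff[of \<one> x] x Nsub by auto
      also have "\<dots> \<longleftrightarrow> x \<in> center G"
        by (metis Z.mem_carrier r_one)
      finally show ?thesis .
    qed
    show "h (?\<pi> x) \<in> D \<longleftrightarrow> x \<in> ?K" if x: "x \<in> ?N" for x
    proof
      assume "h (?\<pi> x) \<in> D"
      then obtain k where k: "k \<in> ?K" "h (?\<pi> x) = h (?\<pi> k)"
        by (auto simp: D[symmetric] image_Mod_def)
      then have "?\<pi> k = ?\<pi> x" using h\<pi>[OF x] KN by auto
      then obtain z where "z \<in> center G" "x = z \<otimes> k"
        using Z.FactGroup_eq_iff[of k x] x k(1) Nsub KN by auto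
      then show "x \<in> ?K" using K(3) k(1) subgroup.m_closed[OF K(1)] by blast
    next
      assume "x \<in> ?K"
      then show "h (?\<pi> x) \<in> D" by (auto simp: D[symmetric] image_Mod_def)
    qed
  qed
qed

text \<open>A homomorphism from C that avoids the centre, and whose image fills the normalizer
  together with the centre, induces an isomorphism from C onto the normalizer in the quotient; the
  required map is its inverse.\<close>

lemma iso_from_section:
  assumes C: "group C" and \<Psi>: "\<Psi> \<in> hom C G" and D: "D \<subseteq> carrier C"
    and W: "subgroup W G" "\<Psi> ` D = W"
    and inj: "\<And>c. c \<in> carrier C \<Longrightarrow> \<Psi> c \<in> center G \<Longrightarrow> c = \<one>\<^bsub>C\<^esub>"
    and N: "normalizer G (W <#> center G) = \<Psi> ` carrier C <#> center G"
  shows "\<exists>h. h \<in> iso ((G Mod center G)\<lparr>carrier := normalizer (G Mod center G) (image_Mod G W (center G))\<rparr>) C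
     \<and> h ` image_Mod G W (center G) = D"
proof -
  interpret Z: normal "center G" G by (rule normal_center)
  interpret C: group C by (rule C)
  let ?\<pi> = "\<lambda>g. center G #> g"
  let ?NQ = "normalizer (G Mod center G) (image_Mod G W (center G))"
  have \<pi>z: "?\<pi> (x \<otimes> z) = ?\<pi> x" if "x \<in> carrier G" "z \<in> center G" for x z
  proof -
    have "x \<otimes> z = z \<otimes> x" using that by (simp add: center_commute)
    then show ?thesis
      using Z.FactGroup_eq_iff[of x "x \<otimes> z"] that center_closed[OF that(2)] by auto
  qed
  have im: "?\<pi> ` (S <#> center G) = ?\<pi> ` S" if "S \<subseteq> carrier G" for S
  proof -
    have "S <#> center G = (\<Union>x\<in>S. \<Union>z\<in>center G. {x \<otimes> z})" by (simp add: set_mult_def)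
    also have "?\<pi> ` \<dots> = (\<Union>x\<in>S. \<Union>z\<in>center G. {?\<pi> (x \<otimes> z)})" by blast
    also have "\<dots> = (\<Union>x\<in>S. \<Union>z\<in>center G. {?\<pi> x})"
      using \<pi>z that by (intro SUP_cong refl) (auto simp: subsetD)
    also have "\<dots> = ?\<pi> ` S" using Z.one_closed by blast
    finally show ?thesis .
  qed
  have \<Psi>c: "\<Psi> c \<in> carrier G" if "c \<in> carrier C" for c
    using \<Psi> that by (auto simp: hom_def)
  have \<Psi>m: "\<Psi> (c \<otimes>\<^bsub>C\<^esub> d) = \<Psi> c \<otimes> \<Psi> d" if "c \<in> carrier C" "d \<in> carrier C" for c d
    using \<Psi> that by (auto simp: hom_def)
  have NQ: "?NQ = ?\<pi> ` \<Psi> ` carrier C"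
    unfolding normalizer_Mod_center[OF W(1)] N by (rule im) (use \<Psi>c in auto)
  have IW: "image_Mod G W (center G) = ?\<pi> ` \<Psi> ` D"
    unfolding image_Mod_def using im[OF subgroup.subset[OF W(1)]] W(2) by simp
  define f where "f c = ?\<pi> (\<Psi> c)" for c
  have "f \<in> iso C ((G Mod center G)\<lparr>carrier := ?NQ\<rparr>)"
  proof (rule isoI)
    show "f \<in> hom C ((G Mod center G)\<lparr>carrier := ?NQ\<rparr>)"
      by (rule homI) (auto simp: f_def NQ \<Psi>m \<Psi>c Z.rcos_sum)
    have "inj_on f (carrier C)"
    proof (rule inj_onI)
      fix c d assume cd: "c \<in> carrier C" "d \<in> carrier C" "f c = f d"
      then obtain z where z: "z \<in> center G" "\<Psi> d = z \<otimes> \<Psi> c"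
        using Z.FactGroup_eq_iff[of "\<Psi> c" "\<Psi> d"] \<Psi>c by (auto simp: f_def)
      \<comment> \<open>Passing to e = d c^-1 reduces injectivity to the kernel: the image of e is
        z, hence central.\<close>
      define e where "e = d \<otimes>\<^bsub>C\<^esub> inv\<^bsub>C\<^esub> c"
      have e: "e \<in> carrier C" "d = e \<otimes>\<^bsub>C\<^esub> c" using cd by (auto simp: e_def C.m_assoc)
      then have "\<Psi> e \<otimes> \<Psi> c = z \<otimes> \<Psi> c" using \<Psi>m z cd by simp
      then have "\<Psi> e = z" using e cd z \<Psi>c Z.subset by (auto dest: center_closed)
      then show "c = d" using inj[OF e(1)] z e cd by auto
    qed
    then show "bij_betw f (carrier C) (carrier ((G Mod center G)\<lparr>carrier := ?NQ\<rparr>))"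
      by (auto simp: bij_betw_def NQ f_def)
  qed
  then have h: "inv_into (carrier C) f \<in> iso ((G Mod center G)\<lparr>carrier := ?NQ\<rparr>) C"
    and inj_f: "inj_on f (carrier C)"
    by (rule C.iso_set_sym, simp add: iso_def bij_betw_def)
  moreover have "inv_into (carrier C) f ` image_Mod G W (center G) = D"
  proof -
    have "image_Mod G W (center G) = f ` D" unfolding IW f_def by auto
    then show ?thesis using inv_into_image_cancel[OF inj_f D] by simp
  qed
  ultimately show ?thesis by blast
qed

end

section \<open>Transport of subgroups, centre and normalizers by conjugation\<close>

context group
begin

abbreviation conj :: "'a \<Rightarrow> 'a \<Rightarrow> 'a" where
  "conj h g \<equiv> h \<otimes> g \<otimes> inv h"

lemma inv_mult_cancel:
  assumes "h \<in> carrier G" "x \<in> carrier G"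
  shows "inv h \<otimes> (h \<otimes> x) = x" "h \<otimes> (inv h \<otimes> x) = x"
  using assms by (simp_all flip: m_assoc)

lemma conj_mult:
  "h \<in> carrier G \<Longrightarrow> x \<in> carrier G \<Longrightarrow> y \<in> carrier G \<Longrightarrow> conj h (x \<otimes> y) = conj h x \<otimes> conj h y"
  by (simp add: m_assoc inv_mult_cancel)

lemma conj_inv_conj:
  "h \<in> carrier G \<Longrightarrow> x \<in> carrier G \<Longrightarrow> conj (inv h) (conj h x) = x"
  "h \<in> carrier G \<Longrightarrow> x \<in> carrier G \<Longrightarrow> conj h (conj (inv h) x) = x"
  by (simp_all add: m_assoc inv_mult_cancel)

lemma conj_image_inv:
  assumes "h \<in> carrier G" "K \<subseteq> carrier G"
  shows "conj (inv h) ` conj h ` K = K"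
proof -
  have "(\<lambda>x. conj (inv h) (conj h x)) ` K = (\<lambda>x. x) ` K"
    using assms by (intro image_cong refl conj_inv_conj(1)) auto
  then show ?thesis by (simp add: image_image)
qed

text \<open>One inclusion is proved for arbitrary h and K; the other is that inclusion for the
  inverse of h and the conjugated set.\<close>

lemma conj_normalizer:
  assumes "h \<in> carrier G" "K \<subseteq> carrier G"
  shows "normalizer G (conj h ` K) = conj h ` normalizer G K"
proof -
  have sub: "conj h g \<in> normalizer G (conj h ` K)"
    if h: "h \<in> carrier G" and K: "K \<subseteq> carrier G" and g: "g \<in> normalizer G K" for h K g
  proof -
    have gc: "g \<in> carrier G" and eq: "g <# K = K #> g" using g K by (auto simp: normalizer_eq)
    show ?thesis
    proof (rule normalizer_I)
      show "conj h ` K \<subseteq> carrier G" "conj h g \<in> carrier G" using h K gc by auto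
      fix k' assume "k' \<in> conj h ` K"
      then obtain k where k: "k \<in> K" "k' = conj h k" by auto
      then have kc: "k \<in> carrier G" using K by blast
      have "g \<otimes> k \<in> K #> g" using k(1) eq by (auto simp: l_coset_def)
      then obtain l where l: "l \<in> K" "g \<otimes> k = l \<otimes> g" by (auto simp: r_coset_def)
      then have lc: "l \<in> carrier G" using K by blast
      have "conj h g \<otimes> k' = conj h l \<otimes> conj h g"
        using conj_mult[OF h gc kc] conj_mult[OF h lc gc] k l by metis
      then show "\<exists>l\<in>conj h ` K. conj h g \<otimes> k' = l \<otimes> conj h g" using l by blast
      have "k \<otimes> g \<in> g <# K" using k(1) eq by (auto simp: r_coset_def)
      then obtain l where l: "l \<in> K" "k \<otimes> g = g \<otimes> l" by (auto simp: l_coset_def)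
      then have lc: "l \<in> carrier G" using K by blast
      have "k' \<otimes> conj h g = conj h g \<otimes> conj h l"
        using conj_mult[OF h kc gc] conj_mult[OF h gc lc] k l by metis
      then show "\<exists>l\<in>conj h ` K. k' \<otimes> conj h g = conj h g \<otimes> l" using l by blast
    qed
  qed
  show ?thesis
  proof (intro equalityI subsetI)
    fix x assume x: "x \<in> normalizer G (conj h ` K)"
    have K': "conj h ` K \<subseteq> carrier G" using assms by auto
    then have xc: "x \<in> carrier G" using x by (auto simp: normalizer_eq)
    have "conj (inv h) x \<in> normalizer G (conj (inv h) ` conj h ` K)"
      by (rule sub[OF _ K' x]) (simp add: assms)
    then have "conj (inv h) x \<in> normalizer G K" by (simp only: conj_image_inv[OF assms])
    moreover have "x = conj h (conj (inv h) x)" using assms xc by (simp only: conj_inv_conj)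
    ultimately show "x \<in> conj h ` normalizer G K" by blast
  qed (use sub[OF assms] in auto)
qed

lemma conj_center:
  assumes "h \<in> carrier G" "z \<in> center G"
  shows "conj h z = z"
proof -
  have "h \<otimes> z = z \<otimes> h" using center_commute[OF assms(2,1)] by simp
  then show ?thesis using assms center_closed[OF assms(2)] by (simp add: m_assoc)
qed

lemma conj_set_mult_center:
  assumes h: "h \<in> carrier G" and W: "W \<subseteq> carrier G"
  shows "conj h ` W <#> center G = conj h ` (W <#> center G)"
proof -
  have "conj h w \<otimes> z = conj h (w \<otimes> z)" if "w \<in> W" "z \<in> center G" for w z
    using conj_mult[OF h, of w z] conj_center[OF h, of z] that center_closed W by auto
  then have "(\<Union>w\<in>W. \<Union>z\<in>center G. {conj h w \<otimes> z}) = (\<Union>w\<in>W. \<Union>z\<in>center G. {conj h (w \<otimes> z)})"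
    by (intro SUP_cong refl) auto
  then show ?thesis by (simp add: set_mult_def image_UN)
qed

lemma conj_subgroup:
  assumes h: "h \<in> carrier G" and W: "subgroup W G"
  shows "subgroup (conj h ` W) G"
proof -
  note Wc = subgroup.mem_carrier[OF W]
  show ?thesis
  proof (rule subgroupI)
    show "conj h ` W \<subseteq> carrier G" using h Wc by auto
    show "conj h ` W \<noteq> {}" using subgroup.one_closed[OF W] by auto
    show "inv x \<in> conj h ` W" if x: "x \<in> conj h ` W" for x
    proof -
      obtain w where w: "w \<in> W" "x = conj h w" using x by auto
      have "inv x = conj h (inv w)" using w h Wc by (simp add: inv_mult_group m_assoc)
      then show ?thesis using subgroup.m_inv_closed[OF W w(1)] by auto
    qed
    show "x \<otimes> y \<in> conj h ` W" if xy: "x \<in> conj h ` W" "y \<in> conj h ` W" for x y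
    proof -
      obtain v w where vw: "v \<in> W" "w \<in> W" "x = conj h v" "y = conj h w" using xy by auto
      then have "x \<otimes> y = conj h (v \<otimes> w)" using conj_mult[OF h] Wc by simp
      then show ?thesis using subgroup.m_closed[OF W] vw by auto
    qed
  qed
qed

end

section \<open>The groups \<open>C\<close> and \<open>P\<close>\<close>

lemma C_mat_nth [simp]:
  "C_mat \<alpha> \<theta> \<delta> \<epsilon> $ 1 $ 1 = 1" "C_mat \<alpha> \<theta> \<delta> \<epsilon> $ 1 $ 2 = 0" "C_mat \<alpha> \<theta> \<delta> \<epsilon> $ 1 $ 3 = 0"
  "C_mat \<alpha> \<theta> \<delta> \<epsilon> $ 2 $ 1 = \<alpha>" "C_mat \<alpha> \<theta> \<delta> \<epsilon> $ 2 $ 2 = \<theta>" "C_mat \<alpha> \<theta> \<delta> \<epsilon> $ 2 $ 3 = 0"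
  "C_mat \<alpha> \<theta> \<delta> \<epsilon> $ 3 $ 1 = \<delta>" "C_mat \<alpha> \<theta> \<delta> \<epsilon> $ 3 $ 2 = \<epsilon>" "C_mat \<alpha> \<theta> \<delta> \<epsilon> $ 3 $ 3 = inverse \<theta>"
  by (simp_all add: C_mat_def vector_3)

lemma C_mat_eq_iff [simp]:
  "C_mat \<alpha> \<theta> \<delta> \<epsilon> = C_mat \<alpha>' \<theta>' \<delta>' \<epsilon>' \<longleftrightarrow> \<alpha> = \<alpha>' \<and> \<theta> = \<theta>' \<and> \<delta> = \<delta>' \<and> \<epsilon> = \<epsilon>'"
  by (auto simp: vec_eq_iff forall_3)

lemma C_mat_mult [simp]:
  "C_mat \<alpha> \<theta> \<delta> \<epsilon> ** C_mat \<alpha>' \<theta>' \<delta>' \<epsilon>' =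
    C_mat (\<alpha> + \<theta> * \<alpha>') (\<theta> * \<theta>') (\<delta> + \<epsilon> * \<alpha>' + inverse \<theta> * \<delta>') (\<epsilon> * \<theta>' + inverse \<theta> * \<epsilon>')"
  by (simp add: vec_eq_iff forall_3 matrix_matrix_mult_def sum_3)

lemma C_mat_1: "mat 1 = C_mat 0 1 0 0"
  by (simp add: vec_eq_iff forall_3 mat_def)

lemma mult_C_group [simp]: "x \<otimes>\<^bsub>C_group\<^esub> y = x ** y"
  and one_C_group [simp]: "\<one>\<^bsub>C_group\<^esub> = C_mat 0 1 0 0"
  by (simp_all add: C_group_def C_mat_1)

lemma C_mat_in_C_group [simp]: "C_mat \<alpha> \<theta> \<delta> \<epsilon> \<in> carrier C_group \<longleftrightarrow> \<theta> \<noteq> 0"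
  by (auto simp: C_group_def)

lemma C_group_cases [elim?]:
  assumes "x \<in> carrier C_group"
  obtains \<alpha> \<theta> \<delta> \<epsilon> where "x = C_mat \<alpha> \<theta> \<delta> \<epsilon>" "\<theta> \<noteq> 0"
  using assms by (auto simp: C_group_def)

lemma C_mat_in_W_subgroup [simp]: "C_mat \<alpha> \<theta> \<delta> \<epsilon> \<in> W_subgroup \<longleftrightarrow> \<theta> = 1 \<and> \<epsilon> = 0"
  by (auto simp: W_subgroup_def)

lemma group_C_group: "group (C_group :: ('f::field^3^3) monoid)"
proof (rule groupI)
  fix x :: "'f^3^3" assume "x \<in> carrier C_group"
  then obtain \<alpha> \<theta> \<delta> \<epsilon> where x: "x = C_mat \<alpha> \<theta> \<delta> \<epsilon>" "\<theta> \<noteq> 0" by (rule C_group_cases)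
  then show "\<exists>y\<in>carrier C_group. y \<otimes>\<^bsub>C_group\<^esub> x = \<one>\<^bsub>C_group\<^esub>"
    by (intro bexI[of _ "C_mat (- \<alpha> / \<theta>) (inverse \<theta>) (\<epsilon> * \<alpha> - \<theta> * \<delta>) (- \<epsilon>)"]) (auto simp: field_simps)
next
  show "x \<otimes>\<^bsub>C_group\<^esub> y \<in> carrier C_group" if "x \<in> carrier C_group" "y \<in> carrier C_group" for x y :: "'f^3^3"
    using that by (auto elim!: C_group_cases)
qed (auto elim!: C_group_cases simp: matrix_mul_assoc)

section \<open>Coordinates on 2x2 matrices and the structure of P\<close>

definition mat2 :: "'f::field \<Rightarrow> 'f \<Rightarrow> 'f \<Rightarrow> 'f \<Rightarrow> 'f^2^2" where
  "mat2 a b c d = vector [vector [a, b], vector [c, d]]"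

lemma mat2_nth [simp]:
  "mat2 a b c d $ 1 $ 1 = a" "mat2 a b c d $ 1 $ 2 = b"
  "mat2 a b c d $ 2 $ 1 = c" "mat2 a b c d $ 2 $ 2 = d"
  by (simp_all add: mat2_def vector_2)

lemma mat2_eq_iff [simp]: "mat2 a b c d = mat2 a' b' c' d' \<longleftrightarrow> a = a' \<and> b = b' \<and> c = c' \<and> d = d'"
  by (auto simp: vec_eq_iff forall_2)

lemma mat2_mult [simp]:
  "mat2 a b c d ** mat2 a' b' c' d' =
    mat2 (a * a' + b * c') (a * b' + b * d') (c * a' + d * c') (c * b' + d * d')"
  by (simp add: vec_eq_iff forall_2 matrix_matrix_mult_def sum_2)

lemma mat2_1: "mat 1 = mat2 1 0 0 1"
  by (simp add: vec_eq_iff forall_2 mat_def)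

lemma mat2_cases: obtains a b c d where "A = mat2 a b c d"
  by (rule that[of "A $ 1 $ 1" "A $ 1 $ 2" "A $ 2 $ 1" "A $ 2 $ 2"]) (simp add: vec_eq_iff forall_2)

lemma det_mat2 [simp]: "det (mat2 a b c d) = a * d - b * c"
  by (simp add: det_2)

lemma invertible_mat2 [simp]: "invertible (mat2 a b c d) \<longleftrightarrow> a * d - b * c \<noteq> 0"
  by (simp add: invertible_det_nz)

text \<open>Since m is positive, the bound puts the characteristic above 2, so 2 is invertible and
  the skew form is alternating. It also leaves room for root counts in degree m on the nonzero
  elements of F.\<close>

locale parabolic =
  fixes m :: nat and F :: "'f::{field,finite} itself"
  assumes odd_m: "odd m" and m_less: "m + 2 \<le> CHAR('f)"
begin

abbreviation P :: "(('f \<times> ('f^2^2)) \<times> ('f poly poly \<times> 'f)) monoid" where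
  "P \<equiv> P_group m"

lemma m_pos: "m > 0" using odd_m by (cases m) auto

lemma m_less_CHAR: "m < CHAR('f)" using m_less by simp

lemma CARD_ge: "m + 2 \<le> CARD('f)"
  using m_less CHAR_le_CARD[where 'f = 'f] by simp

lemma two_nonzero [simp]: "(2 :: 'f) \<noteq> 0"
proof
  assume "(2 :: 'f) = 0"
  then have "CHAR('f) dvd 2"
    using of_nat_eq_0_iff_char_dvd[where 'a = 'f, of 2] by simp
  then have "CHAR('f) \<le> 2" by (rule dvd_imp_le) simp
  with m_less m_pos show False by simp
qed

lemma eq_uminus_iff [simp]: "x = - x \<longleftrightarrow> x = 0" "- x = x \<longleftrightarrow> x = 0" for x :: 'f
proof -
  have "x = - x \<longleftrightarrow> 2 * x = 0"
    by (simp only: mult_2 eq_neg_iff_add_eq_0)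
  then show "x = - x \<longleftrightarrow> x = 0" by simp
  then show "- x = x \<longleftrightarrow> x = 0" by auto
qed

lemma one_neq_uminus_one [simp]: "(1 :: 'f) \<noteq> - 1"
  using eq_uminus_iff(1)[of 1] by simp

lemma form_self [simp]: "form m v v = (0 :: 'f)"
  using form_skew[OF odd_m, of v v] by simp

lemma P_mult:
  "((t, A), (v, z)) \<otimes>\<^bsub>P\<^esub> ((t', A'), (v', z')) =
    ((t * t', A ** A'),
     (scalar t' * mat_act m v A' + v', t'\<^sup>2 * det A' ^ m * z + z' + t' * form m (mat_act m v A') v'))"
  by (simp add: P_group_def semidirect_def L_group_def units_group_def GL2_def DirProd_def
      Q_group_def Q_act_def)

lemma P_one: "\<one>\<^bsub>P\<^esub> = ((1, mat2 1 0 0 1), (0, 0))"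
  by (simp add: P_group_def semidirect_def L_group_def units_group_def GL2_def DirProd_def
      Q_group_def mat2_1)

lemma P_carrier [simp]:
  "((t, A), (v, z)) \<in> carrier P \<longleftrightarrow> t \<noteq> 0 \<and> invertible A \<and> v \<in> hom_polys m"
  by (auto simp: P_group_def semidirect_def L_group_def units_group_def GL2_def DirProd_def
      Q_group_def)

lemma P_cases:
  assumes "x \<in> carrier P"
  obtains t a b c d v z where "x = ((t, mat2 a b c d), (v, z))" "t \<noteq> 0" "a * d - b * c \<noteq> 0" "v \<in> hom_polys m"
proof -
  obtain t A v z where x: "x = ((t, A), (v, z))" by (metis prod.exhaust)
  obtain a b c d where "A = mat2 a b c d" by (rule mat2_cases)
  with x assms that show thesis by auto
qed

lemmas act_mult [simp] = mat_act_mult[OF m_less_CHAR]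
lemmas form_act = form_mat_act[OF m_less_CHAR]
lemmas form_lin = form_lin_power[OF m_less_CHAR]

lemma act_1 [simp]: "v \<in> hom_polys m \<Longrightarrow> mat_act m v (mat2 1 0 0 1) = (v :: 'f poly poly)"
  using mat_act_1[OF m_less_CHAR] by (simp add: mat2_1)

lemma group_P: "group P"
proof (rule groupI)
  show "x \<otimes>\<^bsub>P\<^esub> y \<in> carrier P" if "x \<in> carrier P" "y \<in> carrier P" for x y
    using that by (cases x; cases y) (auto simp: P_mult invertible_mult)
  show "\<one>\<^bsub>P\<^esub> \<in> carrier P"
    by (simp add: P_one)
next
  fix x y w assume "x \<in> carrier P" "y \<in> carrier P" "w \<in> carrier P"
  moreover obtain t1 A1 v1 z1 where "x = ((t1, A1), (v1, z1))" by (metis prod.exhaust)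
  moreover obtain t2 A2 v2 z2 where "y = ((t2, A2), (v2, z2))" by (metis prod.exhaust)
  moreover obtain t3 A3 v3 z3 where "w = ((t3, A3), (v3, z3))" by (metis prod.exhaust)
  ultimately show "x \<otimes>\<^bsub>P\<^esub> y \<otimes>\<^bsub>P\<^esub> w = x \<otimes>\<^bsub>P\<^esub> (y \<otimes>\<^bsub>P\<^esub> w)"
    \<comment> \<open>\<open>form_act\<close> supplies the factor det^m by which the action
      multiplies the second component of Q: this is the fact that L acts by automorphisms.\<close>
    by (simp add: P_mult form_act matrix_mul_assoc det_mul flip: act_mult)
      (simp add: algebra_simps power2_eq_square power_mult_distrib)
next
  fix x assume "x \<in> carrier P"
  then show "\<one>\<^bsub>P\<^esub> \<otimes>\<^bsub>P\<^esub> x = x"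
    by (cases x) (auto simp: P_one P_mult simp flip: mat2_1)
next
  fix x assume x: "x \<in> carrier P"
  then obtain t a b c d v z where
    x: "x = ((t, mat2 a b c d), (v, z))" "t \<noteq> 0" "a * d - b * c \<noteq> 0" "v \<in> hom_polys m"
    by (rule P_cases)
  define D where "D = a * d - b * c"
  have D: "D \<noteq> 0" using x by (simp add: D_def)
  define B where "B = mat2 (d / D) (- b / D) (- c / D) (a / D)"
  have B: "B ** mat2 a b c d = mat2 1 0 0 1"
    using D by (auto simp: B_def field_simps) (auto simp: D_def algebra_simps)
  then have "invertible B"
    by (metis invertible_left_inverse invertible_mat2 x(3) mat2_1 matrix_left_right_inverse)
  \<comment> \<open>No form value enters the last component: in the product with x the V-part of
    \<open>?y\<close> becomes - v, and the form is alternating.\<close>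
  let ?y = "((inverse t, B), (- scalar (inverse t) * mat_act m v B, - z / (t\<^sup>2 * D ^ m)))"
  have "?y \<in> carrier P"
    using \<open>invertible B\<close> x by auto
  moreover have "?y \<otimes>\<^bsub>P\<^esub> x = \<one>\<^bsub>P\<^esub>"
    using x D by (simp add: P_mult P_one B flip: D_def)
      (simp flip: scalar_simps mult.assoc)
  ultimately show "\<exists>y\<in>carrier P. y \<otimes>\<^bsub>P\<^esub> x = \<one>\<^bsub>P\<^esub>" by blast
qed

sublocale P: group P by (rule group_P)

text \<open>A lower triangular matrix maps X to a multiple of X and so preserves divisibility by
  powers of X. The first formula is its action modulo X; the second, for shears, goes one power
  further.\<close>

lemma act_coeffs:
  fixes v :: "'f poly poly"
  assumes "v \<in> hom_polys m"
  shows act_top: "coeff_XY (mat_act m v (mat2 a 0 c d)) 0 m = d ^ m * coeff_XY v 0 m"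
    and act_second: "coeff_XY (mat_act m v (mat2 1 0 c 1)) 1 (m - 1)
      = coeff_XY v 1 (m - 1) + of_nat m * c * coeff_XY v 0 m"
    and act_diag: "i \<le> m \<Longrightarrow>
      coeff_XY (mat_act m v (mat2 a 0 0 d)) i (m - i) = a ^ i * d ^ (m - i) * coeff_XY v i (m - i)"
proof -
  have second: "coeff_XY (lin a b ^ m) 1 (m - 1) = of_nat m * a * b ^ (m - 1)" for a b :: 'f
    using coeff_XY_lin_power[of 1 m a b] m_pos by simp
  let ?f = "\<lambda>v :: 'f poly poly. coeff_XY (mat_act m v (mat2 a 0 c d)) 0 m - d ^ m * coeff_XY v 0 m"
  have "?f v = 0"
    by (rule lin_powers_span[where f = ?f, OF m_less_CHAR _ _ _ assms])
      (simp_all add: mat_act_lin_power power_mult_distrib algebra_simps)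
  then show "coeff_XY (mat_act m v (mat2 a 0 c d)) 0 m = d ^ m * coeff_XY v 0 m" by simp
  let ?f = "\<lambda>v :: 'f poly poly. coeff_XY (mat_act m v (mat2 1 0 c 1)) 1 (m - 1)
      - (coeff_XY v 1 (m - 1) + of_nat m * c * coeff_XY v 0 m)"
  have "?f v = 0"
  proof (rule lin_powers_span[where f = ?f, OF m_less_CHAR _ _ _ assms])
    show "?f (lin 1 b ^ m) = 0" for b
    proof -
      have "b ^ m = b * b ^ (m - 1)" using m_pos by (metis power_eq_if neq0_conv)
      then show ?thesis
        unfolding mat_act_lin_power second by (simp add: algebra_simps)
    qed
  qed (simp_all add: algebra_simps)
  then show "coeff_XY (mat_act m v (mat2 1 0 c 1)) 1 (m - 1)
      = coeff_XY v 1 (m - 1) + of_nat m * c * coeff_XY v 0 m" by simp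
  assume i: "i \<le> m"
  let ?f = "\<lambda>v :: 'f poly poly. coeff_XY (mat_act m v (mat2 a 0 0 d)) i (m - i)
      - a ^ i * d ^ (m - i) * coeff_XY v i (m - i)"
  have "?f v = 0"
    by (rule lin_powers_span[where f = ?f, OF m_less_CHAR _ _ _ assms])
      (simp_all add: i mat_act_lin_power power_mult_distrib algebra_simps)
  then show "coeff_XY (mat_act m v (mat2 a 0 0 d)) i (m - i) = a ^ i * d ^ (m - i) * coeff_XY v i (m - i)"
    by simp
qed

lemma act_scalar:
  fixes v :: "'f poly poly"
  assumes "v \<in> hom_polys m"
  shows "mat_act m v (mat2 l 0 0 l) = scalar (l ^ m) * v"
  by (rule hom_polys_eqI) (use assms in \<open>auto simp: act_diag simp flip: power_add simp del: scalar_simps\<close>)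

lemma X_power: "lin 1 0 ^ m = (var_X ^ m :: 'f poly poly)"
  by (simp add: lin_def)

lemma form_nondegenerate:
  fixes v :: "'f poly poly"
  assumes v: "v \<in> hom_polys m" and zero: "\<And>w. w \<in> hom_polys m \<Longrightarrow> form m v w = 0"
  shows "v = 0"
proof (rule hom_polys_eqI[OF v])
  fix i assume i: "i \<le> m"
  let ?w = "var_X ^ (m - i) * var_Y ^ i :: 'f poly poly"
  have "form m v ?w = (\<Sum>a\<le>m. if a = i then (- 1) ^ i * coeff_XY v i (m - i) / of_nat (m choose i) else 0)"
    unfolding form_altdef using i by (intro sum.cong) (auto simp: coeff_XY_monomial)
  then have "(- 1) ^ i * coeff_XY v i (m - i) / of_nat (m choose i) = 0"
    using zero[of ?w] i monomial_in_hom_polys[of "m - i" i m] by simp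
  then show "coeff_XY v i (m - i) = coeff_XY 0 i (m - i)"
    using of_nat_binomial_nonzero[OF m_less_CHAR i] by simp
qed simp

text \<open>Otherwise X^m - 1 would have |F| - 1 > m roots. The matrix diag(d, 1) then moves Z(Q),
  which keeps Z(Q) out of the centre of P.\<close>

lemma exists_power_neq_1: "\<exists>d::'f. d \<noteq> 0 \<and> d ^ m \<noteq> 1"
proof (rule ccontr)
  assume "\<not> ?thesis"
  then have "poly (monom 1 m - 1) x = 0" if "x \<in> UNIV - {0 :: 'f}" for x
    using that by (auto simp: poly_monom)
  moreover have "degree (monom 1 m - 1 :: 'f poly) \<le> m"
    by (intro degree_diff_le) (auto simp: degree_monom_le)
  ultimately have "monom 1 m - 1 = (0 :: 'f poly)"
    using CARD_ge by (intro poly_eq_0_if_many_roots[of "UNIV - {0}"]) (auto simp: card_Diff_subset)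
  then have "coeff (monom 1 m - 1 :: 'f poly) m = 0" by simp
  then show False using m_pos by simp
qed

lemma center_P: "center P = {((inverse (l ^ m), mat2 l 0 0 l), (0, 0)) | l. l \<noteq> 0}"
proof (intro equalityI subsetI)
  fix x :: "('f \<times> ('f^2^2)) \<times> ('f poly poly \<times> 'f)"
  assume "x \<in> {((inverse (l ^ m), mat2 l 0 0 l), (0, 0)) | l :: 'f. l \<noteq> 0}"
  then obtain l where l: "l \<noteq> 0" and x: "x = ((inverse (l ^ m), mat2 l 0 0 l), (0, 0))" by blast
  have "x \<otimes>\<^bsub>P\<^esub> g = g \<otimes>\<^bsub>P\<^esub> x" if "g \<in> carrier P" for g
    using that
  proof (cases rule: P_cases)
    case (1 t a b c d v z)
    have "(inverse (l ^ m))\<^sup>2 * (l * l) ^ m = 1"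
      using l by (simp add: power_mult_distrib power2_eq_square field_simps)
    moreover have "scalar (inverse (l ^ m)) * (scalar (l ^ m) * v) = v"
      using l by (simp flip: scalar_simps mult.assoc)
    ultimately show ?thesis
      using 1 l by (simp add: x P_mult act_scalar mult.commute del: scalar_simps)
  qed
  then show "x \<in> center P"
    using l by (simp add: x center_def)
next
  fix x assume x: "x \<in> center P"
  then have "x \<in> carrier P" by (rule P.center_closed)
  then obtain t a b c d v z where
    xe: "x = ((t, mat2 a b c d), (v, z))" and t: "t \<noteq> 0" "a * d - b * c \<noteq> 0" "v \<in> hom_polys m"
    by (rule P_cases)
  have comm: "x \<otimes>\<^bsub>P\<^esub> g = g \<otimes>\<^bsub>P\<^esub> x" if "g \<in> carrier P" for g
    using P.center_commute[OF x that] .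
  have V: "scalar t * mat_act m w (mat2 a b c d) = w" and fm: "form m v w = 0" if w: "w \<in> hom_polys m" for w
  proof -
    have "x \<otimes>\<^bsub>P\<^esub> ((1, mat2 1 0 0 1), (w, 0)) = ((1, mat2 1 0 0 1), (w, 0)) \<otimes>\<^bsub>P\<^esub> x"
      by (rule comm) (simp add: w)
    then have *: "v + w = scalar t * mat_act m w (mat2 a b c d) + v"
      "z + form m v w = z + t * form m (mat_act m w (mat2 a b c d)) v"
      using t by (simp_all add: xe P_mult)
    then show V: "scalar t * mat_act m w (mat2 a b c d) = w" by (simp add: add.commute)
    \<comment> \<open>The linear part of x fixes w, so the values of the form at (v, w) and (w, v)
      agree, and skew symmetry makes them zero.\<close>
    have "form m v w = form m (scalar t * mat_act m w (mat2 a b c d)) v"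
      using *(2) by simp
    then show "form m v w = 0"
      using form_skew[OF odd_m, of v w] by (simp add: V)
  qed
  have v0: "v = 0" using form_nondegenerate[OF t(3) fm] .
  have z0: "z = 0"
  proof -
    obtain e :: 'f where e: "e \<noteq> 0" "e ^ m \<noteq> 1" using exists_power_neq_1 by blast
    have "x \<otimes>\<^bsub>P\<^esub> ((1, mat2 e 0 0 1), (0, 0)) = ((1, mat2 e 0 0 1), (0, 0)) \<otimes>\<^bsub>P\<^esub> x"
      by (rule comm) (simp add: e)
    then show ?thesis using e by (simp add: xe v0 P_mult)
  qed
  \<comment> \<open>Fixing X^m and Y^m makes the matrix diagonal with t a^m = 1; fixing X^(m - 1) Y
    then identifies the two diagonal entries.\<close>
  have "coeff_XY (scalar t * mat_act m (lin 1 0 ^ m) (mat2 a b c d)) i (m - i) = coeff_XY (lin 1 0 ^ m) i (m - i)"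
    "coeff_XY (scalar t * mat_act m (lin 0 1 ^ m) (mat2 a b c d)) i (m - i) = coeff_XY (lin 0 1 ^ m) i (m - i)"
    if "i \<le> m" for i
    by (simp_all only: V lin_power_in_hom_polys)
  from this[of 0] this[of m] have "t * b ^ m = 0" "t * c ^ m = 0" "t * a ^ m = 1"
    using m_pos by (simp_all add: mat_act_lin_power)
  then have bc: "b = 0" "c = 0" and ta: "t * a ^ m = 1" using t m_pos by auto
  let ?w = "var_X ^ (m - 1) * var_Y :: 'f poly poly"
  have w: "?w \<in> hom_polys m" using monomial_in_hom_polys[of "m - 1" 1 m] m_pos by simp
  have w1: "coeff_XY ?w (m - 1) (m - (m - 1)) = 1"
    using coeff_XY_monomial[of "m - 1" 1, where 'f = 'f] m_pos by simp
  have "coeff_XY (scalar t * mat_act m ?w (mat2 a 0 0 d)) (m - 1) (m - (m - 1)) = 1"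
    using V[OF w] bc w1 by simp
  then have "t * (a ^ (m - 1) * d) = 1"
    using act_diag[OF w, of "m - 1"] w1 m_pos by simp
  moreover have "t * (a ^ (m - 1) * a) = 1"
    using ta m_pos by (metis power_minus_mult)
  ultimately have "d = a"
    using t(1) by (metis mult_cancel_left mult_zero_left mult_zero_right zero_neq_one)
  moreover have "a \<noteq> 0" using t bc by auto
  moreover have "t = inverse (a ^ m)" using ta by (metis inverse_unique mult.commute)
  ultimately show "x \<in> {((inverse (l ^ m), mat2 l 0 0 l), (0, 0)) | l. l \<noteq> 0}"
    using xe v0 z0 bc by auto
qed

end

section \<open>Subgroups of prime power order\<close>

text \<open>Stated for rings, as it is applied both to elements of F and to the indeterminate of the
  polynomial ring over F.\<close>

lemma minus_one_power_CHAR: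
  fixes x :: "'a::comm_ring_1"
  assumes "prime CHAR('a)"
  shows "(x - 1) ^ (CHAR('a) ^ k) = x ^ (CHAR('a) ^ k) - 1"
  using freshmans_dream'[OF assms refl, of "x - 1" 1 k] by simp

lemma power_CHAR_power_eq_1:
  fixes x :: "'f::{field,finite}"
  assumes "x ^ (CHAR('f) ^ k) = 1"
  shows "x = 1"
  using minus_one_power_CHAR[OF prime_CHAR[where 'f = 'f], of x k] assms by simp

lemma (in group) pow_card_subgroup:
  assumes "subgroup H G" "x \<in> H" "finite H"
  shows "x [^] card H = \<one>"
proof -
  interpret H: group "G\<lparr>carrier := H\<rparr>" by (rule subgroup_imp_group[OF assms(1)])
  have "x [^]\<^bsub>G\<lparr>carrier := H\<rparr>\<^esub> order (G\<lparr>carrier := H\<rparr>) = \<one>\<^bsub>G\<lparr>carrier := H\<rparr>\<^esub>"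
    using assms by (intro H.pow_order_eq_1) auto
  then show ?thesis by (simp add: order_def nat_pow_consistent[symmetric])
qed

context parabolic
begin

text \<open>By Cayley-Hamilton, A^n = x A + y whenever x X + y is congruent to X^n modulo the
  characteristic polynomial of A. The congruence is kept beside the matrix so that X^n - 1 can be
  compared with that polynomial when A^n = 1.\<close>

lemma pow_linear_part:
  assumes w: "w = ((t, mat2 a b c d), (v, z))" "w \<in> carrier P"
  shows "\<exists>x y. fst (w [^]\<^bsub>P\<^esub> n) = (t ^ n, mat2 (x * a + y) (x * b) (x * c) (x * d + y))
    \<and> [:a * d - b * c, - (a + d), 1:] dvd (monom 1 n - [:y, x:])"
proof (induction n)
  case 0
  show ?case
    by (rule exI[of _ 0], rule exI[of _ 1]) (simp add: P_one one_pCons)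
next
  case (Suc n)
  then obtain x y where IH: "fst (w [^]\<^bsub>P\<^esub> n) = (t ^ n, mat2 (x * a + y) (x * b) (x * c) (x * d + y))"
    and dvd: "[:a * d - b * c, - (a + d), 1:] dvd (monom 1 n - [:y, x:])" by blast
  obtain v' z' where wn: "w [^]\<^bsub>P\<^esub> n = ((t ^ n, mat2 (x * a + y) (x * b) (x * c) (x * d + y)), (v', z'))"
    using IH by (metis prod.collapse)
  define x' y' where "x' = x * (a + d) + y" and "y' = - (x * (a * d - b * c))"
  have "fst (w [^]\<^bsub>P\<^esub> Suc n) = (t ^ Suc n, mat2 (x' * a + y') (x' * b) (x' * c) (x' * d + y'))"
    unfolding nat_pow_Suc wn by (simp add: w(1) P_mult x'_def y'_def algebra_simps)
  moreover have "monom 1 (Suc n) - [:y', x':]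
      = [:0, 1:] * (monom 1 n - [:y, x:]) + [:x:] * [:a * d - b * c, - (a + d), 1:]"
    by (simp add: monom_Suc x'_def y'_def algebra_simps)
  with dvd have "[:a * d - b * c, - (a + d), 1:] dvd (monom 1 (Suc n) - [:y', x':])"
    by (simp only: dvd_add dvd_mult dvd_triv_right)
  ultimately show ?case by blast
qed

text \<open>The characteristic polynomial divides \<open>X^N - 1 = (X - 1)^N\<close> for \<open>N = p^k\<close>.\<close>

lemma pow_eq_one_unipotent:
  assumes w: "w = ((t, mat2 a b c d), (v, z))" "w \<in> carrier P"
    and one: "w [^]\<^bsub>P\<^esub> (CHAR('f) ^ k) = \<one>\<^bsub>P\<^esub>"
  shows "t = 1" "a + d = 2" "a * d - b * c = 1"
proof -
  define N where "N = CHAR('f) ^ k"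
  have N: "N > 0" using prime_gt_0_nat[OF prime_CHAR[where 'f = 'f]] by (simp add: N_def)
  obtain x y where xy: "fst (w [^]\<^bsub>P\<^esub> N) = (t ^ N, mat2 (x * a + y) (x * b) (x * c) (x * d + y))"
    "[:a * d - b * c, - (a + d), 1:] dvd (monom 1 N - [:y, x:])"
    using pow_linear_part[OF w] by blast
  have eqs: "t ^ N = 1" "x * a + y = 1" "x * b = 0" "x * c = 0" "x * d + y = 1"
    using xy(1) one by (auto simp: N_def P_one)
  show "t = 1" using eqs(1) power_CHAR_power_eq_1 by (simp add: N_def)
  obtain q where q: "monom 1 N - [:y, x:] = [:a * d - b * c, - (a + d), 1:] * q"
    using xy(2) by (rule dvdE)
  have ad: "a + d = 2 \<and> a * d - b * c = 1"
  proof (cases "x = 0")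
    \<comment> \<open>Here x A + y = 1 makes A itself scalar, and its only eigenvalue satisfies a^N
      = 1.\<close>
    case False
    have "x * a = x * d" using eqs(2,5) by (metis add_right_cancel)
    then have abcd: "b = 0" "c = 0" "d = a" using eqs False by auto
    have "poly (monom 1 N - [:y, x:]) a = 0"
      unfolding q by (simp add: abcd algebra_simps)
    then have "a ^ N = x * a + y" by (simp add: poly_monom algebra_simps)
    then have "a = 1" using eqs power_CHAR_power_eq_1 by (simp add: N_def)
    then show ?thesis by (simp add: abcd)
  next
    case True
    then have y: "y = 1" using eqs by simp
    have *: "e = 1" if root: "poly [:a * d - b * c, - (a + d), 1:] e = 0" for e
    proof -
      have "poly (monom 1 N - [:y, x:]) e = 0"
        unfolding q poly_mult root by simp
      then show ?thesis using power_CHAR_power_eq_1 by (simp add: poly_monom True y N_def)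
    qed
    have "poly [:a * d - b * c, - (a + d), 1:] 1 = 0"
    proof (rule ccontr)
      let ?\<chi> = "[:a * d - b * c, - (a + d), 1:]"
      assume nz: "poly ?\<chi> 1 \<noteq> 0"
      define u where "u = poly ?\<chi> 1"
      have u: "u = 1 - (a + d) + (a * d - b * c)" by (simp add: u_def)
      have "[:- 1, 1:] ^ N = (monom 1 N - [:y, x:] :: 'f poly)"
      proof -
        have "[:0, 1:] - 1 = [:- 1, 1 :: 'f:]" by (simp add: one_pCons)
        moreover have "([:0, 1:] - 1) ^ N = [:0, 1 :: 'f:] ^ N - 1"
          using minus_one_power_CHAR[where 'a = "'f poly", of "[:0, 1:]" k] prime_CHAR[where 'f = 'f]
          by (simp add: N_def)
        ultimately show ?thesis
          by (simp add: True y monom_altdef one_pCons)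
      qed
      \<comment> \<open>The second linear factor is chosen so that the product of both is
        \<open>?\<chi> - [:u:]\<close>. Hence \<open>?\<chi>\<close> would divide a power of the
        nonzero constant - u.\<close>
      then have "?\<chi> dvd [:- 1, 1:] ^ N * [:1 - (a + d), 1:] ^ N"
        unfolding q by (metis dvd_mult2 dvd_triv_left)
      also have "[:- 1, 1:] ^ N * [:1 - (a + d), 1:] ^ N = (?\<chi> - [:u:]) ^ N"
        unfolding power_mult_distrib[symmetric] by (simp add: u algebra_simps)
      finally have "?\<chi> dvd (?\<chi> - [:u:]) ^ N" .
      moreover have "?\<chi> dvd (?\<chi> - [:u:]) ^ N - (- [:u:]) ^ N"
        unfolding power_diff_sumr2[of "?\<chi> - [:u:]"] by (intro dvd_mult2) simp
      ultimately have "?\<chi> dvd (- [:u:]) ^ N"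
        by (metis dvd_diff_commute dvd_add_right_iff diff_add_cancel)
      then have "degree ?\<chi> \<le> degree ((- [:u:]) ^ N)"
      proof (rule dvd_imp_degree_le)
        have "u \<noteq> 0" using nz unfolding u_def .
        then show "(- [:u:]) ^ N \<noteq> 0" by simp
      qed
      also have "(- [:u:]) ^ N = [:(- u) ^ N:]"
        by (induction N) (simp_all add: one_pCons)
      finally have "degree ?\<chi> \<le> 0" by simp
      then show False by simp
    qed
    \<comment> \<open>Once 1 is a root, the other root is the determinant; it equals 1 as well, and
      the trace is 2.\<close>
    moreover have "poly [:a * d - b * c, - (a + d), 1:] (a * d - b * c) = (a * d - b * c) * poly [:a * d - b * c, - (a + d), 1:] 1"
      by (simp add: algebra_simps)
    ultimately show ?thesis using *[of "a * d - b * c"] by (auto simp: algebra_simps)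
  qed
  then show "a + d = 2" "a * d - b * c = 1" by auto
qed

end

section \<open>Necessity\<close>

text \<open>This records what \<open>pull_back_iso\<close> delivers for P. A locale is used because
  the same facts are needed again for a conjugate of W0.\<close>

locale normalizer_datum = parabolic m F for m and F :: "'f::{field,finite} itself" +
  fixes W0 :: "(('f \<times> ('f^2^2)) \<times> ('f poly poly \<times> 'f)) set"
    and \<Phi> :: "('f \<times> ('f^2^2)) \<times> ('f poly poly \<times> 'f) \<Rightarrow> 'f^3^3"
  assumes W0: "subgroup W0 P" and card_W0: "\<exists>k. card W0 = CHAR('f) ^ k"
    and \<Phi>_mult: "\<And>x y. x \<in> normalizer P (W0 <#>\<^bsub>P\<^esub> center P) \<Longrightarrow>
      y \<in> normalizer P (W0 <#>\<^bsub>P\<^esub> center P) \<Longrightarrow> \<Phi> (x \<otimes>\<^bsub>P\<^esub> y) = \<Phi> x ** \<Phi> y"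
    and \<Phi>_surj: "\<Phi> ` normalizer P (W0 <#>\<^bsub>P\<^esub> center P) = carrier C_group"
    and \<Phi>_ker: "\<And>x. x \<in> normalizer P (W0 <#>\<^bsub>P\<^esub> center P) \<Longrightarrow> \<Phi> x = C_mat 0 1 0 0 \<longleftrightarrow> x \<in> center P"
    and \<Phi>_W: "\<And>x. x \<in> normalizer P (W0 <#>\<^bsub>P\<^esub> center P) \<Longrightarrow>
      \<Phi> x \<in> W_subgroup \<longleftrightarrow> x \<in> W0 <#>\<^bsub>P\<^esub> center P"
begin

abbreviation "K \<equiv> W0 <#>\<^bsub>P\<^esub> center P"
abbreviation "N \<equiv> normalizer P K"

lemma K_subgroup: "subgroup K P" and W0_K: "W0 \<subseteq> K" and center_K: "center P \<subseteq> K"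
  using P.set_mult_center[OF W0] .

lemma K_carrier: "K \<subseteq> carrier P" by (rule subgroup.subset[OF K_subgroup])

lemma N_subgroup: "subgroup N P"
  by (rule P.normalizer_imp_subgroup) (rule K_carrier)

lemma K_N: "K \<subseteq> N"
proof
  fix k assume k: "k \<in> K"
  show "k \<in> N"
  proof (rule P.normalizer_I[OF K_carrier])
    have kc: "k \<in> carrier P" using k K_carrier by auto
    then show "k \<in> carrier P" .
    fix l assume l: "l \<in> K"
    then have lc: "l \<in> carrier P" using K_carrier by auto
    have "k \<otimes>\<^bsub>P\<^esub> l \<otimes>\<^bsub>P\<^esub> inv\<^bsub>P\<^esub> k \<in> K" "inv\<^bsub>P\<^esub> k \<otimes>\<^bsub>P\<^esub> l \<otimes>\<^bsub>P\<^esub> k \<in> K"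
      using k l K_subgroup by (auto intro!: subgroup.m_closed subgroup.m_inv_closed)
    moreover have "k \<otimes>\<^bsub>P\<^esub> l = k \<otimes>\<^bsub>P\<^esub> l \<otimes>\<^bsub>P\<^esub> inv\<^bsub>P\<^esub> k \<otimes>\<^bsub>P\<^esub> k"
      using kc lc by (simp add: P.m_assoc)
    moreover have "l \<otimes>\<^bsub>P\<^esub> k = k \<otimes>\<^bsub>P\<^esub> (inv\<^bsub>P\<^esub> k \<otimes>\<^bsub>P\<^esub> l \<otimes>\<^bsub>P\<^esub> k)"
      using kc lc by (simp flip: P.m_assoc)
    ultimately show "\<exists>k'\<in>K. k \<otimes>\<^bsub>P\<^esub> l = k' \<otimes>\<^bsub>P\<^esub> k" "\<exists>k'\<in>K. l \<otimes>\<^bsub>P\<^esub> k = k \<otimes>\<^bsub>P\<^esub> k'" by blast+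
  qed
qed

lemma N_carrier: "N \<subseteq> carrier P" by (rule subgroup.subset[OF N_subgroup])

lemma W0_N: "W0 \<subseteq> N" using W0_K K_N by blast

lemma W0_carrier: "W0 \<subseteq> carrier P" by (rule subgroup.subset[OF W0])

lemma \<Phi>_one: "\<Phi> c = C_mat 0 1 0 0" if "c \<in> center P" for c
  using that \<Phi>_ker center_K K_N by blast

text \<open>Elements of K differ from those of W0 by central factors, which commute with g.\<close>

lemma N_I:
  assumes g: "g \<in> carrier P"
    and "\<And>w. w \<in> W0 \<Longrightarrow> \<exists>w'\<in>W0. w \<otimes>\<^bsub>P\<^esub> g = g \<otimes>\<^bsub>P\<^esub> w'"
    and "\<And>w. w \<in> W0 \<Longrightarrow> \<exists>w'\<in>W0. g \<otimes>\<^bsub>P\<^esub> w = w' \<otimes>\<^bsub>P\<^esub> g"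
  shows "g \<in> N"
proof (rule P.normalizer_I[OF K_carrier g])
  fix k assume "k \<in> K"
  then obtain w c where w: "w \<in> W0" and c: "c \<in> center P" and k: "k = w \<otimes>\<^bsub>P\<^esub> c"
    by (auto simp: set_mult_def)
  have wc: "w \<in> carrier P" "c \<in> carrier P" using w c W0_carrier P.center_closed by auto
  obtain w' where w': "w' \<in> W0" "w \<otimes>\<^bsub>P\<^esub> g = g \<otimes>\<^bsub>P\<^esub> w'" using assms(2)[OF w] by blast
  have w'c: "w' \<in> carrier P" using w' W0_carrier by auto
  have "k \<otimes>\<^bsub>P\<^esub> g = w \<otimes>\<^bsub>P\<^esub> g \<otimes>\<^bsub>P\<^esub> c"
    using wc g P.center_commute[OF c g] by (simp add: k P.m_assoc)
  also have "\<dots> = g \<otimes>\<^bsub>P\<^esub> (w' \<otimes>\<^bsub>P\<^esub> c)"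
    using w' w'c wc g by (simp add: P.m_assoc)
  finally show "\<exists>k'\<in>K. k \<otimes>\<^bsub>P\<^esub> g = g \<otimes>\<^bsub>P\<^esub> k'"
    using w' c by (auto simp: set_mult_def)
  obtain w'' where w'': "w'' \<in> W0" "g \<otimes>\<^bsub>P\<^esub> w = w'' \<otimes>\<^bsub>P\<^esub> g" using assms(3)[OF w] by blast
  have w''c: "w'' \<in> carrier P" using w'' W0_carrier by auto
  have "g \<otimes>\<^bsub>P\<^esub> k = w'' \<otimes>\<^bsub>P\<^esub> (g \<otimes>\<^bsub>P\<^esub> c)"
    using w'' w''c wc g by (simp add: k P.m_assoc[symmetric])
  also have "\<dots> = (w'' \<otimes>\<^bsub>P\<^esub> c) \<otimes>\<^bsub>P\<^esub> g"
    using w''c wc g P.center_commute[OF c g] by (simp add: P.m_assoc)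
  finally show "\<exists>k'\<in>K. g \<otimes>\<^bsub>P\<^esub> k = k' \<otimes>\<^bsub>P\<^esub> g"
    using w'' c by (auto simp: set_mult_def)
qed

lemma W0_cases:
  assumes "w \<in> W0"
  obtains a b c d v z where "w = ((1, mat2 a b c d), (v, z))" "a + d = 2" "a * d - b * c = 1" "v \<in> hom_polys m"
proof -
  have wc: "w \<in> carrier P" using assms W0_carrier by blast
  then obtain t a b c d v z where w: "w = ((t, mat2 a b c d), (v, z))" "v \<in> hom_polys m"
    by (rule P_cases)
  obtain k where k: "card W0 = CHAR('f) ^ k" using card_W0 by blast
  then have "finite W0"
    using prime_gt_0_nat[OF prime_CHAR[where 'f = 'f]] by (intro card_ge_0_finite) simp
  then have "w [^]\<^bsub>P\<^esub> (CHAR('f) ^ k) = \<one>\<^bsub>P\<^esub>"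
    using P.pow_card_subgroup[OF W0 assms] k by simp
  from that pow_eq_one_unipotent[OF w(1) wc this] w show thesis by blast
qed

lemma W0_unipotent:
  assumes "((t, mat2 a b c d), (v, z)) \<in> W0"
  shows "t = 1" "a + d = 2" "a * d - b * c = 1" "v \<in> hom_polys m"
  using W0_cases[OF assms] by auto

text \<open>An element of W0 has trace 2, and a central factor with scalar l multiplies the trace by
  l. So trace 2 leaves only l = 1.\<close>

lemma K_unipotent:
  assumes "((t, mat2 a b c d), (v, z)) \<in> K" "a + d = 2"
  shows "((t, mat2 a b c d), (v, z)) \<in> W0"
proof -
  obtain w e where w: "w \<in> W0" and e: "e \<in> center P"
    and k: "((t, mat2 a b c d), (v, z)) = w \<otimes>\<^bsub>P\<^esub> e"
    using assms(1) by (auto simp: set_mult_def)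
  obtain l where l: "l \<noteq> 0" "e = ((inverse (l ^ m), mat2 l 0 0 l), (0, 0))"
    using e by (auto simp: center_P)
  obtain a' b' c' d' v' z' where w': "w = ((1, mat2 a' b' c' d'), (v', z'))" and "a' + d' = 2"
    using w by (rule W0_cases)
  moreover have "a = a' * l" "d = d' * l" using k by (simp_all add: w' l P_mult)
  ultimately have "2 * l = 2" using assms(2) by (metis distrib_right)
  then have "l = 1" by (metis mult_cancel_left mult_1_right two_nonzero)
  then have "e = \<one>\<^bsub>P\<^esub>" using l by (simp add: P_one)
  then show ?thesis using k w W0_carrier by auto
qed

lemma W0_center:
  assumes "w \<in> W0" "w \<in> center P"
  shows "w = \<one>\<^bsub>P\<^esub>"
proof -
  obtain l where l: "w = ((inverse (l ^ m), mat2 l 0 0 l), (0, 0))"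
    using assms(2) by (auto simp: center_P)
  then have "l + l = 2" using W0_unipotent assms(1) by blast
  then have "2 * l = 2 * 1" by simp
  then have "l = 1" using two_nonzero by (metis mult_left_cancel)
  then show ?thesis by (simp add: l P_one)
qed

text \<open>W0 meets Z(P) trivially, as a scalar matrix of trace 2 is the identity. Together with
  \<open>\<Phi>_W0_surj\<close> this identifies W0 itself with W.\<close>

lemma \<Phi>_inj_W0:
  assumes "w \<in> W0" "w' \<in> W0" "\<Phi> w = \<Phi> w'"
  shows "w = w'"
proof -
  have w: "w \<in> carrier P" "w' \<in> carrier P" using assms W0_carrier by auto
  have i: "inv\<^bsub>P\<^esub> w' \<in> W0" using assms W0 by (simp add: subgroup.m_inv_closed)
  have "\<Phi> (inv\<^bsub>P\<^esub> w' \<otimes>\<^bsub>P\<^esub> w) = \<Phi> (inv\<^bsub>P\<^esub> w' \<otimes>\<^bsub>P\<^esub> w')"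
    using assms i W0_N by (simp add: \<Phi>_mult subsetD)
  also have "\<dots> = C_mat 0 1 0 0"
    using w \<Phi>_one[of "\<one>\<^bsub>P\<^esub>"] by (simp add: center_def)
  finally have "inv\<^bsub>P\<^esub> w' \<otimes>\<^bsub>P\<^esub> w \<in> center P"
    using \<Phi>_ker[of "inv\<^bsub>P\<^esub> w' \<otimes>\<^bsub>P\<^esub> w"] i assms W0_N W0 by (meson subgroup.m_closed subsetD)
  then have "inv\<^bsub>P\<^esub> w' \<otimes>\<^bsub>P\<^esub> w = \<one>\<^bsub>P\<^esub>"
    using i assms W0 W0_center by (meson subgroup.m_closed)
  then show ?thesis using w by (metis P.inv_equality P.inv_inv P.inv_closed)
qed

lemma \<Phi>_W0:
  assumes "w \<in> W0"
  obtains \<alpha> \<delta> where "\<Phi> w = C_mat \<alpha> 1 \<delta> 0"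
proof -
  have "w \<in> N" "w \<in> K" using assms W0_N W0_K by auto
  then have "\<Phi> w \<in> W_subgroup" using \<Phi>_W by simp
  then show thesis using that by (auto simp: W_subgroup_def)
qed

lemma \<Phi>_W0_surj:
  obtains w where "w \<in> W0" "\<Phi> w = C_mat \<alpha> 1 \<delta> 0"
proof -
  have "C_mat \<alpha> 1 \<delta> 0 \<in> \<Phi> ` N" using \<Phi>_surj by simp
  then obtain x where x: "x \<in> N" "\<Phi> x = C_mat \<alpha> 1 \<delta> 0" by auto
  then have "x \<in> K" using \<Phi>_W by (metis C_mat_in_W_subgroup)
  then obtain w c where w: "w \<in> W0" "c \<in> center P" "x = w \<otimes>\<^bsub>P\<^esub> c" by (auto simp: set_mult_def)
  then have "w \<in> N" "c \<in> N" using W0_N center_K K_N by auto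
  then have "\<Phi> x = \<Phi> w ** C_mat 0 1 0 0"
    using \<Phi>_mult[of w c] \<Phi>_one[OF w(2)] w(3) by simp
  also have "\<dots> = \<Phi> w" by (simp flip: C_mat_1)
  finally show thesis using that w x by simp
qed

lemma W0_commute:
  assumes "w \<in> W0" "w' \<in> W0"
  shows "w \<otimes>\<^bsub>P\<^esub> w' = w' \<otimes>\<^bsub>P\<^esub> w"
proof (rule \<Phi>_inj_W0)
  show "w \<otimes>\<^bsub>P\<^esub> w' \<in> W0" "w' \<otimes>\<^bsub>P\<^esub> w \<in> W0" using assms W0 by (auto intro: subgroup.m_closed)
  obtain a d a' d' where "\<Phi> w = C_mat a 1 d 0" "\<Phi> w' = C_mat a' 1 d' 0"
    using assms \<Phi>_W0 by metis
  then show "\<Phi> (w \<otimes>\<^bsub>P\<^esub> w') = \<Phi> (w' \<otimes>\<^bsub>P\<^esub> w)"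
    using assms W0_N by (simp add: \<Phi>_mult subsetD add.commute)
qed

text \<open>\<open>W\<close> is its own centralizer in \<open>C\<close>.\<close>

lemma centralizer_W0:
  assumes g: "((t, mat2 a b c d), (v, z)) \<in> carrier P" and tr: "a + d = 2"
    and comm: "\<And>w. w \<in> W0 \<Longrightarrow>
      w \<otimes>\<^bsub>P\<^esub> ((t, mat2 a b c d), (v, z)) = ((t, mat2 a b c d), (v, z)) \<otimes>\<^bsub>P\<^esub> w"
  shows "((t, mat2 a b c d), (v, z)) \<in> W0" (is "?g \<in> W0")
proof -
  have N: "?g \<in> N" by (rule N_I[OF g]) (use comm in \<open>metis+\<close>)
  then have "\<Phi> ?g \<in> carrier C_group" using \<Phi>_surj by blast
  then obtain \<alpha> \<theta> \<delta> \<epsilon> where \<Phi>g: "\<Phi> ?g = C_mat \<alpha> \<theta> \<delta> \<epsilon>" by (rule C_group_cases)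
  \<comment> \<open>Commuting with this one element already forces \<theta> = 1 and \<epsilon> =
    0.\<close>
  obtain w where w: "w \<in> W0" "\<Phi> w = C_mat 1 1 0 0" by (rule \<Phi>_W0_surj)
  have "\<Phi> w ** \<Phi> ?g = \<Phi> ?g ** \<Phi> w"
    using comm[OF w(1)] \<Phi>_mult[OF N subsetD[OF W0_N w(1)]] \<Phi>_mult[OF subsetD[OF W0_N w(1)] N] by simp
  then have "\<theta> = 1" "\<epsilon> = 0" by (auto simp: \<Phi>g w)
  then have "?g \<in> K" using \<Phi>_W[OF N] \<Phi>g by simp
  then show ?thesis using K_unipotent tr by blast
qed

text \<open>The centre of Q, parametrized additively.\<close>

definition zq :: "'f \<Rightarrow> ('f \<times> ('f^2^2)) \<times> ('f poly poly \<times> 'f)" where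
  "zq s = ((1, mat2 1 0 0 1), (0, s))"

lemma zq_carrier [simp]: "zq s \<in> carrier P" by (simp add: zq_def)

lemma zq_mult: "zq s \<otimes>\<^bsub>P\<^esub> zq r = zq (s + r)" by (simp add: zq_def P_mult)

text \<open>Elements of W0 have t = 1 and determinant 1 and so act trivially on Z(Q); hence
  \<open>centralizer_W0\<close> applies.\<close>

lemma zq_W0: "zq s \<in> W0"
  unfolding zq_def
proof (rule centralizer_W0)
  fix w assume w: "w \<in> W0"
  then obtain a b c d v z where "w = ((1, mat2 a b c d), (v, z))" "a * d - b * c = 1" "v \<in> hom_polys m"
    by (rule W0_cases)
  then show "w \<otimes>\<^bsub>P\<^esub> ((1, mat2 1 0 0 1), (0, s)) = ((1, mat2 1 0 0 1), (0, s)) \<otimes>\<^bsub>P\<^esub> w"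
    by (simp add: P_mult)
qed simp_all

text \<open>
  The involution \<open>- 1\<close> of the first factor of \<open>L\<close> inverts \<open>V\<close> and centralizes the center of
  \<open>Q\<close>, whereas every involution of \<open>C\<close> inverts \<open>W\<close>.
\<close>

lemma W0_not_in_Q: "\<exists>t A v z. ((t, A), (v, z)) \<in> W0 \<and> A \<noteq> mat2 1 0 0 1"
proof (rule ccontr)
  assume "\<not> ?thesis"
  then have Q: "A = mat2 1 0 0 1" if "((t, A), (v, z)) \<in> W0" for t A v z using that by blast
  define \<tau> :: "('f \<times> ('f^2^2)) \<times> ('f poly poly \<times> 'f)" where "\<tau> = ((- 1, mat2 1 0 0 1), (0, 0))"
  have \<tau>c: "\<tau> \<in> carrier P" by (simp add: \<tau>_def)
  have *: "\<exists>w'\<in>W0. w \<otimes>\<^bsub>P\<^esub> \<tau> = \<tau> \<otimes>\<^bsub>P\<^esub> w' \<and> \<tau> \<otimes>\<^bsub>P\<^esub> w = w' \<otimes>\<^bsub>P\<^esub> \<tau>" if w: "w \<in> W0" for w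
  proof -
    obtain a b c d v z where "w = ((1, mat2 a b c d), (v, z))" and v: "v \<in> hom_polys m"
      using w by (rule W0_cases)
    then have we: "w = ((1, mat2 1 0 0 1), (v, z))" using Q w by (auto simp del: mat2_eq_iff)
    let ?w' = "((1, mat2 1 0 0 1), (- v, z))"
    \<comment> \<open>Up to an element of Z(Q), \<open>?w'\<close> is the inverse of w, and Z(Q)
      already lies in W0.\<close>
    have "?w' \<otimes>\<^bsub>P\<^esub> w = zq (2 * z)" using v by (simp add: we P_mult zq_def)
    moreover have "?w' \<in> carrier P" "w \<in> carrier P" using v by (simp_all add: we)
    ultimately have "?w' = zq (2 * z) \<otimes>\<^bsub>P\<^esub> inv\<^bsub>P\<^esub> w" by (metis P.inv_solve_right zq_carrier)
    then have "?w' \<in> W0" using w zq_W0 W0 by (simp add: subgroup.m_closed subgroup.m_inv_closed)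
    moreover have "w \<otimes>\<^bsub>P\<^esub> \<tau> = \<tau> \<otimes>\<^bsub>P\<^esub> ?w'" "\<tau> \<otimes>\<^bsub>P\<^esub> w = ?w' \<otimes>\<^bsub>P\<^esub> \<tau>"
      using v by (simp_all add: we \<tau>_def P_mult)
    ultimately show ?thesis by blast
  qed
  have N: "\<tau> \<in> N" by (rule N_I[OF \<tau>c]) (use * in blast)+
  then have "\<Phi> \<tau> \<in> carrier C_group" using \<Phi>_surj by blast
  then obtain \<alpha> \<theta> \<delta> \<epsilon> where \<Phi>\<tau>: "\<Phi> \<tau> = C_mat \<alpha> \<theta> \<delta> \<epsilon>" and \<theta>: "\<theta> \<noteq> 0" by (rule C_group_cases)
  have "\<tau> \<otimes>\<^bsub>P\<^esub> \<tau> \<in> center P" by (simp add: \<tau>_def P_mult center_P)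
  then have "\<Phi> \<tau> ** \<Phi> \<tau> = C_mat 0 1 0 0" using \<Phi>_mult[OF N N] \<Phi>_one by simp
  then have eqs: "\<alpha> + \<theta> * \<alpha> = 0" "\<theta> * \<theta> = 1" "\<delta> + \<epsilon> * \<alpha> + inverse \<theta> * \<delta> = 0" "\<epsilon> * \<theta> + inverse \<theta> * \<epsilon> = 0"
    by (auto simp: \<Phi>\<tau>)
  have "\<tau> \<notin> center P"
    using one_neq_uminus_one by (auto simp: \<tau>_def center_P)
  then have "\<Phi> \<tau> \<noteq> C_mat 0 1 0 0" using \<Phi>_ker[OF N] by simp
  moreover have "\<theta> = 1 \<or> \<theta> = - 1" using eqs(2) by (simp add: square_eq_1_iff)
  \<comment> \<open>For \<theta> = 1 the equations above read 2 \<alpha> = 0, 2 \<epsilon> = 0 and 2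
    \<delta> + \<epsilon> \<alpha> = 0, which leaves only the identity.\<close>
  ultimately have \<theta>1: "\<theta> = - 1"
  proof (rule_tac ccontr)
    assume "\<Phi> \<tau> \<noteq> C_mat 0 1 0 0" "\<theta> = 1 \<or> \<theta> = - 1" "\<theta> \<noteq> - 1"
    moreover from this have "2 * \<alpha> = 0" "2 * \<epsilon> = 0" "2 * \<delta> + \<epsilon> * \<alpha> = 0" using eqs by (simp_all add: algebra_simps)
    ultimately show False by (simp add: \<Phi>\<tau>)
  qed
  then have "2 * \<epsilon> = 0" using eqs(4) by (simp add: algebra_simps)
  then have \<epsilon>0: "\<epsilon> = 0" by simp
  obtain a d where ad: "\<Phi> (zq 1) = C_mat a 1 d 0" using \<Phi>_W0[OF zq_W0] by blast
  \<comment> \<open>\<tau> has t^2 = 1 and fixes \<open>zq 1\<close>, while a matrix with \<theta> =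
    -1 and \<epsilon> = 0 inverts W; so \<open>zq 1\<close> would map to the identity.\<close>
  have "zq 1 \<otimes>\<^bsub>P\<^esub> \<tau> = \<tau> \<otimes>\<^bsub>P\<^esub> zq 1" by (simp add: zq_def \<tau>_def P_mult)
  then have "\<Phi> (zq 1) ** \<Phi> \<tau> = \<Phi> \<tau> ** \<Phi> (zq 1)"
    using \<Phi>_mult[OF N subsetD[OF W0_N zq_W0[of 1]]] \<Phi>_mult[OF subsetD[OF W0_N zq_W0[of 1]] N] by simp
  then have "2 * a = 0" "2 * d = 0"
    by (auto simp: ad \<Phi>\<tau> \<theta>1 \<epsilon>0 algebra_simps)
  then have "\<Phi> (zq 1) = C_mat 0 1 0 0" by (simp add: ad)
  then have "zq 1 \<in> center P" using \<Phi>_ker zq_W0 W0_N by blast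
  then show False by (auto simp: center_P zq_def)
qed

end

section \<open>The torus of the normalizer\<close>

text \<open>On the prime field H is the identity, so its nonzero elements satisfy y^(k + 1) = 1,
  whence p \<le> k + 2; the bound on k, the parity and the excluded case leave k = p - 2. That F is
  the prime field follows by comparing 1 + y^(-k) with (1 + y)^(-k): H maps both to 1 + y, which
  yields an equation of degree at most 2 k for almost all y.\<close>

lemma additive_inverse_power:
  fixes H :: "'f::{field,finite} \<Rightarrow> 'f"
  assumes add: "\<And>x y. H (x + y) = H x + H y" and inj: "inj H"
    and inv: "\<And>y. y \<noteq> 0 \<Longrightarrow> H (y ^ k) = inverse y"
    and k: "odd k" "k \<le> CHAR('f)" and p: "odd CHAR('f)" "\<not> (k = CHAR('f) \<and> CHAR('f) = 3)"
  shows "CARD('f) = CHAR('f) \<and> k + 2 = CHAR('f)"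
proof -
  define p where "p = CHAR('f)"
  have prime: "prime p" unfolding p_def by (rule prime_CHAR)
  have H1: "H 1 = 1" using inv[of 1] by simp
  have H0: "H 0 = 0" using add[of 0 0] by (metis add_0_right add_left_cancel)
  have Hnat: "H (of_nat n) = of_nat n" for n by (induction n) (simp_all add: H0 H1 add)
  have root: "y ^ (k + 1) = 1" if y: "y = of_nat n" "y \<noteq> 0" for y :: 'f and n
  proof -
    have "y ^ k = H (y ^ k)" using Hnat[of "n ^ k"] by (simp add: y(1))
    also have "\<dots> = inverse y" by (rule inv[OF y(2)])
    finally show ?thesis using y(2) by simp
  qed
  have "p \<le> k + 2"
  proof (rule ccontr)
    assume less: "\<not> p \<le> k + 2"
    have "inj_on (of_nat :: nat \<Rightarrow> 'f) {1..<p}"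
      by (auto simp: inj_on_def of_nat_eq_iff_cong_CHAR cong_def p_def)
    then have card: "card (of_nat ` {1..<p} :: 'f set) = p - 1" by (simp add: card_image)
    have "monom 1 (k + 1) - 1 = (0 :: 'f poly)"
    proof (rule poly_eq_0_if_many_roots)
      fix x :: 'f assume "x \<in> of_nat ` {1..<p}"
      then obtain n where n: "x = of_nat n" "0 < n" "n < p" by auto
      then have "x \<noteq> 0" by (auto simp: of_nat_eq_0_iff_char_dvd p_def dest: dvd_imp_le)
      then show "poly (monom 1 (k + 1) - 1) x = 0"
        using root[OF n(1)] by (simp add: poly_monom)
    next
      have "degree (monom 1 (k + 1) - 1 :: 'f poly) \<le> k + 1"
        by (intro degree_diff_le) (auto simp: degree_monom_le)
      then show "degree (monom 1 (k + 1) - 1 :: 'f poly) < card (of_nat ` {1..<p} :: 'f set)"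
        using less card by simp
    qed
    then have "poly (monom 1 (k + 1) - 1) 0 = (0 :: 'f)" by (simp only: poly_0)
    then show False by (simp add: poly_monom)
  qed
  moreover have "k \<noteq> p"
  proof
    assume kp: "k = p"
    have two: "(2 :: 'f) \<noteq> 0"
    proof
      assume "(2 :: 'f) = 0"
      then have "p dvd 2" using of_nat_eq_0_iff_char_dvd[where 'a = 'f, of 2] by (simp add: p_def)
      then have "p = 2" using prime by (metis primes_dvd_imp_eq two_is_prime_nat)
      then show False using p by (simp add: p_def)
    qed
    \<comment> \<open>For k = p, the k-th power is trivial on the prime field, so y^(k + 1) = 1
      becomes y^2 = 1; y = 2 then gives 3 = 0.\<close>
    have "(1 + 1 :: 'f) ^ p = 1 ^ p + 1 ^ p"
      using prime by (intro freshmans_dream) (auto simp: p_def)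
    then have "(2 :: 'f) ^ p = 2" by simp
    then have "(2 :: 'f) * 2 = 1" using root[of 2 2] two by (simp add: kp)
    then have "(2 :: 'f) * 2 - 1 = 0" by simp
    then have "(3 :: 'f) = 0" by simp
    then have "p dvd 3" using of_nat_eq_0_iff_char_dvd[where 'a = 'f, of 3] by (simp add: p_def)
    then have "p \<le> 3" by (rule dvd_imp_le) simp
    then have "p = 2 \<or> p = 3" using prime_gt_1_nat[OF prime] by auto
    then show False using p kp by (auto simp: p_def)
  qed
  moreover have "k \<noteq> p + 1" "k + 1 \<noteq> p" using k p unfolding p_def by (simp, metis even_plus_one_iff)
  ultimately have kp: "k + 2 = p" using k by (simp add: p_def)
  \<comment> \<open>This clears denominators in 1 + y^(-k) = (1 + y)^(-k). The value at 0 shows that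
    q is nonzero; only 0 and -1 are excluded as arguments.\<close>
  define q where "q = [:1, 1:] ^ k * (1 + [:0, 1:] ^ k) - [:0, 1 :: 'f:] ^ k"
  have k0: "k > 0" using k by (cases k) auto
  have "poly q 0 = 1" using k0 by (simp add: q_def)
  then have q0: "q \<noteq> 0" by auto
  have deg: "degree q \<le> 2 * k"
  proof -
    have X: "degree ([:c, 1 :: 'f:] ^ k) \<le> k" for c
      using degree_power_le[of "[:c, 1:]" k] by simp
    have "degree (1 + [:0, 1 :: 'f:] ^ k) \<le> k"
      using X[of 0] by (intro degree_add_le) auto
    then have "degree ([:1, 1:] ^ k * (1 + [:0, 1 :: 'f:] ^ k)) \<le> k + k"
      using X[of 1] by (intro order_trans[OF degree_mult_le] add_mono)
    then show ?thesis
      unfolding q_def using X[of 0] by (intro degree_diff_le) auto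
  qed
  have root_q: "poly q y = 0" if y: "y \<in> UNIV - {0, - 1}" for y
  proof -
    have nz: "y \<noteq> 0" "1 + y \<noteq> 0" using y by (auto simp: add_eq_0_iff)
    have "H (inverse y ^ k + 1) = H (inverse (1 + y) ^ k)"
      using inv[of "inverse y"] inv[of "inverse (1 + y)"] nz by (simp add: add H1 add.commute)
    then have "inverse y ^ k + 1 = inverse (1 + y) ^ k" by (rule injD[OF inj])
    then have "inverse (y ^ k) + 1 = inverse ((1 + y) ^ k)" by (simp add: power_inverse)
    moreover have "v * (1 + u) = u" if "inverse u + 1 = inverse v" "u \<noteq> 0" "v \<noteq> 0" for u v :: 'f
      using that by (simp add: field_simps)
    ultimately have "(1 + y) ^ k * (1 + y ^ k) = y ^ k" using nz by simp
    then show ?thesis by (simp add: q_def)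
  qed
  have "\<not> degree q < card (UNIV - {0, - 1 :: 'f})"
    using poly_eq_0_if_many_roots[of "UNIV - {0, - 1}" q] root_q q0 by blast
  moreover have "CARD('f) - 2 \<le> card (UNIV - {0, - 1 :: 'f})"
    using diff_card_le_card_Diff[of "{0, - 1 :: 'f}" UNIV] card_insert_le_m1[of 2 "{- 1 :: 'f}" 0] by simp
  \<comment> \<open>The count gives |F| - 2 \<le> 2 k = 2 p - 4, and |F| is a multiple of p.\<close>
  ultimately have "CARD('f) < 2 * p"
    using deg kp k0 by simp
  moreover have "p dvd CARD('f)" unfolding p_def by (rule CHAR_dvd_CARD)
  ultimately have "CARD('f) = p"
    using finite_UNIV_card_ge_0[where 'a = 'f] by (elim dvdE) (auto simp: mult.commute[of 2])
  with kp show ?thesis by (simp add: p_def)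
qed

text \<open>In degree one every vector is a power of a linear form, so \<open>form_lin\<close>
  evaluates the form directly.\<close>

lemma (in parabolic) linear_form_eq:
  fixes v :: "'f poly poly"
  assumes "m = 1" "v \<in> hom_polys m"
  shows "v = lin (coeff_XY v 1 0) (coeff_XY v 0 1) ^ m"
proof (rule hom_polys_eqI[OF assms(2)])
  show "coeff_XY v i (m - i) = coeff_XY (lin (coeff_XY v 1 0) (coeff_XY v 0 1) ^ m) i (m - i)"
    if "i \<le> m" for i
  proof -
    have "i = 0 \<or> i = m" using that assms(1) by auto
    then have "coeff_XY (lin (coeff_XY v 1 0) (coeff_XY v 0 1) ^ m) i (m - i)
        = (if i = 0 then coeff_XY v 0 1 ^ m else coeff_XY v 1 0 ^ m)" by auto
    then show ?thesis using assms(1) that by (cases i) auto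
  qed
qed simp

text \<open>The extra assumption is a choice of basis for one element of W0 outside Q;
  \<open>necessary\<close> achieves it by conjugation.\<close>

locale normalized_datum = normalizer_datum m F W0 \<Phi>
  for m and F :: "'f::{field,finite} itself" and W0 \<Phi> +
  assumes w1: "\<exists>g v z. g \<noteq> 0 \<and> ((1, mat2 1 0 g 1), (v, z)) \<in> W0"
begin

text \<open>A matrix commuting with a nontrivial lower shear is lower triangular with equal diagonal
  entries, and trace 2 makes these 1.\<close>

lemma W0_lower:
  assumes "w \<in> W0"
  obtains g v z where "w = ((1, mat2 1 0 g 1), (v, z))" "v \<in> hom_polys m"
proof -
  obtain g1 v1 z1 where g1: "g1 \<noteq> 0" and w1: "((1, mat2 1 0 g1 1), (v1, z1)) \<in> W0"
    using w1 by blast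
  obtain a b c d v z where w: "w = ((1, mat2 a b c d), (v, z))" "a + d = 2" "v \<in> hom_polys m"
    using assms by (rule W0_cases)
  have "w \<otimes>\<^bsub>P\<^esub> ((1, mat2 1 0 g1 1), (v1, z1)) = ((1, mat2 1 0 g1 1), (v1, z1)) \<otimes>\<^bsub>P\<^esub> w"
    using assms w1 by (rule W0_commute)
  then have "b * g1 = 0" "c + d * g1 = g1 * a + c" by (auto simp: w P_mult)
  then have "b = 0" "d = a" using g1 by (auto simp: mult.commute)
  then have "2 * a = 2 * 1" using w by simp
  then have "a = 1" using two_nonzero by (metis mult_left_cancel)
  with \<open>b = 0\<close> \<open>d = a\<close> w that show thesis by blast
qed

definition slope :: "('f \<times> ('f^2^2)) \<times> ('f poly poly \<times> 'f) \<Rightarrow> 'f" where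
  "slope w = snd (fst w) $ 2 $ 1"

text \<open>The coordinate of the V-part modulo multiples of X, on which lower shears act
  trivially.\<close>

definition lead :: "('f \<times> ('f^2^2)) \<times> ('f poly poly \<times> 'f) \<Rightarrow> 'f" where
  "lead w = coeff_XY (fst (snd w)) 0 m"

lemma slope_lead [simp]:
  "slope ((t, mat2 a b c d), (v, z)) = c" "lead ((t, A), (v, z)) = coeff_XY v 0 m"
  by (simp_all add: slope_def lead_def)

lemma slope_mult:
  assumes "w \<in> W0" "w' \<in> W0"
  shows "slope (w \<otimes>\<^bsub>P\<^esub> w') = slope w + slope w'"
  using assms by (elim W0_lower) (simp add: P_mult)

text \<open>Z(Q) is normalized by N. If some image had \<alpha> \<noteq> 0, conjugation with lifts
  of \<open>C_mat 0 1 0 \<epsilon>\<close> would produce every \<delta>; with the identity these are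
  |F| + 1 elements in the image of a set of size |F|.\<close>

lemma \<Phi>_zq: "\<exists>\<delta>. \<Phi> (zq s) = C_mat 0 1 \<delta> 0"
proof -
  obtain \<alpha> \<delta> where \<Phi>s: "\<Phi> (zq s) = C_mat \<alpha> 1 \<delta> 0" using \<Phi>_W0[OF zq_W0] by blast
  have "\<alpha> = 0"
  proof (rule ccontr)
    assume \<alpha>: "\<alpha> \<noteq> 0"
    have conj: "C_mat \<alpha> 1 (\<delta> - \<epsilon> * \<alpha>) 0 \<in> range (\<lambda>s. \<Phi> (zq s))" for \<epsilon>
    proof -
      have "C_mat 0 1 0 \<epsilon> \<in> \<Phi> ` N" using \<Phi>_surj by simp
      then obtain n where n: "n \<in> N" "\<Phi> n = C_mat 0 1 0 \<epsilon>" by auto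
      then have "n \<in> carrier P" using N_carrier by blast
      then obtain t a b c d v z where ne: "n = ((t, mat2 a b c d), (v, z))" "v \<in> hom_polys m"
        by (rule P_cases)
      define s' where "s' = t\<^sup>2 * (a * d - b * c) ^ m * s"
      have "zq s \<otimes>\<^bsub>P\<^esub> n = n \<otimes>\<^bsub>P\<^esub> zq s'"
        using ne by (simp add: zq_def P_mult s'_def)
      then have "\<Phi> (zq s) ** \<Phi> n = \<Phi> n ** \<Phi> (zq s')"
        using \<Phi>_mult[OF subsetD[OF W0_N zq_W0[of s]] n(1)] \<Phi>_mult[OF n(1) subsetD[OF W0_N zq_W0[of s']]]
        by simp
      moreover obtain \<alpha>' \<delta>' where "\<Phi> (zq s') = C_mat \<alpha>' 1 \<delta>' 0" using \<Phi>_W0[OF zq_W0] by blast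
      ultimately have "\<Phi> (zq s') = C_mat \<alpha> 1 (\<delta> - \<epsilon> * \<alpha>) 0"
        by (auto simp: n \<Phi>s algebra_simps)
      then show ?thesis by (metis rangeI)
    qed
    have "C_mat \<alpha> 1 \<delta>' 0 \<in> range (\<lambda>s. \<Phi> (zq s))" for \<delta>'
      using conj[of "(\<delta> - \<delta>') / \<alpha>"] \<alpha> by simp
    moreover have "C_mat 0 1 0 0 \<in> range (\<lambda>s. \<Phi> (zq s))"
      using \<Phi>_one[of "zq 0"] by (intro range_eqI[of _ _ 0]) (auto simp: zq_def center_P)
    ultimately have "insert (C_mat 0 1 0 0) (range (\<lambda>\<delta>'. C_mat \<alpha> 1 \<delta>' 0)) \<subseteq> range (\<lambda>s. \<Phi> (zq s))"
      by blast
    then have "card (insert (C_mat 0 1 0 0) (range (\<lambda>\<delta>'. C_mat \<alpha> 1 \<delta>' 0))) \<le> card (range (\<lambda>s. \<Phi> (zq s)))"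
      by (intro card_mono) auto
    also have "\<dots> \<le> CARD('f)" by (rule card_image_le) simp
    also have "card (insert (C_mat 0 1 0 0) (range (\<lambda>\<delta>'. C_mat \<alpha> 1 \<delta>' 0))) = Suc (card (range (\<lambda>\<delta>'. C_mat \<alpha> 1 \<delta>' 0)))"
      using \<alpha> by (subst card_insert_disjoint) auto
    also have "card (range (\<lambda>\<delta>'. C_mat \<alpha> 1 \<delta>' 0)) = CARD('f)"
      by (rule card_image) (auto simp: inj_on_def)
    finally show False by simp
  qed
  with \<Phi>s show ?thesis by blast
qed

definition \<zeta> :: "'f \<Rightarrow> 'f" where "\<zeta> s = \<Phi> (zq s) $ 3 $ 1"

lemma \<Phi>_zq_eq: "\<Phi> (zq s) = C_mat 0 1 (\<zeta> s) 0"
  using \<Phi>_zq[of s] by (auto simp: \<zeta>_def)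

lemma \<zeta>_add: "\<zeta> (s + r) = \<zeta> s + \<zeta> r"
proof -
  have "\<Phi> (zq (s + r)) = \<Phi> (zq s) ** \<Phi> (zq r)"
    using \<Phi>_mult[OF subsetD[OF W0_N zq_W0[of s]] subsetD[OF W0_N zq_W0[of r]]] by (simp add: zq_mult)
  then show ?thesis by (simp add: \<Phi>_zq_eq)
qed

lemma \<zeta>_inj: "inj \<zeta>"
proof (rule injI)
  fix s r assume "\<zeta> s = \<zeta> r"
  then have "zq s = zq r" by (intro \<Phi>_inj_W0 zq_W0) (simp add: \<Phi>_zq_eq)
  then show "s = r" by (simp add: zq_def)
qed

lemma \<zeta>_surj: "\<exists>s. \<zeta> s = \<delta>"
proof -
  have "surj \<zeta>" using \<zeta>_inj by (intro finite_UNIV_inj_surj) auto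
  then show ?thesis by (metis surjD)
qed

text \<open>Z(Q) has slope 0 and its image is all of the part \<alpha> = 0 of W, so the slope on W0
  is a function of \<alpha> alone.\<close>

lemma slope_eq_if_\<Phi>:
  assumes "w \<in> W0" "w' \<in> W0" "\<Phi> w = C_mat \<alpha> 1 \<delta> 0" "\<Phi> w' = C_mat \<alpha> 1 \<delta>' 0"
  shows "\<exists>s. w = w' \<otimes>\<^bsub>P\<^esub> zq s" "slope w = slope w'"
proof -
  obtain s where s: "\<zeta> s = \<delta> - \<delta>'" using \<zeta>_surj by blast
  have "\<Phi> (w' \<otimes>\<^bsub>P\<^esub> zq s) = \<Phi> w"
    using \<Phi>_mult[OF subsetD[OF W0_N assms(2)] subsetD[OF W0_N zq_W0[of s]]] assms(3,4) s
    by (simp add: \<Phi>_zq_eq)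
  then have *: "w = w' \<otimes>\<^bsub>P\<^esub> zq s"
    using assms zq_W0 W0 by (intro \<Phi>_inj_W0) (auto intro: subgroup.m_closed)
  then show "\<exists>s. w = w' \<otimes>\<^bsub>P\<^esub> zq s" by blast
  show "slope w = slope w'"
    unfolding * using slope_mult[OF assms(2) zq_W0[of s]] by (simp add: zq_def)
qed

text \<open>n lifts a torus element of C. Its matrix normalizes the lower shears up to scalars, so
  it is triangular, and the central correction l turns out to be 1; thus n normalizes W0 itself and
  not only W0 Z(P).\<close>

lemma torus:
  assumes \<theta>: "\<theta> \<noteq> 0"
  obtains n t a c d v z where "n \<in> N" "\<Phi> n = C_mat 0 \<theta> 0 0"
    "n = ((t, mat2 a 0 c d), (v, z))" "t \<noteq> 0" "a \<noteq> 0" "d \<noteq> 0" "v \<in> hom_polys m"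
    "\<And>w. w \<in> W0 \<Longrightarrow> \<exists>w'\<in>W0. w \<otimes>\<^bsub>P\<^esub> n = n \<otimes>\<^bsub>P\<^esub> w' \<and> slope w' = a / d * slope w
       \<and> (\<forall>\<alpha> \<delta>. \<Phi> w = C_mat \<alpha> 1 \<delta> 0 \<longrightarrow> \<Phi> w' = C_mat (\<alpha> / \<theta>) 1 (\<theta> * \<delta>) 0)"
proof -
  obtain g1 v1 z1 where g1: "g1 \<noteq> 0" and w1: "((1, mat2 1 0 g1 1), (v1, z1)) \<in> W0"
    using w1 by blast
  have "C_mat 0 \<theta> 0 0 \<in> \<Phi> ` N" using \<Phi>_surj \<theta> by simp
  then obtain n where n: "n \<in> N" "\<Phi> n = C_mat 0 \<theta> 0 0" by auto
  then have "n \<in> carrier P" using N_carrier by blast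
  then obtain t a b c d v z where ne: "n = ((t, mat2 a b c d), (v, z))"
    and nz: "t \<noteq> 0" "a * d - b * c \<noteq> 0" "v \<in> hom_polys m"
    by (rule P_cases)
  have conj: "\<exists>w'\<in>W0. \<exists>l. w \<otimes>\<^bsub>P\<^esub> n = n \<otimes>\<^bsub>P\<^esub> (w' \<otimes>\<^bsub>P\<^esub> ((inverse (l ^ m), mat2 l 0 0 l), (0, 0)))
      \<and> b = b * l \<and> g * a + c = c * l + d * (slope w' * l) \<and> g * b + d = d * l"
    if w: "w \<in> W0" "slope w = g" for w g
  proof -
    have "w \<in> K" using w W0_K by blast
    with n(1) obtain k where k: "k \<in> K" "w \<otimes>\<^bsub>P\<^esub> n = n \<otimes>\<^bsub>P\<^esub> k"
      using P.normalizer_D[OF K_carrier] by blast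
    then obtain w' e where w': "w' \<in> W0" and e: "e \<in> center P" "k = w' \<otimes>\<^bsub>P\<^esub> e"
      by (auto simp: set_mult_def)
    obtain l where l: "e = ((inverse (l ^ m), mat2 l 0 0 l), (0, 0))"
      using e by (auto simp: center_P)
    obtain g' v' z' where w'e: "w' = ((1, mat2 1 0 g' 1), (v', z'))" "v' \<in> hom_polys m"
      using w' by (rule W0_lower)
    obtain v0 z0 where we: "w = ((1, mat2 1 0 g 1), (v0, z0))"
      using w by (elim W0_lower) auto
    have "b = b * l \<and> g * a + c = c * l + d * (slope w' * l) \<and> g * b + d = d * l"
      using k(2) by (simp add: e l w'e we ne P_mult)
    then show ?thesis
      by (intro bexI[OF _ w'] exI[of _ l] conjI[OF k(2)[unfolded e(2) l]])
  qed
  have b: "b = 0"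
  proof (rule ccontr)
    assume b: "b \<noteq> 0"
    \<comment> \<open>The first equation gives l = 1, and then the second gives g1 b = 0.\<close>
    obtain l where "b = b * l" "g1 * b + d = d * l" using conj[OF w1] by auto
    then show False using b g1 by auto
  qed
  then have ad: "a \<noteq> 0" "d \<noteq> 0" using nz by auto
  have act: "\<exists>w'\<in>W0. w \<otimes>\<^bsub>P\<^esub> n = n \<otimes>\<^bsub>P\<^esub> w' \<and> slope w' = a / d * slope w
       \<and> (\<forall>\<alpha> \<delta>. \<Phi> w = C_mat \<alpha> 1 \<delta> 0 \<longrightarrow> \<Phi> w' = C_mat (\<alpha> / \<theta>) 1 (\<theta> * \<delta>) 0)" if w: "w \<in> W0" for w
  proof -
    obtain w' l where w': "w' \<in> W0"
      and eq: "w \<otimes>\<^bsub>P\<^esub> n = n \<otimes>\<^bsub>P\<^esub> (w' \<otimes>\<^bsub>P\<^esub> ((inverse (l ^ m), mat2 l 0 0 l), (0, 0)))"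
      and l: "slope w * a + c = c * l + d * (slope w' * l)" "slope w * b + d = d * l"
      using conj[OF w refl] by blast
    have l1: "l = 1" using l(2) ad b by simp
    have w'c: "w' \<in> carrier P" using w' W0_carrier by blast
    have "w' \<otimes>\<^bsub>P\<^esub> ((inverse (l ^ m), mat2 l 0 0 l), (0, 0)) = w'"
      using P.r_one[OF w'c] by (simp add: l1 P_one)
    with eq have eq: "w \<otimes>\<^bsub>P\<^esub> n = n \<otimes>\<^bsub>P\<^esub> w'" by simp
    have "\<Phi> w ** \<Phi> n = \<Phi> n ** \<Phi> w'"
      using eq \<Phi>_mult[OF n(1) subsetD[OF W0_N w']] \<Phi>_mult[OF subsetD[OF W0_N w] n(1)] by simp
    moreover obtain \<alpha>' \<delta>' where "\<Phi> w' = C_mat \<alpha>' 1 \<delta>' 0" using \<Phi>_W0[OF w'] by blast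
    ultimately have "\<forall>\<alpha> \<delta>. \<Phi> w = C_mat \<alpha> 1 \<delta> 0 \<longrightarrow> \<Phi> w' = C_mat (\<alpha> / \<theta>) 1 (\<theta> * \<delta>) 0"
      using \<theta> by (auto simp: n)
    moreover have "slope w' = a / d * slope w" using l(1) l1 ad by (simp add: field_simps)
    ultimately show ?thesis using eq w' by blast
  qed
  show thesis
    by (rule that[OF n ne[unfolded b] nz(1) ad nz(3) act])
qed

text \<open>An element of slope 0 with \<alpha> \<noteq> 0 could be moved by the torus to the
  parameter \<alpha>1 of the given element of slope g1. Slope 0 is preserved, yet the slope depends
  on \<alpha> only.\<close>

lemma slope_zero:
  assumes w: "w \<in> W0" "slope w = 0"
  shows "\<exists>s. w = zq s"
proof -
  obtain \<alpha> \<delta> where \<Phi>w: "\<Phi> w = C_mat \<alpha> 1 \<delta> 0" using \<Phi>_W0[OF w(1)] by blast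
  have "\<alpha> = 0"
  proof (rule ccontr)
    assume \<alpha>: "\<alpha> \<noteq> 0"
    obtain g1 v1 z1 where g1: "g1 \<noteq> 0" and w1: "((1, mat2 1 0 g1 1), (v1, z1)) \<in> W0" (is "?w1 \<in> _")
      using w1 by blast
    obtain \<alpha>1 \<delta>1 where \<Phi>w1: "\<Phi> ?w1 = C_mat \<alpha>1 1 \<delta>1 0" using \<Phi>_W0[OF w1] by blast
    have "\<alpha>1 \<noteq> 0"
    proof
      assume "\<alpha>1 = 0"
      then have "slope ?w1 = slope (zq 0)"
        using \<Phi>w1 \<Phi>_zq_eq[of 0] by (intro slope_eq_if_\<Phi>(2)[OF w1 zq_W0]) auto
      with g1 show False by (simp add: zq_def)
    qed
    have \<theta>: "\<alpha> / \<alpha>1 \<noteq> 0" using \<alpha> \<open>\<alpha>1 \<noteq> 0\<close> by simp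
    have "\<exists>w'\<in>W0. slope w' = 0 \<and> \<Phi> w' = C_mat \<alpha>1 1 (\<alpha> / \<alpha>1 * \<delta>) 0"
    proof (rule torus[OF \<theta>])
      fix n a d
      assume "\<And>w. w \<in> W0 \<Longrightarrow> \<exists>w'\<in>W0. w \<otimes>\<^bsub>P\<^esub> n = n \<otimes>\<^bsub>P\<^esub> w' \<and> slope w' = a / d * slope w
        \<and> (\<forall>\<beta> \<gamma>. \<Phi> w = C_mat \<beta> 1 \<gamma> 0 \<longrightarrow> \<Phi> w' = C_mat (\<beta> / (\<alpha> / \<alpha>1)) 1 (\<alpha> / \<alpha>1 * \<gamma>) 0)"
      from this[OF w(1)] show ?thesis using w(2) \<Phi>w \<alpha> \<open>\<alpha>1 \<noteq> 0\<close> by auto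
    qed
    then obtain w' where "w' \<in> W0" "slope w' = 0" "\<Phi> w' = C_mat \<alpha>1 1 (\<alpha> / \<alpha>1 * \<delta>) 0" by blast
    then have "slope ?w1 = 0"
      using slope_eq_if_\<Phi>(2)[OF w1 _ \<Phi>w1] by metis
    with g1 show False by simp
  qed
  then obtain s where "\<Phi> w = \<Phi> (zq s)" using \<zeta>_surj \<Phi>w \<Phi>_zq_eq by metis
  then show ?thesis using \<Phi>_inj_W0[OF w(1) zq_W0] by blast
qed

text \<open>The two products are compared at X Y^(m - 1): there a shear by g adds m g times the
  coefficient of Y^m, and m is invertible in F.\<close>

lemma lead_slope:
  assumes "w \<in> W0" "w' \<in> W0"
  shows "lead w * slope w' = lead w' * slope w"
proof -
  obtain g v z where w: "w = ((1, mat2 1 0 g 1), (v, z))" "v \<in> hom_polys m" using assms(1) by (rule W0_lower)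
  obtain g' v' z' where w': "w' = ((1, mat2 1 0 g' 1), (v', z'))" "v' \<in> hom_polys m" using assms(2) by (rule W0_lower)
  have "mat_act m v (mat2 1 0 g' 1) + v' = mat_act m v' (mat2 1 0 g 1) + v"
    using W0_commute[OF assms] w w' by (simp add: P_mult)
  then have "coeff_XY (mat_act m v (mat2 1 0 g' 1) + v') 1 (m - 1)
      = coeff_XY (mat_act m v' (mat2 1 0 g 1) + v) 1 (m - 1)" by simp
  then have "of_nat m * (coeff_XY v 0 m * g') = of_nat m * (coeff_XY v' 0 m * g)"
    unfolding coeff_XY_simps act_second[OF w(2)] act_second[OF w'(2)] by (simp add: algebra_simps)
  moreover have "of_nat m \<noteq> (0 :: 'f)"
    using of_nat_binomial_nonzero[OF m_less_CHAR, of 1] m_pos by simp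
  ultimately show ?thesis by (simp add: w w')
qed

lemma lead_nonzero:
  obtains w where "w \<in> W0" "slope w \<noteq> 0" "lead w \<noteq> 0"
proof -
  obtain g1 v1 z1 where g1: "g1 \<noteq> 0" and w1: "((1, mat2 1 0 g1 1), (v1, z1)) \<in> W0" (is "?w1 \<in> _")
    using w1 by blast
  have "lead ?w1 \<noteq> 0"
  proof
    assume "lead ?w1 = 0"
    then have lead0: "lead w = 0" if "w \<in> W0" for w
      using lead_slope[OF w1 that] g1 by simp
    have X: "lin 1 0 ^ m \<in> hom_polys m" by simp
    have "((1, mat2 1 0 0 1), (lin 1 0 ^ m, 0)) \<in> W0" (is "?x \<in> _")
    proof (rule centralizer_W0)
      fix w assume w: "w \<in> W0"
      then obtain g v z where we: "w = ((1, mat2 1 0 g 1), (v, z))" "v \<in> hom_polys m" by (rule W0_lower)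
      have "form m v (lin 1 0 ^ m) = 0" using lead0[OF w] by (simp add: we X_power)
      moreover from this have "form m (lin 1 0 ^ m) v = 0" using form_skew[OF odd_m, of v "lin 1 0 ^ m"] by simp
      ultimately show "w \<otimes>\<^bsub>P\<^esub> ?x = ?x \<otimes>\<^bsub>P\<^esub> w"
        using we by (simp add: P_mult mat_act_lin_power add.commute)
    qed simp_all
    then obtain s where "?x = zq s" using slope_zero by fastforce
    then have "lin 1 0 ^ m = (0 :: 'f poly poly)" by (simp add: zq_def)
    then have "coeff_XY (lin 1 0 ^ m) m 0 = coeff_XY (0 :: 'f poly poly) m 0" by (simp only:)
    then show False unfolding coeff_XY_lin_power_ends by simp
  qed
  then show thesis using that[OF w1] g1 by simp
qed

lemma torus_weight:
  assumes \<theta>: "\<theta> \<noteq> 0"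
  shows "\<exists>x. x \<noteq> 0 \<and> (\<forall>s. \<zeta> (x ^ (m + 2) * s) = \<theta> * \<zeta> s) \<and>
    (\<forall>w\<in>W0. \<forall>\<alpha> \<delta>. \<Phi> w = C_mat \<alpha> 1 \<delta> 0 \<longrightarrow>
      (\<exists>w'\<in>W0. \<Phi> w' = C_mat (\<alpha> / \<theta>) 1 (\<theta> * \<delta>) 0 \<and> slope w' = x * slope w))"
proof -
  obtain n t a c d v z where n: "n \<in> N" "\<Phi> n = C_mat 0 \<theta> 0 0"
    and ne: "n = ((t, mat2 a 0 c d), (v, z))" "t \<noteq> 0" "a \<noteq> 0" "d \<noteq> 0" "v \<in> hom_polys m"
    and conj: "\<And>w. w \<in> W0 \<Longrightarrow> \<exists>w'\<in>W0. w \<otimes>\<^bsub>P\<^esub> n = n \<otimes>\<^bsub>P\<^esub> w' \<and> slope w' = a / d * slope w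
       \<and> (\<forall>\<alpha> \<delta>. \<Phi> w = C_mat \<alpha> 1 \<delta> 0 \<longrightarrow> \<Phi> w' = C_mat (\<alpha> / \<theta>) 1 (\<theta> * \<delta>) 0)"
    using torus[OF \<theta>] by blast
  define x where "x = a / d"
  have x: "x \<noteq> 0" using ne by (simp add: x_def)
  obtain w where w: "w \<in> W0" "slope w \<noteq> 0" "lead w \<noteq> 0" by (rule lead_nonzero)
  obtain w' where w': "w' \<in> W0" "w \<otimes>\<^bsub>P\<^esub> n = n \<otimes>\<^bsub>P\<^esub> w'" "slope w' = x * slope w"
    using conj[OF w(1)] x_def by blast
  obtain g1 v1 z1 where we: "w = ((1, mat2 1 0 g1 1), (v1, z1))" "v1 \<in> hom_polys m" using w(1) by (rule W0_lower)
  obtain g' v' z' where w'e: "w' = ((1, mat2 1 0 g' 1), (v', z'))" "v' \<in> hom_polys m" using w'(1) by (rule W0_lower)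
  have "scalar t * mat_act m v1 (mat2 a 0 c d) + v = mat_act m v (mat2 1 0 g' 1) + v'"
    using w'(2) by (simp add: we w'e ne P_mult)
  then have "coeff_XY (scalar t * mat_act m v1 (mat2 a 0 c d) + v) 0 m = coeff_XY (mat_act m v (mat2 1 0 g' 1) + v') 0 m"
    by simp
  \<comment> \<open>The contributions of v cancel because shears fix the coefficient of Y^m.\<close>
  then have "lead w' = t * d ^ m * lead w"
    unfolding coeff_XY_simps act_top[OF we(2)] act_top[OF ne(5)] by (simp add: we w'e mult.assoc)
  then have "lead w * (x * slope w) = t * d ^ m * lead w * slope w"
    using lead_slope[OF w(1) w'(1)] w'(3) by simp
  then have "x = t * d ^ m" using w by (simp add: algebra_simps)
  then have t: "t = x / d ^ m" using ne by simp
  \<comment> \<open>With a = x d and t = x / d^m all powers of d cancel.\<close>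
  have weight: "t\<^sup>2 * (a * d) ^ m = x ^ (m + 2)"
  proof -
    have "a = x * d" using ne by (simp add: x_def)
    then show ?thesis using ne
      by (simp add: t power_mult_distrib power_add power_divide power2_eq_square)
  qed
  have "\<zeta> (x ^ (m + 2) * s) = \<theta> * \<zeta> s" for s
  proof -
    have "zq s \<otimes>\<^bsub>P\<^esub> n = n \<otimes>\<^bsub>P\<^esub> zq (x ^ (m + 2) * s)"
      using ne weight by (simp add: zq_def P_mult)
    then have "\<Phi> (zq s) ** \<Phi> n = \<Phi> n ** \<Phi> (zq (x ^ (m + 2) * s))"
      using \<Phi>_mult[OF subsetD[OF W0_N zq_W0[of s]] n(1)]
        \<Phi>_mult[OF n(1) subsetD[OF W0_N zq_W0[of "x ^ (m + 2) * s"]]] by simp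
    then show ?thesis using \<theta> by (auto simp: n \<Phi>_zq_eq field_simps)
  qed
  then show ?thesis using x conj unfolding x_def by blast
qed

text \<open>As the slope depends on \<alpha> only, it becomes an additive function G on F. One and
  the same x then describes both weights of \<theta>: through \<zeta> on \<delta> and through G on
  \<alpha>.\<close>

lemma slope_uniformizer:
  obtains G where "\<And>\<alpha> \<beta>. G (\<alpha> + \<beta>) = G \<alpha> + G \<beta>" "inj G"
    "\<And>\<theta>. \<theta> \<noteq> 0 \<Longrightarrow> \<exists>x. x \<noteq> 0 \<and> (\<forall>s. \<zeta> (x ^ (m + 2) * s) = \<theta> * \<zeta> s) \<and> (\<forall>\<alpha>. G (\<alpha> / \<theta>) = x * G \<alpha>)"
proof -
  have "\<exists>w. w \<in> W0 \<and> \<Phi> w = C_mat \<alpha> 1 0 0" for \<alpha>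
    by (rule \<Phi>_W0_surj[of \<alpha> 0]) blast
  then obtain u where u: "u \<alpha> \<in> W0" "\<Phi> (u \<alpha>) = C_mat \<alpha> 1 0 0" for \<alpha>
    by metis
  define G where "G \<alpha> = slope (u \<alpha>)" for \<alpha>
  have G: "slope w = G \<alpha>" if "w \<in> W0" "\<Phi> w = C_mat \<alpha> 1 \<delta> 0" for w \<alpha> \<delta>
    unfolding G_def using slope_eq_if_\<Phi>(2)[OF that(1) u(1) that(2) u(2)] .
  have add: "G (\<alpha> + \<beta>) = G \<alpha> + G \<beta>" for \<alpha> \<beta>
  proof -
    have "\<Phi> (u \<alpha> \<otimes>\<^bsub>P\<^esub> u \<beta>) = C_mat (\<alpha> + \<beta>) 1 0 0"
      using \<Phi>_mult[OF subsetD[OF W0_N u(1)[of \<alpha>]] subsetD[OF W0_N u(1)[of \<beta>]]] by (simp add: u)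
    then show ?thesis
      using G[of "u \<alpha> \<otimes>\<^bsub>P\<^esub> u \<beta>"] slope_mult u W0 by (metis G_def subgroup.m_closed)
  qed
  have zero: "\<alpha> = 0" if "G \<alpha> = 0" for \<alpha>
  proof -
    obtain s where "u \<alpha> = zq s" using slope_zero[OF u(1)] \<open>G \<alpha> = 0\<close> unfolding G_def by blast
    then show ?thesis using u(2)[of \<alpha>] by (simp add: \<Phi>_zq_eq)
  qed
  have "inj G"
  proof (rule injI)
    fix \<alpha> \<beta> assume "G \<alpha> = G \<beta>"
    then have "G (\<alpha> - \<beta>) = 0" using add[of "\<alpha> - \<beta>" \<beta>] by simp
    then have "\<alpha> - \<beta> = 0" by (rule zero)
    then show "\<alpha> = \<beta>" by simp
  qed
  moreover have "\<exists>x. x \<noteq> 0 \<and> (\<forall>s. \<zeta> (x ^ (m + 2) * s) = \<theta> * \<zeta> s) \<and> (\<forall>\<alpha>. G (\<alpha> / \<theta>) = x * G \<alpha>)"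
    if \<theta>: "\<theta> \<noteq> 0" for \<theta>
  proof -
    obtain x where x: "x \<noteq> 0" "\<forall>s. \<zeta> (x ^ (m + 2) * s) = \<theta> * \<zeta> s"
      and conj: "\<And>w \<alpha> \<delta>. w \<in> W0 \<Longrightarrow> \<Phi> w = C_mat \<alpha> 1 \<delta> 0 \<Longrightarrow>
        \<exists>w'\<in>W0. \<Phi> w' = C_mat (\<alpha> / \<theta>) 1 (\<theta> * \<delta>) 0 \<and> slope w' = x * slope w"
      using torus_weight[OF \<theta>] by blast
    have "G (\<alpha> / \<theta>) = x * G \<alpha>" for \<alpha>
      using conj[OF u] G u unfolding G_def by metis
    with x show ?thesis by blast
  qed
  ultimately show thesis using that add by blast
qed

lemma not_char_3: "\<not> (m = 1 \<and> CHAR('f) = 3)"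
proof
  assume "m = 1 \<and> CHAR('f) = 3"
  then have m: "m = 1" and p: "CHAR('f) = 3" by auto
  have three: "(3 :: 'f) = 0" using of_nat_CHAR[where 'a = 'f] by (simp add: p)
  obtain w where w: "w \<in> W0" "slope w \<noteq> 0" "lead w \<noteq> 0" by (rule lead_nonzero)
  obtain g v z where we: "w = ((1, mat2 1 0 g 1), (v, z))" "v \<in> hom_polys m" using w(1) by (rule W0_lower)
  define b f where "b = coeff_XY v 1 0" and "f = coeff_XY v 0 1"
  have v: "v = lin b f ^ m" unfolding b_def f_def by (rule linear_form_eq[OF m we(2)])
  obtain \<alpha> \<delta> where \<Phi>w: "\<Phi> w = C_mat \<alpha> 1 \<delta> 0" using \<Phi>_W0[OF w(1)] by blast
  have ww: "w \<otimes>\<^bsub>P\<^esub> w \<in> W0" and www: "w \<otimes>\<^bsub>P\<^esub> w \<otimes>\<^bsub>P\<^esub> w \<in> W0"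
    using w W0 by (auto intro: subgroup.m_closed)
  have "\<Phi> (w \<otimes>\<^bsub>P\<^esub> w \<otimes>\<^bsub>P\<^esub> w) = \<Phi> w ** \<Phi> w ** \<Phi> w"
    using \<Phi>_mult[OF subsetD[OF W0_N ww] subsetD[OF W0_N w(1)]]
      \<Phi>_mult[OF subsetD[OF W0_N w(1)] subsetD[OF W0_N w(1)]] by simp
  also have "\<dots> = C_mat (3 * \<alpha>) 1 (3 * \<delta>) 0" by (simp add: \<Phi>w algebra_simps)
  finally have "w \<otimes>\<^bsub>P\<^esub> w \<otimes>\<^bsub>P\<^esub> w \<in> center P"
    using \<Phi>_ker[OF subsetD[OF W0_N www]] by (simp add: three)
  then have "w \<otimes>\<^bsub>P\<^esub> w \<otimes>\<^bsub>P\<^esub> w = \<one>\<^bsub>P\<^esub>" by (rule W0_center[OF www])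
  \<comment> \<open>The brackets are the values of the form on v sheared once, twice and once,
    paired with v, as they arise in w w and (w w) w. They add up to -4 f^2 g, where f and g are the
    lead and the slope of w.\<close>
  then have "3 * z + (f * b - (b + f * g) * f) + (f * b - (b + 2 * f * g) * f) + (f * b - (b + f * g) * f) = 0"
    by (simp add: we v P_mult P_one mat_act_lin_power form_lin) (simp add: m algebra_simps)
  then have "(2 * 2) * (f * f * g) = 3 * z" by (simp add: algebra_simps)
  also have "\<dots> = 0" by (simp only: three mult_zero_left)
  finally have "(2 * 2) * (f * f * g) = 0" .
  then have "f * f * g = 0" using two_nonzero by (metis mult_eq_0_iff)
  moreover have "lead w = f" unfolding we slope_lead f_def by (simp only: m)
  ultimately show False using w by (simp add: we(1))
qed

end

context normalized_datum
begin

lemma normalized_necessary: "CARD('f) = CHAR('f) \<and> CHAR('f) = m + 4"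
proof -
  obtain G where Gadd: "\<And>\<alpha> \<beta>. G (\<alpha> + \<beta>) = G \<alpha> + G \<beta>" and Ginj: "inj G"
    and G: "\<And>\<theta>. \<theta> \<noteq> 0 \<Longrightarrow> \<exists>x. x \<noteq> 0 \<and> (\<forall>s. \<zeta> (x ^ (m + 2) * s) = \<theta> * \<zeta> s) \<and> (\<forall>\<alpha>. G (\<alpha> / \<theta>) = x * G \<alpha>)"
    using slope_uniformizer by blast
  have "G 0 = 0" "\<zeta> 0 = 0"
    using Gadd[of 0 0] \<zeta>_add[of 0 0] by (metis add_0_right add_left_cancel)+
  then have G0: "G \<alpha> = 0 \<longleftrightarrow> \<alpha> = 0" and z0: "\<zeta> \<alpha> = 0 \<longleftrightarrow> \<alpha> = 0" for \<alpha>
    using injD[OF Ginj, of \<alpha> 0] injD[OF \<zeta>_inj, of \<alpha> 0] by auto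
  have Gsurj: "surj G" using Ginj by (intro finite_UNIV_inj_surj) auto
  define H where "H z = G (\<zeta> z / \<zeta> 1) / G 1" for z
  have "CARD('f) = CHAR('f) \<and> m + 2 + 2 = CHAR('f)"
  proof (rule additive_inverse_power)
    show "H (x + y) = H x + H y" for x y
      by (simp add: H_def \<zeta>_add Gadd add_divide_distrib)
    show "inj H"
      by (rule injI) (auto simp: H_def G0 z0 dest!: injD[OF Ginj] injD[OF \<zeta>_inj])
    show "H (y ^ (m + 2)) = inverse y" if y: "y \<noteq> 0" for y
    proof -
      obtain \<alpha> where \<alpha>: "G \<alpha> = y * G 1" using Gsurj by (metis surjD)
      then have \<alpha>0: "\<alpha> \<noteq> 0" using y G0[of 1] G0[of \<alpha>] by auto
      \<comment> \<open>With this \<theta> the associated x is the prescribed y, because G (1 /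
        \<theta>) = y G 1. Then \<zeta> (y^(m + 2)) = \<theta> \<zeta> 1, and G \<theta> = G 1 / y
        gives the value of H.\<close>
      define \<theta> where "\<theta> = 1 / \<alpha>"
      have \<theta>: "\<theta> \<noteq> 0" using \<alpha>0 by (simp add: \<theta>_def)
      obtain x where x: "\<forall>s. \<zeta> (x ^ (m + 2) * s) = \<theta> * \<zeta> s" "\<forall>\<alpha>. G (\<alpha> / \<theta>) = x * G \<alpha>"
        using G[OF \<theta>] by blast
      have "x * G 1 = y * G 1" using x(2)[rule_format, of 1] \<alpha> by (auto simp: \<theta>_def)
      then have xy: "x = y" using G0[of 1] by simp
      have "\<zeta> (y ^ (m + 2)) = \<theta> * \<zeta> 1" using x(1)[rule_format, of 1] xy by simp
      moreover have "G 1 = y * G \<theta>" using x(2)[rule_format, of \<theta>] \<theta> xy by simp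
      ultimately show ?thesis using y G0[of 1] G0[of \<theta>] z0[of 1] \<theta> by (simp add: H_def field_simps)
    qed
    show "odd (m + 2)" using odd_m by simp
    show "m + 2 \<le> CHAR('f)" by (rule m_less)
    show "odd CHAR('f)"
    proof
      assume "even CHAR('f)"
      then have "CHAR('f) = 2" using prime_CHAR[where 'f = 'f] by (metis primes_dvd_imp_eq two_is_prime_nat)
      then show False using m_less m_pos by simp
    qed
    show "\<not> (m + 2 = CHAR('f) \<and> CHAR('f) = 3)" using not_char_3 by auto
  qed
  then show ?thesis by simp
qed

end

section \<open>Reduction to lower shears by conjugation\<close>

context normalizer_datum
begin

text \<open>Every ingredient of the datum is carried along by conjugation with h; \<Phi> is
  evaluated after undoing it.\<close>

lemma conj_datum:
  assumes h: "h \<in> carrier P"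
  shows "normalizer_datum m (P.conj h ` W0) (\<lambda>g. \<Phi> (P.conj (inv\<^bsub>P\<^esub> h) g))"
proof -
  have K': "P.conj h ` W0 <#>\<^bsub>P\<^esub> center P = P.conj h ` K"
    by (rule P.conj_set_mult_center[OF h W0_carrier])
  have N': "normalizer P (P.conj h ` K) = P.conj h ` N"
    by (rule P.conj_normalizer[OF h K_carrier])
  have ci: "P.conj (inv\<^bsub>P\<^esub> h) (P.conj h x) = x" if "x \<in> N" for x
    using P.conj_inv_conj(1)[OF h subsetD[OF N_carrier that]] .
  have mem: "P.conj h x \<in> P.conj h ` S \<longleftrightarrow> x \<in> S" if xS: "x \<in> carrier P" "S \<subseteq> carrier P" for x S
  proof
    assume "P.conj h x \<in> P.conj h ` S"
    then obtain s where s: "s \<in> S" "P.conj h x = P.conj h s" by blast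
    then have "s \<in> carrier P" using xS by blast
    then have "x = s"
      using P.conj_inv_conj(1)[OF h xS(1)] P.conj_inv_conj(1)[OF h, of s] s(2) by metis
    then show "x \<in> S" using s(1) by (simp only:)
  qed simp
  show ?thesis
  proof (intro normalizer_datum.intro normalizer_datum_axioms.intro, unfold K' N')
    show "parabolic TYPE('f) m" by (rule parabolic_axioms)
    show "subgroup (P.conj h ` W0) P" by (rule P.conj_subgroup[OF h W0])
    have "inj_on (P.conj h) W0"
      using P.conj_inv_conj(1)[OF h] W0_carrier by (intro inj_on_inverseI[of _ "P.conj (inv\<^bsub>P\<^esub> h)"]) auto
    then show "\<exists>k. card (P.conj h ` W0) = CHAR('f) ^ k"
      using card_W0 by (simp add: card_image)
    show "\<Phi> (P.conj (inv\<^bsub>P\<^esub> h) (x \<otimes>\<^bsub>P\<^esub> y)) = \<Phi> (P.conj (inv\<^bsub>P\<^esub> h) x) ** \<Phi> (P.conj (inv\<^bsub>P\<^esub> h) y)"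
      if "x \<in> P.conj h ` N" "y \<in> P.conj h ` N" for x y
    proof -
      obtain x' y' where xy: "x' \<in> N" "y' \<in> N" "x = P.conj h x'" "y = P.conj h y'"
        using \<open>x \<in> P.conj h ` N\<close> \<open>y \<in> P.conj h ` N\<close> by blast
      have "x \<otimes>\<^bsub>P\<^esub> y = P.conj h (x' \<otimes>\<^bsub>P\<^esub> y')"
        using P.conj_mult[OF h subsetD[OF N_carrier xy(1)] subsetD[OF N_carrier xy(2)]] by (simp add: xy)
      then show ?thesis
        using ci[OF xy(1)] ci[OF xy(2)] ci[OF subgroup.m_closed[OF N_subgroup xy(1,2)]] \<Phi>_mult[OF xy(1,2)] xy
        by metis
    qed
    have "(\<lambda>g. \<Phi> (P.conj (inv\<^bsub>P\<^esub> h) g)) ` P.conj h ` N = \<Phi> ` N"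
      unfolding image_image using ci by (intro image_cong refl) metis
    then show "(\<lambda>g. \<Phi> (P.conj (inv\<^bsub>P\<^esub> h) g)) ` P.conj h ` N = carrier C_group"
      by (simp only: \<Phi>_surj)
    show "\<Phi> (P.conj (inv\<^bsub>P\<^esub> h) x) = C_mat 0 1 0 0 \<longleftrightarrow> x \<in> center P"
      if "x \<in> P.conj h ` N" for x
    proof -
      obtain y where y: "y \<in> N" "x = P.conj h y" using \<open>x \<in> P.conj h ` N\<close> by blast
      have "center P = P.conj h ` center P"
        using P.conj_center[OF h] by force
      moreover have "y \<in> carrier P" "center P \<subseteq> carrier P" using y N_carrier P.center_closed by blast+
      ultimately have "x \<in> center P \<longleftrightarrow> y \<in> center P"
        unfolding y(2) using mem by metis
      then show ?thesis using \<Phi>_ker[OF y(1)] ci[OF y(1)] y(2) by simp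
    qed
    show "\<Phi> (P.conj (inv\<^bsub>P\<^esub> h) x) \<in> W_subgroup \<longleftrightarrow> x \<in> P.conj h ` K"
      if "x \<in> P.conj h ` N" for x
    proof -
      obtain y where y: "y \<in> N" "x = P.conj h y" using \<open>x \<in> P.conj h ` N\<close> by blast
      then have "y \<in> carrier P" using N_carrier by blast
      then have "x \<in> P.conj h ` K \<longleftrightarrow> y \<in> K"
        unfolding y(2) using K_carrier by (rule mem)
      then show ?thesis using \<Phi>_W[OF y(1)] ci[OF y(1)] y(2) by simp
    qed
  qed
qed

lemma necessary: "CARD('f) = CHAR('f) \<and> CHAR('f) = m + 4"
proof -
  obtain t A v z where w: "((t, A), (v, z)) \<in> W0" and A: "A \<noteq> mat2 1 0 0 1"
    using W0_not_in_Q by blast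
  obtain a b c d where Ae: "A = mat2 a b c d" by (rule mat2_cases)
  have t: "t = 1" and tr: "a + d = 2" and det: "a * d - b * c = 1" and v: "v \<in> hom_polys m"
    using W0_unipotent[OF w[unfolded Ae]] by auto
  have d: "d = 2 - a" using tr by (simp add: algebra_simps)
  show ?thesis
  proof (cases "b = 0")
    case True
    have "(a - 1) * (a - 1) = 0" using det True by (simp add: d algebra_simps)
    then have "a = 1" "d = 1" using d by auto
    then have "\<exists>g v z. g \<noteq> 0 \<and> ((1, mat2 1 0 g 1), (v, z)) \<in> W0"
      using w A True by (auto simp: Ae t)
    then interpret normalized_datum m F W0 \<Phi> by unfold_locales
    show ?thesis by (rule normalized_necessary)
  next
    case False
    let ?w = "((1, mat2 a b c d), (v, z))"
    \<comment> \<open>The first row of the matrix is a row vector fixed by that of w, and w maps the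
      second row to the sum of both rows. Hence conjugation turns the matrix of w into (1 0; 1 1);
      the determinant is - b.\<close>
    define h :: "('f \<times> ('f^2^2)) \<times> ('f poly poly \<times> 'f)" where "h = ((1, mat2 (1 - d) b 1 0), (0, 0))"
    have h: "h \<in> carrier P" using False by (simp add: h_def)
    have wW: "?w \<in> W0" using w by (simp add: Ae t)
    have wc: "?w \<in> carrier P" using wW W0_carrier by blast
    interpret D: normalizer_datum m F "P.conj h ` W0" "\<lambda>g. \<Phi> (P.conj (inv\<^bsub>P\<^esub> h) g)"
      by (rule conj_datum[OF h])
    have cw: "P.conj h ?w \<in> P.conj h ` W0" using wW by blast
    then have "P.conj h ?w \<in> carrier P" using D.W0_carrier by blast
    then obtain t' a' b' c' d' v' z' where w': "P.conj h ?w = ((t', mat2 a' b' c' d'), (v', z'))"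
      by (rule P_cases)
    have "P.conj h ?w \<otimes>\<^bsub>P\<^esub> h = h \<otimes>\<^bsub>P\<^esub> ?w"
      using h wc by (simp add: P.m_assoc)
    then have "((t', mat2 a' b' c' d'), (v', z')) \<otimes>\<^bsub>P\<^esub> h = h \<otimes>\<^bsub>P\<^esub> ?w"
      unfolding w' .
    then have eqs: "a' * (1 - d) + b' = (1 - d) * a + b * c" "a' * b = (1 - d) * b + b * d"
      "c' * (1 - d) + d' = a" "c' * b = b" "t' = 1"
      by (simp_all add: h_def P_mult)
    have a': "a' = 1" and c': "c' = 1" using eqs(2,4) False by (simp_all add: algebra_simps)
    have d': "d' = 1" using eqs(3) by (simp add: c' d algebra_simps)
    have "b' = a - (a * d - b * c) - (1 - d)" using eqs(1) by (simp add: a' algebra_simps)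
    then have b': "b' = 0" using det by (simp add: d algebra_simps)
    have "\<exists>g v z. g \<noteq> 0 \<and> ((1, mat2 1 0 g 1), (v, z)) \<in> P.conj h ` W0"
      using cw unfolding w' a' b' c' d' eqs(5) by (metis one_neq_zero)
    then interpret E: normalized_datum m F "P.conj h ` W0" "\<lambda>g. \<Phi> (P.conj (inv\<^bsub>P\<^esub> h) g)"
      by unfold_locales
    show ?thesis by (rule E.normalized_necessary)
  qed
qed

end

lemma (in parabolic) condition_necessary:
  assumes "p_subgroup CHAR('f) W0 P"
    and "h \<in> iso ((P Mod center P)\<lparr>carrier := normalizer (P Mod center P) (image_Mod P W0 (center P))\<rparr>)
      (C_group :: ('f^3^3) monoid)"
    and "h ` image_Mod P W0 (center P) = W_subgroup"
  shows "CARD('f) = CHAR('f) \<and> CHAR('f) = m + 4"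
proof -
  have W0: "subgroup W0 P" "\<exists>k. card W0 = CHAR('f) ^ k"
    using assms(1) by (auto simp: p_subgroup_def)
  show ?thesis
  proof (rule P.pull_back_iso[OF W0(1) assms(2,3) group_C_group])
    fix \<Phi> :: "('f \<times> ('f^2^2)) \<times> ('f poly poly \<times> 'f) \<Rightarrow> 'f^3^3"
    assume \<Phi>: "\<And>x y. x \<in> normalizer P (W0 <#>\<^bsub>P\<^esub> center P) \<Longrightarrow>
        y \<in> normalizer P (W0 <#>\<^bsub>P\<^esub> center P) \<Longrightarrow> \<Phi> (x \<otimes>\<^bsub>P\<^esub> y) = \<Phi> x \<otimes>\<^bsub>C_group\<^esub> \<Phi> y"
      "\<Phi> ` normalizer P (W0 <#>\<^bsub>P\<^esub> center P) = carrier C_group"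
      "\<And>x. x \<in> normalizer P (W0 <#>\<^bsub>P\<^esub> center P) \<Longrightarrow> \<Phi> x = \<one>\<^bsub>C_group\<^esub> \<longleftrightarrow> x \<in> center P"
      "\<And>x. x \<in> normalizer P (W0 <#>\<^bsub>P\<^esub> center P) \<Longrightarrow>
        \<Phi> x \<in> W_subgroup \<longleftrightarrow> x \<in> W0 <#>\<^bsub>P\<^esub> center P"
    have "normalizer_datum m W0 \<Phi>"
      using W0 \<Phi> by (intro normalizer_datum.intro normalizer_datum_axioms.intro parabolic_axioms) simp_all
    then interpret normalizer_datum m F W0 \<Phi> .
    show ?thesis by (rule necessary)
  qed
qed

section \<open>Sufficiency\<close>

lemma coeff_XY_X_mult:
  "coeff_XY (var_X * v) a b = (case a of 0 \<Rightarrow> 0 | Suc a' \<Rightarrow> coeff_XY v a' b)"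
  by (simp add: coeff_XY_def var_X_def split: nat.split)

lemma coeff_XY_X_power_mult:
  "coeff_XY (var_X ^ i * v) a b = (if i \<le> a then coeff_XY v (a - i) b else 0)"
  by (induction i arbitrary: a) (auto simp: coeff_XY_X_mult mult.assoc split: nat.split)

lemma sum_monomials:
  assumes "v = (\<Sum>i\<le>m. scalar (c i) * (var_X ^ i * var_Y ^ (m - i)))"
  shows "v \<in> hom_polys m" and "i \<le> m \<Longrightarrow> coeff_XY v i (m - i) = c i"
proof -
  show "v \<in> hom_polys m"
    unfolding assms by (intro hom_polys_sum hom_polys_closed monomial_in_hom_polys) auto
  assume i: "i \<le> m"
  have "coeff_XY v i (m - i) = (\<Sum>j\<le>m. if j = i then c j else 0)"
    unfolding assms coeff_XY_simps using i by (intro sum.cong) auto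
  then show "coeff_XY v i (m - i) = c i" using i by simp
qed

text \<open>This links degrees m and m + 1, so that \<open>vv s\<close> can be handled through (m +
  1)-st powers of linear forms.\<close>

lemma mat_act_X_mult:
  "mat_act (Suc m) (var_X * v) A = lin (A $ 1 $ 1) (A $ 1 $ 2) * mat_act m v A"
  unfolding mat_act_def lin_def[symmetric] sum.atMost_Suc_shift
  by (simp add: coeff_XY_X_mult sum_distrib_left algebra_simps)

text \<open>Absorbs the two denominators that arise when both arguments of the form are
  integrated.\<close>

lemma binomial_Suc_Suc_absorb:
  assumes "a \<le> m"
  shows "(Suc (Suc m) choose Suc a) * (Suc a * Suc (m - a)) = Suc (Suc m) * Suc m * (m choose a)"
proof -
  have "(Suc m choose a) * Suc (m - a) = Suc m * (m choose a)"
    using binomial_absorb_comp[of "Suc m" a] assms by (simp add: Suc_diff_le mult.commute)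
  moreover have "Suc a * (Suc (Suc m) choose Suc a) = Suc (Suc m) * (Suc m choose a)"
    by (rule Suc_times_binomial_eq[symmetric, unfolded mult.commute[of "_ choose _"]])
  ultimately show ?thesis by (metis mult.assoc mult.commute)
qed

locale parabolic_prime = parabolic m F for m and F :: "'f::{field,finite} itself" +
  assumes card: "CARD('f) = m + 4" and char: "CHAR('f) = m + 4"
begin

text \<open>F is the prime field, so every element comes from a natural number, and additivity of
  p-th powers allows induction.\<close>

lemma power_card: "x ^ (m + 4) = (x :: 'f)"
proof -
  have "inj_on (of_nat :: nat \<Rightarrow> 'f) {..<m + 4}"
    by (auto simp: inj_on_def of_nat_eq_iff_cong_CHAR cong_def char)
  then have "card ((of_nat :: nat \<Rightarrow> 'f) ` {..<m + 4}) = CARD('f)"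
    by (simp add: card_image card)
  then have "(of_nat :: nat \<Rightarrow> 'f) ` {..<m + 4} = UNIV"
    by (intro card_subset_eq) auto
  then obtain n where n: "x = of_nat n" by blast
  have "(of_nat n :: 'f) ^ (m + 4) = of_nat n"
  proof (induction n)
    case (Suc n)
    have "(1 + of_nat n :: 'f) ^ (m + 4) = 1 ^ (m + 4) + of_nat n ^ (m + 4)"
      by (rule freshmans_dream) (simp_all only: char prime_CHAR[where 'f = 'f, unfolded char])
    with Suc show ?case by simp
  qed simp
  then show ?thesis by (simp only: n)
qed

text \<open>For t = x and diag(x, 1) with x = 1 / \<theta>, the weight on Z(Q) is x^(m + 2) and that
  on X^m is x^(m + 1); both simplify because x^(m + 3) = 1.\<close>

lemma power_inverse_weights:
  fixes \<theta> :: 'f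
  assumes "\<theta> \<noteq> 0"
  shows "inverse \<theta> ^ (m + 2) = \<theta>" "inverse \<theta> ^ (m + 1) = \<theta> ^ 2"
proof -
  let ?x = "inverse \<theta>"
  have "?x ^ (m + 4) = ?x" by (rule power_card)
  then have "?x ^ (m + 1) * (?x * ?x * ?x) = ?x" "?x ^ (m + 2) * (?x * ?x) = ?x"
    by (simp_all add: power_add numeral_eq_Suc mult_ac)
  with assms show "?x ^ (m + 2) = \<theta>" "?x ^ (m + 1) = \<theta> ^ 2"
    by (simp_all add: field_simps power2_eq_square del: power_inverse)
qed

lemma of_nat_nonzero: "0 < n \<Longrightarrow> n < m + 4 \<Longrightarrow> of_nat n \<noteq> (0 :: 'f)"
  by (auto simp: of_nat_eq_0_iff_char_dvd char dest: dvd_imp_le)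

text \<open>
  \<open>vv s\<close> is the integral of \<open>(Y + r X)^m\<close> for \<open>r\<close> from \<open>0\<close> to \<open>s\<close>, and the elements
  \<open>((1, mat2 1 0 s 1), (vv s, yy s))\<close> form a one-parameter subgroup of \<open>P\<close>.
\<close>

definition vv :: "'f \<Rightarrow> 'f poly poly" where
  "vv s = (\<Sum>i\<le>m. scalar (of_nat (m choose i) / of_nat (Suc i) * s ^ Suc i) * (var_X ^ i * var_Y ^ (m - i)))"

text \<open>The denominator left by integrating an m-th power twice.\<close>

definition cc :: 'f where "cc = of_nat (Suc m) * of_nat (Suc (Suc m))"

definition yy :: "'f \<Rightarrow> 'f" where "yy s = - (s ^ (m + 2)) / cc"

lemmas vv_hom [simp] = sum_monomials(1)[OF vv_def]
lemmas vv_coeff = sum_monomials(2)[OF vv_def]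

lemma vv_coeff_0 [simp]: "coeff_XY (vv s) 0 m = s"
  using vv_coeff[of 0 s] by simp

lemma vv_0 [simp]: "vv 0 = 0" by (simp add: vv_def)

lemma yy_0 [simp]: "yy 0 = 0" by (simp add: yy_def)

lemma cc_nonzero: "cc \<noteq> 0"
  using of_nat_nonzero[of "Suc m"] of_nat_nonzero[of "Suc (Suc m)"] by (simp add: cc_def del: of_nat_Suc)

text \<open>The antiderivative of (Y + r X)^m in r is (Y + r X)^(m + 1) / ((m + 1) X). Clearing the
  denominator leaves powers of linear forms, which the action transforms directly.\<close>

lemma X_mult_vv: "scalar (of_nat (Suc m)) * (var_X * vv s) = lin s 1 ^ Suc m - lin 0 1 ^ Suc m"
proof (rule hom_polys_eqI[where m = "Suc m"])
  have "var_X \<in> hom_polys 1" using monomial_in_hom_polys[of 1 0 1] by simp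
  then have "var_X * vv s \<in> hom_polys (1 + m)" by (rule hom_polys_mult) simp
  then show "scalar (of_nat (Suc m)) * (var_X * vv s) \<in> hom_polys (Suc m)"
    by (intro hom_polys_closed(3)) simp
  show "lin s 1 ^ Suc m - lin 0 1 ^ Suc m \<in> hom_polys (Suc m)"
    by (intro hom_polys_diff lin_power_in_hom_polys)
next
  fix i assume i: "i \<le> Suc m"
  show "coeff_XY (scalar (of_nat (Suc m)) * (var_X * vv s)) i (Suc m - i) =
      coeff_XY (lin s 1 ^ Suc m - lin 0 1 ^ Suc m) i (Suc m - i)"
  proof (cases i)
    case 0
    then show ?thesis unfolding coeff_XY_simps coeff_XY_X_mult coeff_XY_lin_power[OF i] by simp
  next
    case (Suc j)
    then have j: "j \<le> m" using i by simp
    have "of_nat (Suc j) * of_nat (Suc m choose Suc j) = (of_nat (Suc m) * of_nat (m choose j) :: 'f)"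
      unfolding of_nat_mult[symmetric] by (subst Suc_times_binomial) (rule refl)
    moreover have "of_nat (Suc j) \<noteq> (0 :: 'f)" using j by (intro of_nat_nonzero) auto
    ultimately have *: "of_nat (Suc m) * (of_nat (m choose j) / of_nat (Suc j) * s ^ Suc j)
        = of_nat (Suc m choose Suc j) * s ^ Suc j"
      by (simp add: field_simps del: of_nat_Suc binomial_Suc_Suc)
    show ?thesis
      unfolding Suc coeff_XY_simps coeff_XY_X_mult coeff_XY_lin_power[OF i[unfolded Suc]]
      using vv_coeff[OF j, of s] * by (simp del: of_nat_Suc power_Suc binomial_Suc_Suc)
  qed
qed

text \<open>The shear replaces Y by Y + r X and so shifts the interval of integration. This is
  carried out after multiplication by (m + 1) X, which is nonzero because p = m + 4.\<close>

lemma vv_shear: "mat_act m (vv s) (mat2 1 0 r 1) = vv (s + r) - vv r"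
proof -
  let ?u = "mat2 1 0 r 1"
  let ?k = "scalar (of_nat (Suc m) :: 'f)"
  have X: "lin 1 0 = (var_X :: 'f poly poly)" by (simp add: lin_def)
  have "?k * (var_X * mat_act m (vv s) ?u) = mat_act (Suc m) (?k * (var_X * vv s)) ?u"
    unfolding mat_act_scalar mat_act_X_mult by (simp add: X)
  also have "\<dots> = lin (s + r) 1 ^ Suc m - lin r 1 ^ Suc m"
    unfolding X_mult_vv mat_act_diff mat_act_lin_power by simp
  also have "\<dots> = ?k * (var_X * (vv (s + r) - vv r))"
    unfolding right_diff_distrib X_mult_vv by simp
  finally have "?k * var_X * (mat_act m (vv s) ?u) = ?k * var_X * (vv (s + r) - vv r)"
    by (simp only: mult.assoc)
  moreover have "?k * var_X \<noteq> 0"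
    using of_nat_nonzero[of "Suc m"] by (simp add: scalar_def var_X_def del: of_nat_Suc)
  ultimately show ?thesis by (metis mult_left_cancel)
qed

lemma vv_scale: "scalar x * mat_act m (vv s) (mat2 x 0 0 1) = vv (s * x)"
proof (rule hom_polys_eqI[of _ m])
  fix i assume i: "i \<le> m"
  then show "coeff_XY (scalar x * mat_act m (vv s) (mat2 x 0 0 1)) i (m - i) = coeff_XY (vv (s * x)) i (m - i)"
    unfolding coeff_XY_simps act_diag[OF vv_hom i] vv_coeff[OF i] by (simp add: power_mult_distrib)
qed simp_all

text \<open>By \<open>form_lin_power\<close> this is formally the double integral of (r' - r)^m,
  with r from 0 to s and r' from 0 to t. In finite terms, the sum defining the form is the binomial
  expansion of (s - t)^(m + 2) without its two end terms.\<close>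

lemma form_vv: "form m (vv s) (vv t) = ((s - t) ^ (m + 2) + t ^ (m + 2) - s ^ (m + 2)) / cc"
proof -
  have cc: "cc = of_nat (Suc (Suc m) * Suc m)" by (simp only: cc_def of_nat_mult) (rule mult.commute)
  have summand: "(- 1) ^ a * coeff_XY (vv s) a (m - a) * coeff_XY (vv t) (m - a) a / of_nat (m choose a)
      = of_nat (Suc (Suc m) choose Suc a) * s ^ Suc a * (- t) ^ (Suc (Suc m) - Suc a) / cc"
    if a: "a \<le> m" for a
  proof -
    define B where "B = (of_nat (m choose a) :: 'f)"
    define A1 where "A1 = (of_nat (Suc a) :: 'f)"
    define A2 where "A2 = (of_nat (Suc (m - a)) :: 'f)"
    define C where "C = (of_nat (Suc (Suc m) choose Suc a) :: 'f)"
    have nz: "B \<noteq> 0" "A1 \<noteq> 0" "A2 \<noteq> 0"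
      unfolding B_def A1_def A2_def
      using of_nat_binomial_nonzero[OF m_less_CHAR a] of_nat_nonzero[of "Suc a"] of_nat_nonzero[of "Suc (m - a)"] a
      by (simp_all del: of_nat_Suc)
    have "C * (A1 * A2) = cc * B"
      unfolding B_def A1_def A2_def C_def cc of_nat_mult[symmetric] binomial_Suc_Suc_absorb[OF a] ..
    then have C: "C / cc = B / (A1 * A2)"
      using nz cc_nonzero by (simp add: field_simps)
    have t: "coeff_XY (vv t) (m - a) a = B / A2 * t ^ Suc (m - a)"
      using vv_coeff[of "m - a" t] a binomial_symmetric[OF a] by (simp add: B_def A2_def)
    have s: "coeff_XY (vv s) a (m - a) = B / A1 * s ^ Suc a"
      using vv_coeff[OF a] by (simp add: B_def A1_def)
    have "even (Suc (m - a)) \<longleftrightarrow> even a" using odd_m a by auto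
    then have sign: "(- t) ^ Suc (m - a) = (- 1) ^ a * t ^ Suc (m - a)"
      by (cases "even a") (auto simp del: power_Suc)
    have "(- 1) ^ a * coeff_XY (vv s) a (m - a) * coeff_XY (vv t) (m - a) a / B
        = C / cc * (s ^ Suc a * ((- 1) ^ a * t ^ Suc (m - a)))"
      unfolding s t C using nz by (simp del: power_Suc)
    also have "\<dots> = C * s ^ Suc a * (- t) ^ (Suc (Suc m) - Suc a) / cc"
      using a by (simp add: sign[symmetric] Suc_diff_le del: power_Suc)
    finally show ?thesis by (simp only: B_def C_def)
  qed
  have "(s - t) ^ Suc (Suc m) = (\<Sum>k\<le>Suc (Suc m). of_nat (Suc (Suc m) choose k) * s ^ k * (- t) ^ (Suc (Suc m) - k))"
    using binomial_ring[of s "- t" "Suc (Suc m)"] by (simp only: diff_conv_add_uminus)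
  also have "\<dots> = (- t) ^ Suc (Suc m)
      + (\<Sum>a\<le>m. of_nat (Suc (Suc m) choose Suc a) * s ^ Suc a * (- t) ^ (Suc (Suc m) - Suc a)) + s ^ Suc (Suc m)"
    unfolding sum.atMost_Suc_shift[of _ "Suc m"] sum.atMost_Suc[of _ m] by (simp del: power_Suc binomial_Suc_Suc)
  also have "(\<Sum>a\<le>m. of_nat (Suc (Suc m) choose Suc a) * s ^ Suc a * (- t) ^ (Suc (Suc m) - Suc a)) = cc * form m (vv s) (vv t)"
    unfolding form_altdef sum_distrib_left using cc_nonzero by (intro sum.cong refl) (simp add: summand del: power_Suc binomial_Suc_Suc)
  also have "(- t) ^ Suc (Suc m) = - (t ^ Suc (Suc m))" using odd_m by (simp del: power_Suc)
  finally show ?thesis using cc_nonzero by (simp add: field_simps)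
qed

text \<open>This is the condition on the central coordinates under which the elements with
  parameters s and r multiply to the one with parameter s + r.\<close>

lemma yy_cocycle: "form m (vv (s + r) - vv r) (vv r) = yy (s + r) - yy s - yy r"
proof -
  have "form m (vv (s + r) - vv r) (vv r) = form m (vv (s + r)) (vv r)"
    by simp
  also have "\<dots> = (s ^ (m + 2) + r ^ (m + 2) - (s + r) ^ (m + 2)) / cc"
    unfolding form_vv by simp
  finally show ?thesis by (simp add: yy_def diff_divide_distrib add_divide_distrib)
qed

lemma yy_scale:
  assumes "\<theta> \<noteq> 0"
  shows "yy (s * inverse \<theta>) = \<theta> * yy s"
  using power_inverse_weights(1)[OF assms] by (simp only: yy_def power_mult_distrib) simp

text \<open>By induction on the power of X: once the lower coefficients of v vanish, the shear
  changes the next one by (m - i) c times the coefficient at i, and m - i is invertible for i <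
  m.\<close>

lemma shear_fixed:
  fixes v :: "'f poly poly"
  assumes v: "v \<in> hom_polys m" and fixed: "mat_act m v (mat2 1 0 c 1) = v" and c: "c \<noteq> 0"
  obtains r where "v = scalar r * lin 1 0 ^ m"
proof -
  have zero: "coeff_XY v i (m - i) = 0" if "i < m" for i
    using that
  proof (induction i rule: less_induct)
    case (less i)
    have "coeff_XY (mat_act m v (mat2 1 0 c 1)) (Suc i) (m - Suc i)
        = (\<Sum>j\<le>m. coeff_XY v j (m - j) * coeff_XY (var_X ^ j * lin c 1 ^ (m - j)) (Suc i) (m - Suc i))"
      unfolding mat_act_def by (simp add: lin_def mult.assoc)
    also have "\<dots> = (\<Sum>j\<in>{i, Suc i}. coeff_XY v j (m - j) * coeff_XY (var_X ^ j * lin c 1 ^ (m - j)) (Suc i) (m - Suc i))"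
    proof (rule sum.mono_neutral_right)
      show "\<forall>j\<in>{..m} - {i, Suc i}. coeff_XY v j (m - j) * coeff_XY (var_X ^ j * lin c 1 ^ (m - j)) (Suc i) (m - Suc i) = 0"
      proof
        fix j assume "j \<in> {..m} - {i, Suc i}"
        then have "j < i \<or> Suc i < j" by auto
        then show "coeff_XY v j (m - j) * coeff_XY (var_X ^ j * lin c 1 ^ (m - j)) (Suc i) (m - Suc i) = 0"
          using less by (auto simp: coeff_XY_X_power_mult)
      qed
    qed (use less.prems in auto)
    also have "\<dots> = coeff_XY v i (m - i) * (of_nat (m - i) * c) + coeff_XY v (Suc i) (m - Suc i)"
    proof -
      have "coeff_XY (lin c 1 ^ (m - i)) 1 (m - i - 1) = of_nat (m - i) * c"
        using coeff_XY_lin_power[of 1 "m - i" c 1] less.prems by simp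
      then show ?thesis by (simp add: coeff_XY_X_power_mult)
    qed
    finally have "coeff_XY v i (m - i) * (of_nat (m - i) * c) = 0"
      by (simp add: fixed)
    then show ?case using of_nat_nonzero[of "m - i"] less.prems c by simp
  qed
  have "v = scalar (coeff_XY v m 0) * lin 1 0 ^ m"
  proof (rule hom_polys_eqI[OF v])
    fix i assume "i \<le> m"
    then show "coeff_XY v i (m - i) = coeff_XY (scalar (coeff_XY v m 0) * lin 1 0 ^ m) i (m - i)"
      using zero[of i] by (cases "i = m") (simp_all add: power_0_left)
  qed simp
  then show thesis by (rule that)
qed

text \<open>The torus goes to t = x and diag(x, 1) with x = 1 / \<theta>, the case d = 1 of the
  relation t d^m = a / d. The parameter \<alpha> gives the slope \<alpha> x, \<epsilon> a multiple
  of X^m, and \<delta> enters the central coordinate. The halves compensate that commutators with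
  X^m pick up the form twice.\<close>

definition \<Psi> :: "'f^3^3 \<Rightarrow> ('f \<times> ('f^2^2)) \<times> ('f poly poly \<times> 'f)" where
  "\<Psi> M = (let \<alpha> = M $ 2 $ 1; \<theta> = M $ 2 $ 2; \<delta> = M $ 3 $ 1; \<epsilon> = M $ 3 $ 2; x = inverse \<theta> in
    ((x, mat2 x 0 (\<alpha> * x) 1),
     (vv (\<alpha> * x) - scalar (\<epsilon> * \<theta> / 2) * lin 1 0 ^ m, yy (\<alpha> * x) + \<theta> * \<delta> - \<epsilon> * \<alpha> / 2)))"

lemma \<Psi>_C_mat: "\<Psi> (C_mat \<alpha> \<theta> \<delta> \<epsilon>) =
    ((inverse \<theta>, mat2 (inverse \<theta>) 0 (\<alpha> * inverse \<theta>) 1),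
     (vv (\<alpha> * inverse \<theta>) - scalar (\<epsilon> * \<theta> / 2) * lin 1 0 ^ m, yy (\<alpha> * inverse \<theta>) + \<theta> * \<delta> - \<epsilon> * \<alpha> / 2))"
  by (simp add: \<Psi>_def Let_def)

lemma \<Psi>_carrier: "\<theta> \<noteq> 0 \<Longrightarrow> \<Psi> (C_mat \<alpha> \<theta> \<delta> \<epsilon>) \<in> carrier P"
  by (simp add: \<Psi>_C_mat)

lemma act_lower:
  fixes v :: "'f poly poly"
  assumes "v \<in> hom_polys m"
  shows "mat_act m v (mat2 x 0 g 1) = mat_act m (mat_act m v (mat2 x 0 0 1)) (mat2 1 0 g 1)"
  using assms by simp

lemma act_lower_vv: "scalar x * mat_act m (vv s) (mat2 x 0 g 1) = vv (s * x + g) - vv g"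
proof -
  have "scalar x * mat_act m (vv s) (mat2 x 0 g 1) = mat_act m (scalar x * mat_act m (vv s) (mat2 x 0 0 1)) (mat2 1 0 g 1)"
    unfolding mat_act_scalar using act_lower[OF vv_hom] by simp
  then show ?thesis unfolding vv_scale vv_shear .
qed

lemma \<Psi>_mult:
  assumes \<theta>: "\<theta> \<noteq> 0" "\<theta>' \<noteq> 0"
  shows "\<Psi> (C_mat \<alpha> \<theta> \<delta> \<epsilon>) \<otimes>\<^bsub>P\<^esub> \<Psi> (C_mat \<alpha>' \<theta>' \<delta>' \<epsilon>')
    = \<Psi> (C_mat \<alpha> \<theta> \<delta> \<epsilon> ** C_mat \<alpha>' \<theta>' \<delta>' \<epsilon>')"
proof -
  define x x' g g' G where "x = inverse \<theta>" and "x' = inverse \<theta>'" and "g = \<alpha> * x" and "g' = \<alpha>' * x'"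
    and "G = g * x' + g'"
  let ?X = "lin 1 0 ^ m :: 'f poly poly"
  have xx': "inverse (\<theta> * \<theta>') = x * x'" by (simp add: x_def x'_def)
  have G: "G = (\<alpha> + \<theta> * \<alpha>') * inverse (\<theta> * \<theta>')"
    using \<theta> by (simp add: G_def g_def g'_def x_def x'_def field_simps)
  \<comment> \<open>X^m is scaled by x'^(m + 1), which is \<theta>'^2 because x'^(m + 3) =
    1.\<close>
  have Xact: "scalar x' * mat_act m ?X (mat2 x' 0 g' 1) = scalar (\<theta>' ^ 2) * ?X"
  proof -
    have "scalar x' * mat_act m ?X (mat2 x' 0 g' 1) = scalar x' * (scalar x' * lin 1 0) ^ m"
      by (simp add: mat_act_lin_power lin_scalar)
    also have "\<dots> = scalar (x' ^ (m + 1)) * ?X"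
      by (simp add: power_mult_distrib scalar_power)
    finally show ?thesis using power_inverse_weights(2)[OF \<theta>(2)] by (simp only: x'_def)
  qed
  have V: "scalar x' * mat_act m (vv g - scalar (\<epsilon> * \<theta> / 2) * ?X) (mat2 x' 0 g' 1)
      = vv G - vv g' - scalar (\<epsilon> * \<theta> / 2 * \<theta>' ^ 2) * ?X"
  proof -
    have "scalar x' * mat_act m (vv g - scalar (\<epsilon> * \<theta> / 2) * ?X) (mat2 x' 0 g' 1)
       = scalar x' * mat_act m (vv g) (mat2 x' 0 g' 1)
         - scalar (\<epsilon> * \<theta> / 2) * (scalar x' * mat_act m ?X (mat2 x' 0 g' 1))"
      unfolding mat_act_diff mat_act_scalar by (simp only: right_diff_distrib mult.left_commute)
    then show ?thesis
      unfolding Xact act_lower_vv by (simp only: G_def scalar_simps mult.assoc)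
  qed
  have fX: "form m v ?X = coeff_XY v 0 m" for v by (simp add: X_power)
  have fX': "form m ?X v = - coeff_XY v 0 m" for v
    using form_skew[OF odd_m, of v ?X] by (simp add: fX)
  \<comment> \<open>The \<open>yy\<close> terms come from the cocycle identity. Pairing with X^m
    only reads off coefficients of Y^m, and that of \<open>vv s\<close> is s.\<close>
  have F: "form m (vv G - vv g' - scalar (\<epsilon> * \<theta> / 2 * \<theta>' ^ 2) * ?X) (vv g' - scalar (\<epsilon>' * \<theta>' / 2) * ?X)
      = yy G - yy (g * x') - yy g' - \<epsilon>' * \<theta>' / 2 * (G - g') + \<epsilon> * \<theta> / 2 * \<theta>' ^ 2 * g'"
    using yy_cocycle[of "g * x'" g'] by (simp add: fX fX' form_skew[OF odd_m, of "vv g'" "vv G"] flip: G_def)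
  have y: "yy (g * x') = \<theta>' * yy g" unfolding x'_def by (rule yy_scale[OF \<theta>(2)])
  have w: "x'\<^sup>2 * x' ^ m = \<theta>'"
    using power_inverse_weights(1)[OF \<theta>(2)] by (simp add: x'_def power_add power2_eq_square mult_ac)
  have "\<Psi> (C_mat \<alpha> \<theta> \<delta> \<epsilon>) \<otimes>\<^bsub>P\<^esub> \<Psi> (C_mat \<alpha>' \<theta>' \<delta>' \<epsilon>')
     = ((x * x', mat2 (x * x') 0 G 1),
        (vv G - vv g' - scalar (\<epsilon> * \<theta> / 2 * \<theta>' ^ 2) * ?X + (vv g' - scalar (\<epsilon>' * \<theta>' / 2) * ?X),
         \<theta>' * (yy g + \<theta> * \<delta> - \<epsilon> * \<alpha> / 2) + (yy g' + \<theta>' * \<delta>' - \<epsilon>' * \<alpha>' / 2)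
         + (yy G - yy (g * x') - yy g' - \<epsilon>' * \<theta>' / 2 * (G - g') + \<epsilon> * \<theta> / 2 * \<theta>' ^ 2 * g')))"
    unfolding \<Psi>_C_mat x_def[symmetric] x'_def[symmetric] g_def[symmetric] g'_def[symmetric] P_mult V
      form_linear(3)[symmetric] F det_mat2
    by (simp add: w G_def)
  also have "\<dots> = \<Psi> (C_mat \<alpha> \<theta> \<delta> \<epsilon> ** C_mat \<alpha>' \<theta>' \<delta>' \<epsilon>')"
  proof -
    have X: "vv G - vv g' - scalar p * ?X + (vv g' - scalar q * ?X) = vv G - scalar (p + q) * ?X" for p q
      by (simp add: algebra_simps)
    have "\<epsilon> * \<theta> / 2 * \<theta>'\<^sup>2 + \<epsilon>' * \<theta>' / 2 = (\<epsilon> * \<theta>' + inverse \<theta> * \<epsilon>') * (\<theta> * \<theta>') / 2"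
      using \<theta> by (simp add: field_simps power2_eq_square)
    then have 1: "vv G - vv g' - scalar (\<epsilon> * \<theta> / 2 * \<theta>' ^ 2) * ?X + (vv g' - scalar (\<epsilon>' * \<theta>' / 2) * ?X)
       = vv G - scalar ((\<epsilon> * \<theta>' + inverse \<theta> * \<epsilon>') * (\<theta> * \<theta>') / 2) * ?X"
      unfolding X by (simp only:)
    \<comment> \<open>In these two combinations the inverse of \<theta>' cancels; they are isolated
      below so that the central coordinates can be compared.\<close>
    have Gg: "\<theta>' * (G - g') = \<alpha> * inverse \<theta>" "\<theta>' ^ 2 * g' = \<theta>' * \<alpha>'"
      using \<theta> by (simp_all add: G_def g_def g'_def x_def x'_def power2_eq_square)
    have "\<theta>' * (yy g + \<theta> * \<delta> - \<epsilon> * \<alpha> / 2) + (yy g' + \<theta>' * \<delta>' - \<epsilon>' * \<alpha>' / 2)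
         + (yy G - yy (g * x') - yy g' - \<epsilon>' * \<theta>' / 2 * (G - g') + \<epsilon> * \<theta> / 2 * \<theta>' ^ 2 * g')
       = yy G + \<theta>' * (\<theta> * \<delta> - \<epsilon> * \<alpha> / 2) + \<theta>' * \<delta>' - \<epsilon>' * \<alpha>' / 2
         - \<epsilon>' / 2 * (\<theta>' * (G - g')) + \<epsilon> * \<theta> / 2 * (\<theta>' ^ 2 * g')"
    proof -
      have "\<theta>' * (a + b - q) + (a' + b' - r) + (c - \<theta>' * a - a' - u * \<theta>' * (G - g') + k * \<theta>' ^ 2 * g')
        = c + \<theta>' * (b - q) + b' - r - u * (\<theta>' * (G - g')) + k * (\<theta>' ^ 2 * g')" for a b q a' b' r c u k
        by (simp add: algebra_simps)
      from this[of "yy g" "\<theta> * \<delta>" "\<epsilon> * \<alpha> / 2" "yy g'" "\<theta>' * \<delta>'" "\<epsilon>' * \<alpha>' / 2" "yy G" "\<epsilon>' / 2" "\<epsilon> * \<theta> / 2"]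
      show ?thesis unfolding y by (simp only: times_divide_eq_left)
    qed
    also have "\<dots> = yy G + \<theta> * \<theta>' * (\<delta> + \<epsilon> * \<alpha>' + inverse \<theta> * \<delta>') - (\<epsilon> * \<theta>' + inverse \<theta> * \<epsilon>') * (\<alpha> + \<theta> * \<alpha>') / 2"
    proof -
      have "c + \<theta>' * (\<theta> * \<delta> - h * \<alpha>) + \<theta>' * \<delta>' - h' * \<alpha>' - h' * (\<alpha> * inverse \<theta>) + h * \<theta> * (\<theta>' * \<alpha>')
        = c + \<theta> * \<theta>' * (\<delta> + e * \<alpha>' + inverse \<theta> * \<delta>') - (h * \<theta>' + inverse \<theta> * h') * (\<alpha> + \<theta> * \<alpha>')"
        if "e = 2 * h" for c h h' e
        using \<theta> that by (simp add: field_simps)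
      from this[of \<epsilon> "\<epsilon> / 2" "yy G" "\<epsilon>' / 2"] show ?thesis
        unfolding Gg by (simp add: add_divide_distrib)
    qed
    finally show ?thesis
      unfolding 1 C_mat_mult \<Psi>_C_mat G[symmetric] xx'[symmetric] by simp
  qed
  finally show ?thesis .
qed

lemma \<Psi>_hom: "\<Psi> \<in> hom C_group P"
proof (rule homI)
  show "\<Psi> c \<in> carrier P" if "c \<in> carrier C_group" for c
    using that \<Psi>_carrier by (elim C_group_cases) simp
  show "\<Psi> (c \<otimes>\<^bsub>C_group\<^esub> c') = \<Psi> c \<otimes>\<^bsub>P\<^esub> \<Psi> c'" if "c \<in> carrier C_group" "c' \<in> carrier C_group" for c c'
    using that \<Psi>_mult by (elim C_group_cases) (simp del: C_mat_mult)
qed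

lemma \<Psi>_center:
  assumes "c \<in> carrier C_group" "\<Psi> c \<in> center P"
  shows "c = C_mat 0 1 0 0"
proof -
  obtain \<alpha> \<theta> \<delta> \<epsilon> where c: "c = C_mat \<alpha> \<theta> \<delta> \<epsilon>" "\<theta> \<noteq> 0" using assms(1) by (rule C_group_cases)
  obtain l where l: "\<Psi> c = ((inverse (l ^ m), mat2 l 0 0 l), (0, 0))"
    using assms(2) by (auto simp: center_P)
  then have \<alpha>\<theta>: "\<alpha> = 0" "\<theta> = 1" using c(2) unfolding c \<Psi>_C_mat by (auto simp: field_simps)
  then have "scalar (\<epsilon> / 2) * lin 1 0 ^ m = 0" and \<delta>: "\<delta> = 0"
    using l unfolding c \<Psi>_C_mat by simp_all
  then have "coeff_XY (scalar (\<epsilon> / 2) * lin 1 0 ^ m) m 0 = coeff_XY 0 m 0" by (simp only:)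
  then have "\<epsilon> = 0" unfolding coeff_XY_simps coeff_XY_lin_power_ends by simp
  with \<alpha>\<theta> \<delta> c show ?thesis by simp
qed

lemma W_normal:
  assumes "c \<in> carrier (C_group :: ('f^3^3) monoid)" "w \<in> W_subgroup"
  shows "\<exists>w'\<in>W_subgroup. c ** w = w' ** c" "\<exists>w'\<in>W_subgroup. w ** c = c ** w'"
proof -
  obtain \<alpha> \<theta> \<delta> \<epsilon> where c: "c = C_mat \<alpha> \<theta> \<delta> \<epsilon>" "\<theta> \<noteq> 0" using assms(1) by (rule C_group_cases)
  obtain a d where w: "w = C_mat a 1 d 0" using assms(2) by (auto simp: W_subgroup_def)
  show "\<exists>w'\<in>W_subgroup. c ** w = w' ** c"
    by (rule bexI[of _ "C_mat (\<theta> * a) 1 (\<epsilon> * a + inverse \<theta> * d) 0"]) (simp_all add: c w algebra_simps)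
  show "\<exists>w'\<in>W_subgroup. w ** c = c ** w'"
    using c(2) by (intro bexI[of _ "C_mat (a / \<theta>) 1 (\<theta> * (d - \<epsilon> * (a / \<theta>))) 0"]) (simp_all add: c w field_simps)
qed

lemma subgroup_W: "subgroup W_subgroup (C_group :: ('f^3^3) monoid)"
proof -
  interpret C: group "C_group :: ('f^3^3) monoid" by (rule group_C_group)
  show ?thesis
  proof (rule C.subgroupI)
    show "W_subgroup \<subseteq> carrier (C_group :: ('f^3^3) monoid)" by (auto simp: W_subgroup_def)
    show "W_subgroup \<noteq> {}" by (auto simp: W_subgroup_def)
    show "inv\<^bsub>C_group\<^esub> w \<in> W_subgroup" if wW: "w \<in> W_subgroup" for w :: "'f^3^3"
    proof -
      obtain a d where w: "w = C_mat a 1 d 0" using wW by (auto simp: W_subgroup_def)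
      have "inv\<^bsub>C_group\<^esub> w = C_mat (- a) 1 (- d) 0"
        by (rule C.inv_equality) (simp_all add: w)
      then show ?thesis by simp
    qed
    show "v \<otimes>\<^bsub>C_group\<^esub> w \<in> W_subgroup" if "v \<in> W_subgroup" "w \<in> W_subgroup" for v w :: "'f^3^3"
      using that by (auto simp: W_subgroup_def)
  qed
qed

section \<open>The image of W and its normalizer in P\<close>

abbreviation "W0 \<equiv> \<Psi> ` W_subgroup"
abbreviation "K \<equiv> W0 <#>\<^bsub>P\<^esub> center P"

lemma subgroup_W0: "subgroup W0 P"
proof -
  interpret group_hom C_group P \<Psi>
    by (intro group_hom.intro group_hom_axioms.intro group_C_group group_P \<Psi>_hom)
  show ?thesis by (rule subgroup_img_is_subgroup[OF subgroup_W])
qed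

lemma card_W0: "card W0 = CHAR('f) ^ 2"
proof -
  have "W0 = (\<lambda>(\<alpha>, \<delta>). \<Psi> (C_mat \<alpha> 1 \<delta> 0)) ` UNIV"
    by (force simp: W_subgroup_def)
  also have "card \<dots> = CARD('f \<times> 'f)"
    by (rule card_image) (auto simp: inj_on_def \<Psi>_C_mat)
  finally show ?thesis by (simp add: card char power2_eq_square)
qed

lemma K_carrier: "K \<subseteq> carrier P"
  using subgroup.subset[OF P.set_mult_center(1)[OF subgroup_W0]] .

lemma W_in_C: "w \<in> W_subgroup \<Longrightarrow> w \<in> carrier (C_group :: ('f^3^3) monoid)"
  using subgroup.subset[OF subgroup_W] by blast

text \<open>W is normal in C, and the factor from Z(P) commutes with everything.\<close>

lemma \<Psi>_normalizes:
  assumes c: "c \<in> carrier C_group"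
  shows "\<Psi> c \<in> normalizer P K"
proof (rule P.normalizer_I[OF K_carrier])
  have \<Psi>c: "\<Psi> c \<in> carrier P" if "c \<in> carrier C_group" for c using \<Psi>_hom that by (auto simp: hom_def)
  have \<Psi>m: "\<Psi> (c ** d) = \<Psi> c \<otimes>\<^bsub>P\<^esub> \<Psi> d" if "c \<in> carrier C_group" "d \<in> carrier C_group" for c d
    using \<Psi>_hom that by (auto simp: hom_def)
  show cc: "\<Psi> c \<in> carrier P" by (rule \<Psi>c[OF c])
  fix k assume "k \<in> K"
  then obtain w z where w: "w \<in> W_subgroup" "z \<in> center P" "k = \<Psi> w \<otimes>\<^bsub>P\<^esub> z" by (auto simp: set_mult_def)
  note wc = \<Psi>c[OF W_in_C[OF w(1)]] and zc = P.center_closed[OF w(2)]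
  obtain w' where w': "w' \<in> W_subgroup" "c ** w = w' ** c" using W_normal(1)[OF c w(1)] by blast
  have "\<Psi> c \<otimes>\<^bsub>P\<^esub> k = \<Psi> (c ** w) \<otimes>\<^bsub>P\<^esub> z"
    using P.m_assoc[OF cc wc zc] \<Psi>m[OF c W_in_C[OF w(1)]] by (simp add: w(3))
  also have "\<dots> = \<Psi> w' \<otimes>\<^bsub>P\<^esub> (\<Psi> c \<otimes>\<^bsub>P\<^esub> z)"
    using P.m_assoc[OF \<Psi>c[OF W_in_C[OF w'(1)]] cc zc] \<Psi>m[OF W_in_C[OF w'(1)] c] by (simp add: w'(2))
  also have "\<dots> = (\<Psi> w' \<otimes>\<^bsub>P\<^esub> z) \<otimes>\<^bsub>P\<^esub> \<Psi> c"
    using P.m_assoc[OF \<Psi>c[OF W_in_C[OF w'(1)]] zc cc] P.center_commute[OF w(2) cc] by simp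
  finally show "\<exists>k'\<in>K. \<Psi> c \<otimes>\<^bsub>P\<^esub> k = k' \<otimes>\<^bsub>P\<^esub> \<Psi> c"
    using w'(1) w(2) by (auto simp: set_mult_def)
  obtain w' where w': "w' \<in> W_subgroup" "w ** c = c ** w'" using W_normal(2)[OF c w(1)] by blast
  have "k \<otimes>\<^bsub>P\<^esub> \<Psi> c = \<Psi> w \<otimes>\<^bsub>P\<^esub> (\<Psi> c \<otimes>\<^bsub>P\<^esub> z)"
    using P.m_assoc[OF wc zc cc] P.center_commute[OF w(2) cc] by (simp add: w(3))
  also have "\<dots> = \<Psi> (w ** c) \<otimes>\<^bsub>P\<^esub> z"
    using P.m_assoc[OF wc cc zc] \<Psi>m[OF W_in_C[OF w(1)] c] by simp
  also have "\<dots> = \<Psi> c \<otimes>\<^bsub>P\<^esub> (\<Psi> w' \<otimes>\<^bsub>P\<^esub> z)"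
    using P.m_assoc[OF cc \<Psi>c[OF W_in_C[OF w'(1)]] zc] \<Psi>m[OF c W_in_C[OF w'(1)]] by (simp add: w'(2))
  finally show "\<exists>k'\<in>K. k \<otimes>\<^bsub>P\<^esub> \<Psi> c = \<Psi> c \<otimes>\<^bsub>P\<^esub> k'"
    using w'(1) w(2) by (auto simp: set_mult_def)
qed

text \<open>The conjugate of a single shear element already determines n: it forces b = 0 and t d^m
  = a / d, and after removal of a central factor the V-part differs from \<open>vv c'\<close> by a
  vector fixed by a nontrivial shear, that is, by a multiple of X^m.\<close>

lemma normalizer_subset: "normalizer P K \<subseteq> \<Psi> ` carrier C_group <#>\<^bsub>P\<^esub> center P"
proof
  fix n assume n: "n \<in> normalizer P K"
  then have "n \<in> carrier P" using K_carrier by (auto simp: P.normalizer_eq)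
  then obtain t a b c d v z where ne: "n = ((t, mat2 a b c d), (v, z))"
    and nz: "t \<noteq> 0" "a * d - b * c \<noteq> 0" "v \<in> hom_polys m" by (rule P_cases)
  have "\<Psi> (C_mat 1 1 0 0) \<in> W0" by (intro imageI) simp
  then have "\<Psi> (C_mat 1 1 0 0) \<in> K" using P.set_mult_center(2)[OF subgroup_W0] by blast
  with n obtain k where k: "k \<in> K" "\<Psi> (C_mat 1 1 0 0) \<otimes>\<^bsub>P\<^esub> n = n \<otimes>\<^bsub>P\<^esub> k"
    using P.normalizer_D[OF K_carrier] by blast
  then obtain w e where w: "w \<in> W_subgroup" "e \<in> center P" "k = \<Psi> w \<otimes>\<^bsub>P\<^esub> e" by (auto simp: set_mult_def)
  obtain g \<delta>' where we: "w = C_mat g 1 \<delta>' 0" using w(1) by (auto simp: W_subgroup_def)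
  obtain l where l: "e = ((inverse (l ^ m), mat2 l 0 0 l), (0, 0))" "l \<noteq> 0"
    using w(2) by (auto simp: center_P)
  have eqs: "b = b * l" "a + c = c * l + d * (g * l)" "b + d = d * l"
    and V: "scalar t * mat_act m (vv 1) (mat2 a b c d) + v
      = scalar (inverse (l ^ m)) * mat_act m v (mat2 l 0 (g * l) l)
        + scalar (inverse (l ^ m)) * mat_act m (vv g) (mat2 l 0 0 l)"
    using k(2) nz by (simp_all add: w(3) we l \<Psi>_C_mat ne P_mult)
  have b: "b = 0"
  proof (rule ccontr)
    assume "b \<noteq> 0"
    then have "l = 1" using eqs(1) by simp
    then show False using eqs(3) \<open>b \<noteq> 0\<close> by simp
  qed
  then have ad: "a \<noteq> 0" "d \<noteq> 0" using nz by auto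
  then have l1: "l = 1" using eqs(3) b by simp
  define x where "x = a / d"
  have x: "x \<noteq> 0" using ad by (simp add: x_def)
  have g: "g = x" using eqs(2) ad by (simp add: l1 x_def field_simps)
  have V: "scalar t * mat_act m (vv 1) (mat2 a 0 c d) + v = mat_act m v (mat2 1 0 x 1) + vv x"
    using V by (simp add: l1 b g)
  then have "coeff_XY (scalar t * mat_act m (vv 1) (mat2 a 0 c d) + v) 0 m
      = coeff_XY (mat_act m v (mat2 1 0 x 1) + vv x) 0 m" by (simp only:)
  then have "t * d ^ m = x"
    unfolding coeff_XY_simps act_top[OF vv_hom] act_top[OF nz(3)] by simp
  then have t: "t = x * inverse (d ^ m)" using ad by (simp add: field_simps)
  define c' where "c' = c / d"
  \<comment> \<open>Splitting off the scalar d, later the central factor \<open>e0\<close>, reduces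
    to d = 1, where t becomes x.\<close>
  have A: "mat2 a 0 c d = mat2 x 0 c' 1 ** mat2 d 0 0 d" using ad by (simp add: x_def c'_def)
  have "scalar t * mat_act m (vv 1) (mat2 a 0 c d)
      = scalar (x * inverse (d ^ m)) * (scalar (d ^ m) * mat_act m (vv 1) (mat2 x 0 c' 1))"
    unfolding A act_mult[OF vv_hom, symmetric] act_scalar[OF mat_act_in_hom_polys] t ..
  also have "\<dots> = scalar (x * inverse (d ^ m) * d ^ m) * mat_act m (vv 1) (mat2 x 0 c' 1)"
    by (simp only: scalar_simps(5) mult.assoc)
  also have "\<dots> = vv (x + c') - vv c'"
  proof -
    have "x * inverse (d ^ m) * d ^ m = x" using ad by simp
    then show ?thesis using act_lower_vv[of x 1 c'] by (simp only: mult_1)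
  qed
  finally have "vv (x + c') - vv c' + v = mat_act m v (mat2 1 0 x 1) + vv x" using V by simp
  then have "mat_act m (v - vv c') (mat2 1 0 x 1) = v - vv c'"
    by (simp add: vv_shear algebra_simps)
  then obtain r where "v - vv c' = scalar r * lin 1 0 ^ m"
    using shear_fixed[of "v - vv c'" x] nz(3) x by auto
  then have v: "v = vv c' + scalar r * lin 1 0 ^ m" by (simp add: algebra_simps)
  define \<theta> where "\<theta> = inverse x"
  define \<alpha> where "\<alpha> = c' * \<theta>"
  \<comment> \<open>\<epsilon> and \<delta> are solved from \<open>\<Psi>_C_mat\<close>, where the
    coefficient of X^m has to be r and the central coordinate z.\<close>
  define \<epsilon> where "\<epsilon> = - 2 * r / \<theta>"
  define \<delta> where "\<delta> = (z - yy c' + \<epsilon> * \<alpha> / 2) / \<theta>"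
  have \<theta>: "\<theta> \<noteq> 0" using x by (simp add: \<theta>_def)
  have "\<epsilon> * \<theta> / 2 = - r" "\<alpha> * inverse \<theta> = c'" "inverse \<theta> = x" "yy c' + \<theta> * \<delta> - \<epsilon> * \<alpha> / 2 = z"
    using \<theta> by (simp_all add: \<epsilon>_def \<alpha>_def \<theta>_def \<delta>_def)
  then have \<Psi>c: "\<Psi> (C_mat \<alpha> \<theta> \<delta> \<epsilon>) = ((x, mat2 x 0 c' 1), (v, z))"
    unfolding \<Psi>_C_mat v by simp
  define e0 :: "('f \<times> ('f^2^2)) \<times> ('f poly poly \<times> 'f)" where "e0 = ((inverse (d ^ m), mat2 d 0 0 d), (0, 0))"
  have "scalar (inverse (d ^ m)) * (scalar (d ^ m) * v) = v"
    using ad by (simp flip: scalar_simps mult.assoc)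
  moreover have "(inverse (d ^ m))\<^sup>2 * (d * d) ^ m = 1"
    using ad by (simp add: power_mult_distrib power2_eq_square field_simps)
  ultimately have "n = \<Psi> (C_mat \<alpha> \<theta> \<delta> \<epsilon>) \<otimes>\<^bsub>P\<^esub> e0"
    unfolding \<Psi>c e0_def P_mult act_scalar[OF nz(3)] det_mat2 ne b A t by simp
  moreover have "e0 \<in> center P" using ad by (auto simp: center_P e0_def)
  ultimately show "n \<in> \<Psi> ` carrier C_group <#>\<^bsub>P\<^esub> center P"
    using \<theta> unfolding set_mult_def by auto
qed

lemma condition_sufficient:
  "\<exists>W0 h. p_subgroup (m + 4) W0 P \<and>
    h \<in> iso ((P Mod center P)\<lparr>carrier := normalizer (P Mod center P) (image_Mod P W0 (center P))\<rparr>)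
      (C_group :: ('f^3^3) monoid) \<and>
    h ` image_Mod P W0 (center P) = W_subgroup"
proof -
  have sub: "\<Psi> ` carrier C_group <#>\<^bsub>P\<^esub> center P \<subseteq> normalizer P K"
  proof
    fix n assume "n \<in> \<Psi> ` carrier C_group <#>\<^bsub>P\<^esub> center P"
    then obtain c e where n: "c \<in> carrier C_group" "e \<in> center P" "n = \<Psi> c \<otimes>\<^bsub>P\<^esub> e"
      by (auto simp: set_mult_def)
    have "e \<in> normalizer P K"
    proof (rule P.normalizer_I[OF K_carrier P.center_closed[OF n(2)]])
      fix k assume k: "k \<in> K"
      then have ek: "e \<otimes>\<^bsub>P\<^esub> k = k \<otimes>\<^bsub>P\<^esub> e" using P.center_commute[OF n(2)] K_carrier by blast
      show "\<exists>k'\<in>K. e \<otimes>\<^bsub>P\<^esub> k = k' \<otimes>\<^bsub>P\<^esub> e" using ek k by (intro bexI[of _ k])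
      show "\<exists>k'\<in>K. k \<otimes>\<^bsub>P\<^esub> e = e \<otimes>\<^bsub>P\<^esub> k'" using ek k by (intro bexI[of _ k]) simp
    qed
    then show "n \<in> normalizer P K"
      unfolding n(3) using \<Psi>_normalizes[OF n(1)] P.normalizer_imp_subgroup[OF K_carrier]
      by (intro subgroup.m_closed)
  qed
  have "\<exists>h. h \<in> iso ((P Mod center P)\<lparr>carrier := normalizer (P Mod center P) (image_Mod P W0 (center P))\<rparr>)
      (C_group :: ('f^3^3) monoid) \<and> h ` image_Mod P W0 (center P) = W_subgroup"
  proof (rule P.iso_from_section[OF group_C_group \<Psi>_hom _ subgroup_W0 refl])
    show "W_subgroup \<subseteq> carrier (C_group :: ('f^3^3) monoid)" using W_in_C by blast
    show "c = \<one>\<^bsub>C_group\<^esub>" if "c \<in> carrier C_group" "\<Psi> c \<in> center P" for c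
      using \<Psi>_center[OF that] by simp
    show "normalizer P K = \<Psi> ` carrier C_group <#>\<^bsub>P\<^esub> center P"
      using sub normalizer_subset by blast
  qed
  moreover have "p_subgroup (m + 4) W0 P"
    using subgroup_W0 card_W0 by (auto simp: p_subgroup_def char)
  ultimately show ?thesis by blast
qed

end

theorem theorem2p9:
  fixes p m :: nat
    and P :: "(('f::{field,finite} \<times> ('f^2^2)) \<times> ('f poly poly \<times> 'f)) monoid"
  assumes "prime p" and "odd p"
    and "CHAR('f) = p"
    and "odd m" and "1 \<le> m" and "m \<le> p - 1"
  defines "P \<equiv> P_group m"
  shows "(\<exists>W0 h. p_subgroup p W0 P \<and>
            h \<in> iso ((P Mod center P)
                      \<lparr>carrier := normalizer (P Mod center P) (image_Mod P W0 (center P))\<rparr>)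
                    (C_group :: ('f^3^3) monoid) \<and>
            h ` image_Mod P W0 (center P) = W_subgroup)
         \<longleftrightarrow> CARD('f) = p \<and> p = m + 4"
proof -
  \<comment> \<open>p - 1 is even and m is odd, which sharpens the bound to m + 2 \<le> p.\<close>
  have "m \<noteq> p - 1" using \<open>odd p\<close> \<open>odd m\<close> by auto
  then have less: "m + 2 \<le> p" using \<open>m \<le> p - 1\<close> by simp
  interpret parabolic m "TYPE('f)"
    by unfold_locales (use less \<open>odd m\<close> \<open>CHAR('f) = p\<close> in auto)
  show ?thesis
  proof
    assume "\<exists>W0 h. p_subgroup p W0 P \<and>
            h \<in> iso ((P Mod center P)
                      \<lparr>carrier := normalizer (P Mod center P) (image_Mod P W0 (center P))\<rparr>)
                    (C_group :: ('f^3^3) monoid) \<and>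
            h ` image_Mod P W0 (center P) = W_subgroup"
    then show "CARD('f) = p \<and> p = m + 4"
      using condition_necessary unfolding P_def \<open>CHAR('f) = p\<close> by blast
  next
    assume "CARD('f) = p \<and> p = m + 4"
    then interpret parabolic_prime m "TYPE('f)"
      using \<open>CHAR('f) = p\<close> by unfold_locales simp_all
    show "\<exists>W0 h. p_subgroup p W0 P \<and>
            h \<in> iso ((P Mod center P)
                      \<lparr>carrier := normalizer (P Mod center P) (image_Mod P W0 (center P))\<rparr>)
                    (C_group :: ('f^3^3) monoid) \<and>
            h ` image_Mod P W0 (center P) = W_subgroup"
      using condition_sufficient \<open>CARD('f) = p \<and> p = m + 4\<close> unfolding P_def by simp
  qed
qed

end
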